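(* Let $\widehat{H}_{r,n}^{\mathcal{R}}:=\mathcal{R}\otimes_{\mathcal{A}}\widehat{H}_{r,n}$. Then there is an $\mathcal{R}$-algebra isomorphism $\widehat{Y}_{r,n}\xrightarrow{\sim}\widehat{H}_{r,n}^{\mathcal{R}}$. Moreover, the set $$\{X_1^{\alpha_1}\cdots X_n^{\alpha_n}1_\lambda g_w \mid \alpha_1,\dots,\alpha_n\in\mathbb{Z},\ \lambda\in\underline{\mathfrak{s}}_n,\ w\in\mathfrak{S}_n\}$$ is an $\mathcal{A}$-basis of $\widehat{H}_{r,n}$.
   Context: Let $r,n\ge 1$, $\zeta=e^{2\pi i/r}$, $q$ an indeterminate, $\mathcal{R}=\mathbb{Z}[\frac1r][q,q^{-1},\zeta]$ and $\mathcal{A}=\mathbb{Z}[q,q^{-1}]$. Let $s_i=(i,i+1)\in\mathfrak{S}_n$. The affine Yokonuma–Hecke algebra $\widehat{Y}_{r,n}$ is the $\mathcal{R}$-algebra generated by $t_1,\dots,t_n,h_1,\dots,h_{n-1},Y_1^{\pm1}$ with relations: $h_ih_j=h_jh_i$ for $|i-j|\ge2$; $h_ih_{i+1}h_i=h_{i+1}h_ih_{i+1}$; $t_it_j=t_jt_i$; $h_it_j=t_{s_i(j)}h_i$; $t_i^r=1$; $h_i^2=1+(q-q^{-1})e_ih_i$ where $e_i=\frac1r\sum_{s=0}^{r-1}t_i^st_{i+1}^{-s}$; $Y_1Y_1^{-1}=Y_1^{-1}Y_1=1$; $h_1Y_1h_1Y_1=Y_1h_1Y_1h_1$; $h_iY_1=Y_1h_i$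 for $2\le i\le n-1$; $t_jY_1=Y_1t_j$ for all $j$. Set $\zeta_k:=\zeta^{k-1}$ ($1\le k\le r$) and let $\underline{\mathfrak{s}}_n$ be the set of $n$-tuples of $r$-th roots of unity, with $\mathfrak{S}_n$ acting by permuting entries; for $\lambda\in\underline{\mathfrak{s}}_n$ let $W_\lambda=\{w\in\mathfrak{S}_n\mid w(\lambda)=\lambda\}$. $\widehat{H}_{r,n}$ is the $\mathcal{A}$-algebra generated by $g_1,\dots,g_{n-1}$, $1_\lambda$ ($\lambda\in\underline{\mathfrak{s}}_n$), $X_1^{\pm1}$ with relations: $g_ig_j=g_jg_i$ for $|i-j|\ge2$; $g_ig_{i+1}g_i=g_{i+1}g_ig_{i+1}$; $g_i1_\lambda=1_{s_i(\lambda)}g_i$; $\sum_{\lambda}1_\lambda=1$; $1_\lambda1_{\lambda'}=\delta_{\lambda,\lambda'}1_\lambda$; $g_i^2=1+(q-q^{-1})\sum_{\lambda:\,s_i\in W_\lambda}g_i1_\lambda$; $X_1X_1^{-1}=X_1^{-1}X_1=1$; $g_1X_1g_1X_1=X_1g_1X_1g_1$; $g_iX_1=X_1g_i$ for $2\le i\le n-1$; $X_11_\lambda=1_\lambda X_1$. Define $X_{i+1}:=g_iX_ig_i$ for $1\le i\le n-1$, and for $w\in\mathfrak{S}_n$ with reduced expression $w=s_{i_1}\cdots s_{i_m}$ set $g_w:=g_{i_1}\cdots g_{i_m}$ (independent of the reduced expression). *)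

theory Defs
  imports Complex_Main "HOL-Algebra.QuotRing" "HOL-Library.Poly_Mapping"
          "HOL-Combinatorics.Permutations"
begin

text \<open>An element of the free algebra on a generator type 'g with coefficients in
 a commutative ring 'k is a finitely supported function from words to 'k.
 A coefficient subring K and a set of admissible generators Gen are carried along.\<close>

definition fa :: "'g set \<Rightarrow> 'k set \<Rightarrow> ('g list \<Rightarrow> 'k::comm_ring_1) set" where
  "fa Gen K = {p. finite {w. p w \<noteq> 0} \<and> (\<forall>w. p w \<in> K) \<and> (\<forall>w. p w \<noteq> 0 \<longrightarrow> set w \<subseteq> Gen)}"

definition fw :: "'g list \<Rightarrow> ('g list \<Rightarrow> 'k::comm_ring_1)" where
  "fw u = (\<lambda>v. if v = u then 1 else 0)"

definition fadd :: "('g list \<Rightarrow> 'k::comm_ring_1) \<Rightarrow> ('g list \<Rightarrow> 'k) \<Rightarrow> ('g list \<Rightarrow> 'k)" where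
  "fadd p q = (\<lambda>w. p w + q w)"

definition fsub :: "('g list \<Rightarrow> 'k::comm_ring_1) \<Rightarrow> ('g list \<Rightarrow> 'k) \<Rightarrow> ('g list \<Rightarrow> 'k)" where
  "fsub p q = (\<lambda>w. p w - q w)"

definition fsc :: "'k::comm_ring_1 \<Rightarrow> ('g list \<Rightarrow> 'k) \<Rightarrow> ('g list \<Rightarrow> 'k)" where
  "fsc c p = (\<lambda>w. c * p w)"

definition fmul :: "('g list \<Rightarrow> 'k::comm_ring_1) \<Rightarrow> ('g list \<Rightarrow> 'k) \<Rightarrow> ('g list \<Rightarrow> 'k)" where
  "fmul p q = (\<lambda>w. \<Sum>i\<le>length w. p (take i w) * q (drop i w))"

definition fsum :: "('i \<Rightarrow> ('g list \<Rightarrow> 'k::comm_ring_1)) \<Rightarrow> 'i set \<Rightarrow> ('g list \<Rightarrow> 'k)" where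
  "fsum f I = (\<lambda>w. \<Sum>i\<in>I. f i w)"

abbreviation fg :: "'g \<Rightarrow> ('g list \<Rightarrow> 'k::comm_ring_1)" where
  "fg g \<equiv> fw [g]"

definition fprod :: "('g list \<Rightarrow> 'k::comm_ring_1) list \<Rightarrow> ('g list \<Rightarrow> 'k)" where
  "fprod xs = foldr fmul xs (fw [])"

inductive_set fa_ideal :: "'g set \<Rightarrow> 'k set \<Rightarrow> ('g list \<Rightarrow> 'k::comm_ring_1) set \<Rightarrow> ('g list \<Rightarrow> 'k) set"
  for Gen K Rel where
  zero: "(\<lambda>w. 0) \<in> fa_ideal Gen K Rel"
| gen: "\<rho> \<in> Rel \<Longrightarrow> a \<in> fa Gen K \<Longrightarrow> b \<in> fa Gen K \<Longrightarrow> fmul (fmul a \<rho>) b \<in> fa_ideal Gen K Rel"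
| add: "x \<in> fa_ideal Gen K Rel \<Longrightarrow> y \<in> fa_ideal Gen K Rel \<Longrightarrow> fadd x y \<in> fa_ideal Gen K Rel"
| neg: "x \<in> fa_ideal Gen K Rel \<Longrightarrow> (\<lambda>w. - x w) \<in> fa_ideal Gen K Rel"

definition fa_cls :: "'g set \<Rightarrow> 'k set \<Rightarrow> ('g list \<Rightarrow> 'k::comm_ring_1) set \<Rightarrow> ('g list \<Rightarrow> 'k) \<Rightarrow> ('g list \<Rightarrow> 'k) set" where
  "fa_cls Gen K Rel x = {y \<in> fa Gen K. fsub x y \<in> fa_ideal Gen K Rel}"

definition pres :: "'g set \<Rightarrow> 'k set \<Rightarrow> ('g list \<Rightarrow> 'k::comm_ring_1) set \<Rightarrow> ('g list \<Rightarrow> 'k) set ring" where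
  "pres Gen K Rel =
     \<lparr>partial_object.carrier = fa_cls Gen K Rel ` fa Gen K,
      monoid.mult = (\<lambda>A B. fa_cls Gen K Rel (fmul (SOME x. x \<in> A) (SOME y. y \<in> B))),
      monoid.one = fa_cls Gen K Rel (fw []),
      ring.zero = fa_cls Gen K Rel (\<lambda>w. 0),
      ring.add = (\<lambda>A B. fa_cls Gen K Rel (fadd (SOME x. x \<in> A) (SOME y. y \<in> B)))\<rparr>"

definition psc :: "'g set \<Rightarrow> 'k set \<Rightarrow> ('g list \<Rightarrow> 'k::comm_ring_1) set \<Rightarrow> 'k \<Rightarrow> ('g list \<Rightarrow> 'k) set \<Rightarrow> ('g list \<Rightarrow> 'k) set" where
  "psc Gen K Rel c A = fa_cls Gen K Rel (fsc c (SOME x. x \<in> A))"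

definition pgen :: "'g set \<Rightarrow> 'k set \<Rightarrow> ('g list \<Rightarrow> 'k::comm_ring_1) set \<Rightarrow> 'g \<Rightarrow> ('g list \<Rightarrow> 'k) set" where
  "pgen Gen K Rel g = fa_cls Gen K Rel (fw [g])"

text \<open>Laurent polynomials in q over a ring are modelled as finitely supported maps from int (convolution product).\<close>
definition qL :: "int \<Rightarrow>\<^sub>0 'a::comm_ring_1" where "qL = Poly_Mapping.single 1 1"
definition qLinv :: "int \<Rightarrow>\<^sub>0 'a::comm_ring_1" where "qLinv = Poly_Mapping.single (-1) 1"

definition zeta :: "nat \<Rightarrow> complex" where "zeta r = cis (2 * pi / real r)"

inductive_set Zrz :: "nat \<Rightarrow> complex set" for r where
  one: "1 \<in> Zrz r"
| invr: "1 / of_nat r \<in> Zrz r"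
| zeta: "zeta r \<in> Zrz r"
| add: "a \<in> Zrz r \<Longrightarrow> b \<in> Zrz r \<Longrightarrow> a + b \<in> Zrz r"
| mult: "a \<in> Zrz r \<Longrightarrow> b \<in> Zrz r \<Longrightarrow> a * b \<in> Zrz r"
| neg: "a \<in> Zrz r \<Longrightarrow> - a \<in> Zrz r"

text \<open>The ring R = Z[1/r][q,q^-1,zeta], as a subring of complex Laurent polynomials.\<close>
definition Rcoef :: "nat \<Rightarrow> (int \<Rightarrow>\<^sub>0 complex) set" where
  "Rcoef r = {p. \<forall>k. Poly_Mapping.lookup p k \<in> Zrz r}"

definition sw :: "nat \<Rightarrow> nat \<Rightarrow> nat" where
  "sw i = (\<lambda>j. if j = i then i + 1 else if j = i + 1 then i else j)"

definition sprod :: "nat list \<Rightarrow> nat \<Rightarrow> nat" where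
  "sprod is = foldr (\<lambda>i f. sw i \<circ> f) is id"

definition is_redword :: "nat \<Rightarrow> (nat \<Rightarrow> nat) \<Rightarrow> nat list \<Rightarrow> bool" where
  "is_redword n w is \<longleftrightarrow> (\<forall>i\<in>set is. 1 \<le> i \<and> i < n) \<and> sprod is = w \<and>
     (\<forall>js. (\<forall>j\<in>set js. 1 \<le> j \<and> j < n) \<and> sprod js = w \<longrightarrow> length is \<le> length js)"

definition redword :: "nat \<Rightarrow> (nat \<Rightarrow> nat) \<Rightarrow> nat list" where
  "redword n w = (SOME is. is_redword n w is)"

text \<open>n-tuples of r-th roots of unity (as lists), and the action of s_i (1-based).\<close>
definition lam :: "nat \<Rightarrow> nat \<Rightarrow> complex list set" where
  "lam r n = {l. length l = n \<and> (\<forall>x\<in>set l. x ^ r = 1)}"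

definition slam :: "nat \<Rightarrow> complex list \<Rightarrow> complex list" where
  "slam i l = l[i - 1 := l ! i, i := l ! (i - 1)]"

definition sfix :: "nat \<Rightarrow> complex list \<Rightarrow> bool" where
  "sfix i l \<longleftrightarrow> slam i l = l"

datatype ygen = T nat | Hg nat | Y1 | Y1i

definition ygens :: "nat \<Rightarrow> ygen set" where
  "ygens n = {T j | j. 1 \<le> j \<and> j \<le> n} \<union> {Hg i | i. 1 \<le> i \<and> i < n} \<union> {Y1, Y1i}"

text \<open>e_i, using t^(-s) = t^((r-s) mod r) (from t^r = 1); rinv plays 1/r.\<close>
definition ye :: "nat \<Rightarrow> 'k::comm_ring_1 \<Rightarrow> nat \<Rightarrow> (ygen list \<Rightarrow> 'k)" where
  "ye r rinv i = fsc rinv (fsum (\<lambda>s. fw (replicate s (T i) @ replicate ((r - s) mod r) (T (i+1)))) {0..<r})"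

definition yrels :: "nat \<Rightarrow> nat \<Rightarrow> 'k::comm_ring_1 \<Rightarrow> 'k \<Rightarrow> (ygen list \<Rightarrow> 'k) set" where
  "yrels r n qd rinv =
     {fsub (fw [Hg i, Hg j]) (fw [Hg j, Hg i]) | i j. 1 \<le> i \<and> i < n \<and> 1 \<le> j \<and> j < n \<and> (i + 2 \<le> j \<or> j + 2 \<le> i)}
   \<union> {fsub (fw [Hg i, Hg (i+1), Hg i]) (fw [Hg (i+1), Hg i, Hg (i+1)]) | i. 1 \<le> i \<and> i + 1 < n}
   \<union> {fsub (fw [T i, T j]) (fw [T j, T i]) | i j. 1 \<le> i \<and> i \<le> n \<and> 1 \<le> j \<and> j \<le> n}
   \<union> {fsub (fw [Hg i, T j]) (fw [T (sw i j), Hg i]) | i j. 1 \<le> i \<and> i < n \<and> 1 \<le> j \<and> j \<le> n}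
   \<union> {fsub (fw (replicate r (T i))) (fw []) | i. 1 \<le> i \<and> i \<le> n}
   \<union> {fsub (fw [Hg i, Hg i]) (fadd (fw []) (fsc qd (fmul (ye r rinv i) (fw [Hg i])))) | i. 1 \<le> i \<and> i < n}
   \<union> {fsub (fw [Y1, Y1i]) (fw []), fsub (fw [Y1i, Y1]) (fw [])}
   \<union> {fsub (fw [Hg 1, Y1, Hg 1, Y1]) (fw [Y1, Hg 1, Y1, Hg 1]) | i::nat. 2 \<le> n}
   \<union> {fsub (fw [Hg i, Y1]) (fw [Y1, Hg i]) | i. 2 \<le> i \<and> i < n}
   \<union> {fsub (fw [T j, Y1]) (fw [Y1, T j]) | j. 1 \<le> j \<and> j \<le> n}"

definition Yrels :: "nat \<Rightarrow> nat \<Rightarrow> (ygen list \<Rightarrow> (int \<Rightarrow>\<^sub>0 complex)) set" where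
  "Yrels r n = yrels r n (qL - qLinv) (Poly_Mapping.single 0 (1 / of_nat r))"

definition Yhat :: "nat \<Rightarrow> nat \<Rightarrow> (ygen list \<Rightarrow> (int \<Rightarrow>\<^sub>0 complex)) set ring" where
  "Yhat r n = pres (ygens n) (Rcoef r) (Yrels r n)"

definition Ysc :: "nat \<Rightarrow> nat \<Rightarrow> (int \<Rightarrow>\<^sub>0 complex) \<Rightarrow> (ygen list \<Rightarrow> (int \<Rightarrow>\<^sub>0 complex)) set \<Rightarrow> (ygen list \<Rightarrow> (int \<Rightarrow>\<^sub>0 complex)) set" where
  "Ysc r n = psc (ygens n) (Rcoef r) (Yrels r n)"

datatype hgen = G nat | E "complex list" | X1 | X1i

definition hgens :: "nat \<Rightarrow> nat \<Rightarrow> hgen set" where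
  "hgens r n = {G i | i. 1 \<le> i \<and> i < n} \<union> {E l | l. l \<in> lam r n} \<union> {X1, X1i}"

definition hrels :: "nat \<Rightarrow> nat \<Rightarrow> 'k::comm_ring_1 \<Rightarrow> (hgen list \<Rightarrow> 'k) set" where
  "hrels r n qd =
     {fsub (fw [G i, G j]) (fw [G j, G i]) | i j. 1 \<le> i \<and> i < n \<and> 1 \<le> j \<and> j < n \<and> (i + 2 \<le> j \<or> j + 2 \<le> i)}
   \<union> {fsub (fw [G i, G (i+1), G i]) (fw [G (i+1), G i, G (i+1)]) | i. 1 \<le> i \<and> i + 1 < n}
   \<union> {fsub (fw [G i, E l]) (fw [E (slam i l), G i]) | i l. 1 \<le> i \<and> i < n \<and> l \<in> lam r n}
   \<union> {fsub (fsum (\<lambda>l. fw [E l]) (lam r n)) (fw [])}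
   \<union> {fsub (fw [E l, E l']) (if l = l' then fw [E l] else (\<lambda>w. 0)) | l l'. l \<in> lam r n \<and> l' \<in> lam r n}
   \<union> {fsub (fw [G i, G i]) (fadd (fw []) (fsc qd (fsum (\<lambda>l. fw [G i, E l]) {l \<in> lam r n. sfix i l}))) | i. 1 \<le> i \<and> i < n}
   \<union> {fsub (fw [X1, X1i]) (fw []), fsub (fw [X1i, X1]) (fw [])}
   \<union> {fsub (fw [G 1, X1, G 1, X1]) (fw [X1, G 1, X1, G 1]) | i::nat. 2 \<le> n}
   \<union> {fsub (fw [G i, X1]) (fw [X1, G i]) | i. 2 \<le> i \<and> i < n}
   \<union> {fsub (fw [X1, E l]) (fw [E l, X1]) | l. l \<in> lam r n}"

definition Hhat :: "nat \<Rightarrow> nat \<Rightarrow> (hgen list \<Rightarrow> (int \<Rightarrow>\<^sub>0 int)) set ring" where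
  "Hhat r n = pres (hgens r n) UNIV (hrels r n (qL - qLinv))"

definition Hsc :: "nat \<Rightarrow> nat \<Rightarrow> (int \<Rightarrow>\<^sub>0 int) \<Rightarrow> (hgen list \<Rightarrow> (int \<Rightarrow>\<^sub>0 int)) set \<Rightarrow> (hgen list \<Rightarrow> (int \<Rightarrow>\<^sub>0 int)) set" where
  "Hsc r n = psc (hgens r n) UNIV (hrels r n (qL - qLinv))"

text \<open>Base change R \<otimes>_A H-hat: same presentation over R.\<close>
definition HhatR :: "nat \<Rightarrow> nat \<Rightarrow> (hgen list \<Rightarrow> (int \<Rightarrow>\<^sub>0 complex)) set ring" where
  "HhatR r n = pres (hgens r n) (Rcoef r) (hrels r n (qL - qLinv))"

definition HRsc :: "nat \<Rightarrow> nat \<Rightarrow> (int \<Rightarrow>\<^sub>0 complex) \<Rightarrow> (hgen list \<Rightarrow> (int \<Rightarrow>\<^sub>0 complex)) set \<Rightarrow> (hgen list \<Rightarrow> (int \<Rightarrow>\<^sub>0 complex)) set" where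
  "HRsc r n = psc (hgens r n) (Rcoef r) (hrels r n (qL - qLinv))"

definition hg :: "nat \<Rightarrow> nat \<Rightarrow> hgen \<Rightarrow> (hgen list \<Rightarrow> (int \<Rightarrow>\<^sub>0 int)) set" where
  "hg r n = pgen (hgens r n) UNIV (hrels r n (qL - qLinv))"

definition rprod :: "('a, 'm) monoid_scheme \<Rightarrow> 'a list \<Rightarrow> 'a" where
  "rprod M xs = foldr (\<lambda>x y. x \<otimes>\<^bsub>M\<^esub> y) xs \<one>\<^bsub>M\<^esub>"

fun HX :: "nat \<Rightarrow> nat \<Rightarrow> nat \<Rightarrow> (hgen list \<Rightarrow> (int \<Rightarrow>\<^sub>0 int)) set" where
  "HX r n 0 = hg r n X1"
| "HX r n (Suc 0) = hg r n X1"
| "HX r n (Suc (Suc i)) =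
     hg r n (G (Suc i)) \<otimes>\<^bsub>Hhat r n\<^esub> HX r n (Suc i) \<otimes>\<^bsub>Hhat r n\<^esub> hg r n (G (Suc i))"

definition Hgw :: "nat \<Rightarrow> nat \<Rightarrow> (nat \<Rightarrow> nat) \<Rightarrow> (hgen list \<Rightarrow> (int \<Rightarrow>\<^sub>0 int)) set" where
  "Hgw r n w = rprod (Hhat r n) (map (\<lambda>i. hg r n (G i)) (redword n w))"

definition Hbasis :: "nat \<Rightarrow> nat \<Rightarrow> (hgen list \<Rightarrow> (int \<Rightarrow>\<^sub>0 int)) set set" where
  "Hbasis r n = {rprod (Hhat r n) (map (\<lambda>i. HX r n i [^]\<^bsub>Hhat r n\<^esub> ((\<alpha>::int list) ! (i - 1))) [1..<Suc n])
                    \<otimes>\<^bsub>Hhat r n\<^esub> hg r n (E l) \<otimes>\<^bsub>Hhat r n\<^esub> Hgw r n w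
                 | \<alpha> l w. length \<alpha> = n \<and> l \<in> lam r n \<and> w permutes {1..n}}"

definition is_basis :: "('a, 'm) ring_scheme \<Rightarrow> 'k::zero set \<Rightarrow> ('k \<Rightarrow> 'a \<Rightarrow> 'a) \<Rightarrow> 'a set \<Rightarrow> bool" where
  "is_basis M K sc B \<longleftrightarrow> B \<subseteq> carrier M \<and>
     (\<forall>x\<in>carrier M. \<exists>!c::'a \<Rightarrow> 'k. (\<forall>v. c v \<in> K) \<and> (\<forall>v. c v \<noteq> 0 \<longrightarrow> v \<in> B) \<and>
         finite {v. c v \<noteq> 0} \<and> x = finsum M (\<lambda>v. sc (c v) v) {v. c v \<noteq> 0})"

end

theory Submission
  imports Defs "HOL-Computational_Algebra.Polynomial"
begin

text \<open>
  The isomorphism is the Fourier transform on the group generated by the t_j: the idempotent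
  1_\<lambda> corresponds to the product over j of (1/r) \<Sum>_s \<lambda>_j^(-s) t_j^s, and t_j to \<Sum>_\<lambda> \<lambda>_j 1_\<lambda>.
  Everything about these products follows from the fact that they are the simultaneous eigenprojections
  of the t_j: left multiplication by the one attached to \<lambda> fixes a simultaneous eigenvector with
  eigenvalues \<lambda> and kills the other ones.

  The basis elements span because their span contains 1 and is stable under left multiplication by the
  generators: moving g_i past a Laurent monomial produces Laurent monomials with or without g_i (Bernstein
  relations), and g_i g_w is computed by Matsumoto's theorem.

  For independence, the algebra acts on functions of a point (q, x, \<lambda>), where q > 1 and x_1, ..., x_n are
  generic real numbers: X_k multiplies by x_k, 1_\<mu> is the indicator function of \<lambda> = \<mu>, and g_i acts by
  Demazure-Lusztig operators. These operators are triangular with respect to the length of w, and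
  a Laurent polynomial in q and the x_k that vanishes at all generic points is zero, as one sees by
  substituting x_k = q^(M^k) with a large M.
\<close>

text \<open>The isomorphism and the basis live over different rings. Fourier inversion divides by r
  and uses the r-th roots of unity as scalars, which R provides and A in general does not. Spanning
  and independence are argued over A directly, so no descent from R to A occurs.

  The Demazure-Lusztig operators have denominators x_(i+1) - x_i. Acting on real functions of points
  turns every coefficient into a real number, at the price that a point must carry q as a
  coordinate: the scalars in A then act by functions of the point, which commute with the g_i but
  are not central among all operators.

  Independence is tested on indicator functions of permuted coordinate vectors. For this the term of
  g_i that applies the reflection must never vanish, and it vanishes exactly for equal labels with
  x_(i+1) = t^2 x_i. This is the origin of the condition with t^2 in the notion of a generic
  point.\<close>

unbundle no m_inv_syntax

section \<open>Free algebras and presented rings\<close>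

lemma fmul_Nil: "fmul p q [] = p [] * q []"
  by (simp add: fmul_def)

text \<open>The cut before the first letter is split off; every other cut leaves x in the left
  factor. This recursion replaces manipulation of sums over cut points in the inductions on
  words.\<close>

lemma fmul_Cons: "fmul p q (x # w) = p [] * q (x # w) + fmul (\<lambda>u. p (x # u)) q w"
  unfolding fmul_def by (simp add: sum.atMost_Suc_shift del: sum.atMost_Suc)

lemma fmul_fadd_left: "fmul (fadd p q) s = fadd (fmul p s) (fmul q s)"
  by (simp add: fmul_def fadd_def sum.distrib algebra_simps fun_eq_iff)

lemma fmul_fadd_right: "fmul s (fadd p q) = fadd (fmul s p) (fmul s q)"
  by (simp add: fmul_def fadd_def sum.distrib algebra_simps fun_eq_iff)

lemma fmul_fsc_left: "fmul (fsc c p) q = fsc c (fmul p q)"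
  by (simp add: fmul_def fsc_def sum_distrib_left algebra_simps fun_eq_iff)

lemma fmul_fsc_right: "fmul p (fsc c q) = fsc c (fmul p q)"
  by (simp add: fmul_def fsc_def sum_distrib_left algebra_simps fun_eq_iff)

lemma fmul_zero: "fmul (\<lambda>w. 0) p = (\<lambda>w. 0)" "fmul p (\<lambda>w. 0) = (\<lambda>w. 0)"
  by (simp_all add: fmul_def)

lemma fmul_uminus:
  "fmul (\<lambda>w. - p w) q = (\<lambda>w. - fmul p q w)" "fmul p (\<lambda>w. - q w) = (\<lambda>w. - fmul p q w)"
  by (simp_all add: fmul_def sum_negf)

lemma fmul_assoc: "fmul (fmul p q) s = fmul p (fmul q s)"
proof
  fix w show "fmul (fmul p q) s w = fmul p (fmul q s) w"
  proof (induction w arbitrary: p)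
    case Nil
    then show ?case by (simp add: fmul_Nil mult.assoc)
  next
    case (Cons x w)
    \<comment> \<open>Deleting the leading letter x acts on a product like a twisted derivation:
      either the left word is empty and x comes from q, or x belongs to p.\<close>
    have eq: "(\<lambda>u. fmul p q (x # u)) = fadd (fsc (p []) (\<lambda>u. q (x # u))) (fmul (\<lambda>u. p (x # u)) q)"
      by (simp add: fun_eq_iff fmul_Cons fadd_def fsc_def)
    show ?case
      by (simp add: fmul_Cons[of _ _ x w] fmul_Nil eq fmul_fadd_left fmul_fsc_left)
        (simp add: fadd_def fsc_def Cons algebra_simps)
  qed
qed

lemma fmul_one_left: "fmul (fw []) p = p"
proof
  fix w show "fmul (fw []) p w = p w"
    by (cases w) (simp_all add: fmul_Nil fmul_Cons fw_def fmul_zero)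
qed

lemma fmul_one_right: "fmul p (fw []) = p"
proof
  fix w show "fmul p (fw []) w = p w"
    by (induction w arbitrary: p) (simp_all add: fmul_Nil fmul_Cons fw_def)
qed

lemma fmul_fw: "fmul (fw u) (fw v) = fw (u @ v)"
proof (induction u)
  case Nil
  then show ?case by (simp add: fmul_one_left)
next
  case (Cons a u)
  have eq: "(\<lambda>u'. fw (a # u) (x # u') :: 'b) = (if x = a then fw u else (\<lambda>w. 0))" for x
    by (auto simp: fw_def fun_eq_iff)
  show ?case
  proof
    fix w show "fmul (fw (a # u)) (fw v) w = (fw ((a # u) @ v) w :: 'b)"
      by (cases w) (auto simp: fmul_Nil fmul_Cons eq Cons fmul_zero, auto simp: fw_def)
  qed
qed

section \<open>Quotients of free algebras over a coefficient subring\<close>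

locale coefficient_ring =
  fixes K :: "'k::comm_ring_1 set"
  assumes K_one: "1 \<in> K"
    and K_add: "a \<in> K \<Longrightarrow> b \<in> K \<Longrightarrow> a + b \<in> K"
    and K_mult: "a \<in> K \<Longrightarrow> b \<in> K \<Longrightarrow> a * b \<in> K"
    and K_neg: "a \<in> K \<Longrightarrow> - a \<in> K"

locale presentation = coefficient_ring K
  for Gen :: "'g set" and K :: "'k::comm_ring_1 set" +
  fixes Rel :: "('g list \<Rightarrow> 'k) set"
  assumes Rel_sub: "Rel \<subseteq> fa Gen K"
begin

lemma K_zero: "0 \<in> K"
  using K_add[OF K_one K_neg[OF K_one]] by simp

lemma K_sum: "(\<And>i. i \<in> I \<Longrightarrow> f i \<in> K) \<Longrightarrow> sum f I \<in> K"
  by (induction I rule: infinite_finite_induct) (auto simp: K_zero K_add)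

lemma fa_zero: "(\<lambda>w. 0) \<in> fa Gen K"
  by (simp add: fa_def K_zero)

lemma fa_fw: "set u \<subseteq> Gen \<Longrightarrow> fw u \<in> fa Gen K"
  by (auto simp: fa_def fw_def K_zero K_one)

lemma fa_fadd: "p \<in> fa Gen K \<Longrightarrow> q \<in> fa Gen K \<Longrightarrow> fadd p q \<in> fa Gen K"
proof -
  assume a: "p \<in> fa Gen K" "q \<in> fa Gen K"
  have "{w. p w + q w \<noteq> 0} \<subseteq> {w. p w \<noteq> 0} \<union> {w. q w \<noteq> 0}" by auto
  moreover have "finite ({w. p w \<noteq> 0} \<union> {w. q w \<noteq> 0})" using a by (simp add: fa_def)
  ultimately have "finite {w. p w + q w \<noteq> 0}" by (rule finite_subset)
  moreover have "set w \<subseteq> Gen" if "p w + q w \<noteq> 0" for w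
    using that a by (cases "p w = 0") (auto simp: fa_def)
  ultimately show ?thesis using a by (simp add: fa_def fadd_def K_add)
qed

lemma fa_neg: "p \<in> fa Gen K \<Longrightarrow> (\<lambda>w. - p w) \<in> fa Gen K"
  by (auto simp: fa_def K_neg)

lemma fa_fsub: "p \<in> fa Gen K \<Longrightarrow> q \<in> fa Gen K \<Longrightarrow> fsub p q \<in> fa Gen K"
  using fa_fadd[OF _ fa_neg, of p q] by (simp add: fsub_def fadd_def)

lemma fa_fsc: "c \<in> K \<Longrightarrow> p \<in> fa Gen K \<Longrightarrow> fsc c p \<in> fa Gen K"
proof -
  assume a: "c \<in> K" "p \<in> fa Gen K"
  have "{w. c * p w \<noteq> 0} \<subseteq> {w. p w \<noteq> 0}" by auto
  then have "finite {w. c * p w \<noteq> 0}" using a by (auto simp: fa_def intro: finite_subset)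
  moreover have "set w \<subseteq> Gen" if "c * p w \<noteq> 0" for w
    using that a by (cases "p w = 0") (auto simp: fa_def)
  ultimately show ?thesis using a by (simp add: fa_def fsc_def K_mult)
qed

lemma fa_fsum: "(\<And>i. i \<in> I \<Longrightarrow> f i \<in> fa Gen K) \<Longrightarrow> fsum f I \<in> fa Gen K"
proof (induction I rule: infinite_finite_induct)
  case (insert i I)
  have "fsum f (insert i I) = fadd (f i) (fsum f I)"
    using insert by (simp add: fsum_def fadd_def fun_eq_iff)
  then show ?case using insert by (simp add: fa_fadd)
qed (simp_all add: fsum_def fa_zero)

lemma fa_fmul: "p \<in> fa Gen K \<Longrightarrow> q \<in> fa Gen K \<Longrightarrow> fmul p q \<in> fa Gen K"
proof -
  assume a: "p \<in> fa Gen K" "q \<in> fa Gen K"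
  have *: "\<exists>i\<le>length w. p (take i w) \<noteq> 0 \<and> q (drop i w) \<noteq> 0" if "fmul p q w \<noteq> 0" for w
    using that unfolding fmul_def by (metis (mono_tags, lifting) atMost_iff mult_not_zero sum.neutral)
  have sub: "{w. fmul p q w \<noteq> 0} \<subseteq> (\<lambda>(u, v). u @ v) ` ({w. p w \<noteq> 0} \<times> {w. q w \<noteq> 0})"
  proof
    fix w assume "w \<in> {w. fmul p q w \<noteq> 0}"
    then obtain i where "p (take i w) \<noteq> 0" "q (drop i w) \<noteq> 0" using * by blast
    then show "w \<in> (\<lambda>(u, v). u @ v) ` ({w. p w \<noteq> 0} \<times> {w. q w \<noteq> 0})"
      by (intro image_eqI[of _ _ "(take i w, drop i w)"]) auto
  qed
  have "finite ((\<lambda>(u, v). u @ v) ` ({w. p w \<noteq> 0} \<times> {w. q w \<noteq> 0}))"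
    using a by (simp add: fa_def)
  then have "finite {w. fmul p q w \<noteq> 0}" using sub finite_subset by blast
  moreover have "set w \<subseteq> Gen" if "fmul p q w \<noteq> 0" for w
  proof -
    obtain i where "p (take i w) \<noteq> 0" "q (drop i w) \<noteq> 0" using * \<open>fmul p q w \<noteq> 0\<close> by blast
    then have "set (take i w @ drop i w) \<subseteq> Gen" using a unfolding fa_def set_append by blast
    then show ?thesis by simp
  qed
  moreover have "fmul p q w \<in> K" for w
    unfolding fmul_def using a by (intro K_sum K_mult) (auto simp: fa_def)
  ultimately show ?thesis by (simp add: fa_def)
qed

lemmas fa_intros = fa_zero fa_fw fa_fadd fa_fsub fa_fsc fa_fsum fa_fmul

text \<open>The support is finite, so removing one word after another ends at 0. A property then
  only has to survive the addition of a scalar multiple of a word.\<close>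

lemma fa_induct [consumes 1, case_names zero step]:
  assumes "p \<in> fa Gen K"
    and zero: "P (\<lambda>w. 0)"
    and step: "\<And>c u p. c \<in> K \<Longrightarrow> set u \<subseteq> Gen \<Longrightarrow> p \<in> fa Gen K \<Longrightarrow> P p \<Longrightarrow> P (fadd (fsc c (fw u)) p)"
  shows "P p"
proof -
  have "finite {w. p w \<noteq> 0}" using assms(1) by (simp add: fa_def)
  then show ?thesis using assms(1)
  proof (induction "{w. p w \<noteq> 0}" arbitrary: p rule: finite_psubset_induct)
    case psubset
    show ?case
    proof (cases "{w. p w \<noteq> 0} = {}")
      case True
      then have "p = (\<lambda>w. 0)" by auto
      then show ?thesis using zero by simp
    next
      case False
      then obtain u where u: "p u \<noteq> 0" by blast
      have fin: "finite {w. p w \<noteq> 0}" using psubset by simp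
      have fa: "p(u := 0) \<in> fa Gen K"
        using psubset(3) by (auto simp: fa_def K_zero intro: finite_subset[OF _ fin])
      have "P (p(u := 0))"
        using u by (intro psubset(2) fa) auto
      moreover have "p = fadd (fsc (p u) (fw u)) (p(u := 0))"
        by (auto simp: fadd_def fsc_def fw_def)
      moreover have "p u \<in> K" "set u \<subseteq> Gen" using psubset(3) u by (auto simp: fa_def)
      ultimately show ?thesis using step fa by metis
    qed
  qed
qed

abbreviation I where "I \<equiv> fa_ideal Gen K Rel"
abbreviation cls where "cls \<equiv> fa_cls Gen K Rel"
abbreviation Pr where "Pr \<equiv> pres Gen K Rel"

lemma I_sub: "x \<in> I \<Longrightarrow> x \<in> fa Gen K"
  by (induction rule: fa_ideal.induct) (use Rel_sub in \<open>auto intro: fa_zero fa_fmul fa_fadd fa_neg\<close>)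

lemma I_fmul_left: "x \<in> I \<Longrightarrow> a \<in> fa Gen K \<Longrightarrow> fmul a x \<in> I"
proof (induction rule: fa_ideal.induct)
  case (gen \<rho> a' b')
  then show ?case
    using fa_ideal.gen[of \<rho> Rel "fmul a a'" Gen K b'] by (simp add: fmul_assoc fa_fmul)
qed (simp_all add: fmul_zero fmul_fadd_right fmul_uminus fa_ideal.intros)

lemma I_fmul_right: "x \<in> I \<Longrightarrow> a \<in> fa Gen K \<Longrightarrow> fmul x a \<in> I"
proof (induction rule: fa_ideal.induct)
  case (gen \<rho> a' b')
  then show ?case
    using fa_ideal.gen[of \<rho> Rel a' Gen K "fmul b' a"] by (simp add: fmul_assoc fa_fmul)
qed (simp_all add: fmul_zero fmul_fadd_left fmul_uminus fa_ideal.intros)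

lemma Rel_I: "\<rho> \<in> Rel \<Longrightarrow> \<rho> \<in> I"
  using fa_ideal.gen[of \<rho> Rel "fw []" Gen K "fw []"] by (simp add: fmul_one_left fmul_one_right fa_fw)

lemma I_sym: "fsub x y \<in> I \<Longrightarrow> fsub y x \<in> I"
  using fa_ideal.neg[of "fsub x y" Gen K Rel] by (simp add: fsub_def)

lemma I_trans: "fsub x y \<in> I \<Longrightarrow> fsub y z \<in> I \<Longrightarrow> fsub x z \<in> I"
  using fa_ideal.add[of "fsub x y" Gen K Rel "fsub y z"] by (simp add: fsub_def fadd_def)

lemma I_refl: "fsub x x \<in> I"
  by (simp add: fsub_def fa_ideal.zero)

lemma cls_eq: "x \<in> fa Gen K \<Longrightarrow> y \<in> fa Gen K \<Longrightarrow> cls x = cls y \<longleftrightarrow> fsub x y \<in> I"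
  unfolding fa_cls_def by (auto intro: I_refl I_sym I_trans)

text \<open>The operations of \<open>pres\<close> are computed on representatives picked by
  \<open>SOME\<close>. A picked representative differs from a given one by an element of the ideal,
  which makes those operations independent of the choice.\<close>

lemma cls_some:
  assumes "x \<in> fa Gen K"
  shows "(SOME y. y \<in> cls x) \<in> fa Gen K" "fsub x (SOME y. y \<in> cls x) \<in> I"
proof -
  have "x \<in> cls x" using assms by (simp add: fa_cls_def I_refl)
  then have "(SOME y. y \<in> cls x) \<in> cls x" by (rule someI[of "\<lambda>y. y \<in> cls x"])
  then show "(SOME y. y \<in> cls x) \<in> fa Gen K" "fsub x (SOME y. y \<in> cls x) \<in> I"
    by (simp_all add: fa_cls_def)
qed

lemma carrier_P: "carrier Pr = cls ` fa Gen K"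
  by (simp add: pres_def)

lemma one_P: "\<one>\<^bsub>Pr\<^esub> = cls (fw [])" and zero_P: "\<zero>\<^bsub>Pr\<^esub> = cls (\<lambda>w. 0)"
  by (simp_all add: pres_def)

lemma add_P:
  assumes "x \<in> fa Gen K" "y \<in> fa Gen K"
  shows "cls x \<oplus>\<^bsub>Pr\<^esub> cls y = cls (fadd x y)"
proof -
  let ?x = "SOME z. z \<in> cls x" and ?y = "SOME z. z \<in> cls y"
  have "fsub (fadd x y) (fadd ?x ?y) = fadd (fsub x ?x) (fsub y ?y)"
    by (simp add: fsub_def fadd_def fun_eq_iff)
  then have "fsub (fadd x y) (fadd ?x ?y) \<in> I"
    using cls_some[OF assms(1)] cls_some[OF assms(2)] by (simp add: fa_ideal.add)
  then have "cls (fadd x y) = cls (fadd ?x ?y)"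
    using assms cls_some by (subst cls_eq) (simp_all add: fa_fadd)
  then show ?thesis by (simp add: pres_def)
qed

lemma mult_P:
  assumes "x \<in> fa Gen K" "y \<in> fa Gen K"
  shows "cls x \<otimes>\<^bsub>Pr\<^esub> cls y = cls (fmul x y)"
proof -
  let ?x = "SOME z. z \<in> cls x" and ?y = "SOME z. z \<in> cls y"
  \<comment> \<open>Telescoping: xy - x'y' = (x - x')y + x'(y - y'), with both differences in the
    two-sided ideal.\<close>
  have "fsub (fmul x y) (fmul ?x ?y) = fadd (fmul (fsub x ?x) y) (fmul ?x (fsub y ?y))"
    by (simp add: fsub_def fadd_def fmul_def fun_eq_iff algebra_simps flip: sum.distrib)
  then have "fsub (fmul x y) (fmul ?x ?y) \<in> I"
    using cls_some[OF assms(1)] cls_some[OF assms(2)] assms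
    by (simp add: fa_ideal.add I_fmul_left I_fmul_right)
  then have "cls (fmul x y) = cls (fmul ?x ?y)"
    using assms cls_some by (subst cls_eq) (simp_all add: fa_fmul)
  then show ?thesis by (simp add: pres_def)
qed

lemma psc_P:
  assumes "c \<in> K" "x \<in> fa Gen K"
  shows "psc Gen K Rel c (cls x) = cls (fsc c x)"
proof -
  let ?x = "SOME z. z \<in> cls x"
  have "fsub (fsc c x) (fsc c ?x) = fmul (fsc c (fw [])) (fsub x ?x)"
    by (simp add: fmul_fsc_left fmul_one_left) (simp add: fsub_def fsc_def algebra_simps)
  then have "fsub (fsc c x) (fsc c ?x) \<in> I"
    using cls_some[OF assms(2)] assms(1) by (simp add: I_fmul_left fa_fsc fa_fw)
  then have "cls (fsc c x) = cls (fsc c ?x)"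
    using assms cls_some by (subst cls_eq) (simp_all add: fa_fsc)
  then show ?thesis by (simp add: psc_def)
qed

lemma fadd_simps:
  "fadd (fadd x y) z = fadd x (fadd y z)" "fadd x y = fadd y x" "fadd (\<lambda>w. 0) x = x"
  "fadd (\<lambda>w. - x w) x = (\<lambda>w. 0)"
  by (simp_all add: fadd_def algebra_simps)

lemma ring_P: "ring Pr"
proof (rule ringI)
  show "abelian_group Pr"
  proof (rule abelian_groupI)
    fix x assume "x \<in> carrier Pr"
    then obtain a where a: "x = cls a" "a \<in> fa Gen K" by (auto simp: carrier_P)
    show "\<exists>y\<in>carrier Pr. y \<oplus>\<^bsub>Pr\<^esub> x = \<zero>\<^bsub>Pr\<^esub>"
    proof (rule bexI[of _ "cls (\<lambda>w. - a w)"])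
      have "cls (\<lambda>w. - a w) \<oplus>\<^bsub>Pr\<^esub> cls a = cls (fadd (\<lambda>w. - a w) a)"
        using a by (intro add_P) (simp_all add: fa_neg)
      then show "cls (\<lambda>w. - a w) \<oplus>\<^bsub>Pr\<^esub> x = \<zero>\<^bsub>Pr\<^esub>"
        using a by (simp add: zero_P fadd_simps(4))
    qed (use a in \<open>auto simp: carrier_P intro!: imageI fa_neg\<close>)
    fix y assume "y \<in> carrier Pr"
    then obtain b where b: "y = cls b" "b \<in> fa Gen K" by (auto simp: carrier_P)
    show "x \<oplus>\<^bsub>Pr\<^esub> y = y \<oplus>\<^bsub>Pr\<^esub> x"
      using a b by (simp add: add_P) (simp add: fadd_simps(2)[of a b])
  qed (auto simp: carrier_P add_P zero_P fa_fadd fa_zero fadd_simps(1,3))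
  show "monoid Pr"
    by (rule monoidI)
      (auto simp: carrier_P mult_P one_P fa_fmul fa_fw fmul_assoc fmul_one_left fmul_one_right)
qed (auto simp: carrier_P mult_P add_P fa_fmul fa_fadd fmul_fadd_left fmul_fadd_right)

end

section \<open>Evaluation of a free algebra in a ring\<close>

definition feval :: "('k \<Rightarrow> 'b::{ring,monoid_mult}) \<Rightarrow> ('g \<Rightarrow> 'b) \<Rightarrow> ('g list \<Rightarrow> 'k::comm_ring_1) \<Rightarrow> 'b" where
  "feval \<iota> \<theta> p = (\<Sum>w | p w \<noteq> 0. \<iota> (p w) * prod_list (map \<theta> w))"

text \<open>Scalars are only required to commute with the images of the generators. Centrality would
  exclude the operator representation, where a function of q commutes with the operators in use but
  not with every operator.\<close>

locale evaluation = presentation Gen K Rel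
  for Gen :: "'g set" and K :: "'k::comm_ring_1 set" and Rel :: "('g list \<Rightarrow> 'k) set" +
  fixes \<iota> :: "'k \<Rightarrow> 'b::{ring,monoid_mult}" and \<theta> :: "'g \<Rightarrow> 'b"
  assumes \<iota>_add: "a \<in> K \<Longrightarrow> b \<in> K \<Longrightarrow> \<iota> (a + b) = \<iota> a + \<iota> b"
    and \<iota>_mult: "a \<in> K \<Longrightarrow> b \<in> K \<Longrightarrow> \<iota> (a * b) = \<iota> a * \<iota> b"
    and \<iota>_one: "\<iota> 1 = 1"
    and \<iota>_comm: "c \<in> K \<Longrightarrow> g \<in> Gen \<Longrightarrow> \<iota> c * \<theta> g = \<theta> g * \<iota> c"
begin

abbreviation ev where "ev \<equiv> feval \<iota> \<theta>"

lemma \<iota>_zero: "\<iota> 0 = 0"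
  using \<iota>_add[OF K_zero K_zero] by simp

lemma \<iota>_neg: "a \<in> K \<Longrightarrow> \<iota> (- a) = - \<iota> a"
  using \<iota>_add[OF _ K_neg, of a a] by (simp add: \<iota>_zero add_eq_0_iff)

lemma ev_superset:
  assumes "finite S" "{w. p w \<noteq> 0} \<subseteq> S"
  shows "ev p = (\<Sum>w\<in>S. \<iota> (p w) * prod_list (map \<theta> w))"
  unfolding feval_def using assms by (intro sum.mono_neutral_left) (auto simp: \<iota>_zero)

lemma ev_zero: "ev (\<lambda>w. 0) = 0"
  by (simp add: feval_def)

lemma ev_fadd:
  assumes "p \<in> fa Gen K" "q \<in> fa Gen K"
  shows "ev (fadd p q) = ev p + ev q"
proof -
  let ?S = "{w. p w \<noteq> 0} \<union> {w. q w \<noteq> 0}"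
  have S: "finite ?S" using assms by (simp add: fa_def)
  have K: "p w \<in> K" "q w \<in> K" for w using assms by (auto simp: fa_def)
  have "{w. fadd p q w \<noteq> 0} \<subseteq> ?S" by (auto simp: fadd_def)
  then have "ev (fadd p q) = (\<Sum>w\<in>?S. \<iota> (fadd p q w) * prod_list (map \<theta> w))"
    by (rule ev_superset[OF S])
  also have "\<dots> = (\<Sum>w\<in>?S. \<iota> (p w) * prod_list (map \<theta> w)) + (\<Sum>w\<in>?S. \<iota> (q w) * prod_list (map \<theta> w))"
    by (simp add: fadd_def \<iota>_add K distrib_right sum.distrib)
  also have "\<dots> = ev p + ev q" by (subst (1 2) ev_superset[OF S]) auto
  finally show ?thesis .
qed

lemma ev_neg: "p \<in> fa Gen K \<Longrightarrow> ev (\<lambda>w. - p w) = - ev p"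
  using ev_fadd[OF _ fa_neg, of p p]
  by (simp add: fadd_def ev_zero add_eq_0_iff)

lemma ev_fsub: "p \<in> fa Gen K \<Longrightarrow> q \<in> fa Gen K \<Longrightarrow> ev (fsub p q) = ev p - ev q"
  using ev_fadd[OF _ fa_neg, of p q] by (simp add: fadd_def fsub_def ev_neg)

lemma ev_fw: "ev (fw u) = prod_list (map \<theta> u)"
  using ev_superset[of "{u}" "fw u"] by (auto simp: fw_def \<iota>_one)

lemma ev_fsc:
  assumes "c \<in> K" "p \<in> fa Gen K"
  shows "ev (fsc c p) = \<iota> c * ev p"
proof -
  have S: "finite {w. p w \<noteq> 0}" and K: "p w \<in> K" for w using assms by (auto simp: fa_def)
  have "ev (fsc c p) = (\<Sum>w | p w \<noteq> 0. \<iota> (fsc c p w) * prod_list (map \<theta> w))"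
    by (rule ev_superset[OF S]) (auto simp: fsc_def)
  also have "\<dots> = \<iota> c * ev p"
    using assms by (simp add: feval_def fsc_def sum_distrib_left \<iota>_mult K mult.assoc)
  finally show ?thesis .
qed

lemma ev_fsum: "(\<And>i. i \<in> J \<Longrightarrow> f i \<in> fa Gen K) \<Longrightarrow> ev (fsum f J) = (\<Sum>i\<in>J. ev (f i))"
proof (induction J rule: infinite_finite_induct)
  case (insert i J)
  have "fsum f (insert i J) = fadd (f i) (fsum f J)"
    using insert by (simp add: fsum_def fadd_def fun_eq_iff)
  then show ?case using insert by (simp add: fa_fsum ev_fadd)
qed (simp_all add: fsum_def ev_zero)

lemma \<iota>_comm_word: "c \<in> K \<Longrightarrow> set u \<subseteq> Gen \<Longrightarrow> \<iota> c * prod_list (map \<theta> u) = prod_list (map \<theta> u) * \<iota> c"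
proof (induction u)
  case (Cons g u)
  have "\<iota> c * (\<theta> g * prod_list (map \<theta> u)) = \<theta> g * (\<iota> c * prod_list (map \<theta> u))"
    using Cons.prems by (simp add: \<iota>_comm flip: mult.assoc)
  also have "\<dots> = \<theta> g * prod_list (map \<theta> u) * \<iota> c" using Cons by (simp add: mult.assoc)
  finally show ?case by simp
qed simp

lemma ev_fmul:
  assumes "p \<in> fa Gen K" "q \<in> fa Gen K"
  shows "ev (fmul p q) = ev p * ev q"
  using assms(1)
proof (induction rule: fa_induct)
  case zero
  then show ?case by (simp add: fmul_zero ev_zero)
next
  case (step c u p)
  have *: "ev (fmul (fw u) q) = prod_list (map \<theta> u) * ev q"
    using assms(2)
  proof (induction rule: fa_induct)
    case zero
    then show ?case by (simp add: fmul_zero ev_zero)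
  next
    case (step d v q)
    have "prod_list (map \<theta> u) * (\<iota> d * prod_list (map \<theta> v)) = \<iota> d * (prod_list (map \<theta> u) * prod_list (map \<theta> v))"
      using \<iota>_comm_word[of d u] step \<open>set u \<subseteq> Gen\<close> by (simp flip: mult.assoc)
    then show ?case
      using step \<open>set u \<subseteq> Gen\<close>
      by (simp add: fmul_fadd_right fmul_fsc_right fmul_fw ev_fadd ev_fsc ev_fw fa_fsc fa_fw fa_fmul distrib_left)
  qed
  show ?case
    using step assms(2)
    by (simp add: fmul_fadd_left fmul_fsc_left ev_fadd ev_fsc ev_fw fa_fsc fa_fw fa_fmul * distrib_right mult.assoc)
qed

lemmas ev_simps = ev_zero ev_fw ev_fadd ev_fsub ev_fsc ev_fsum ev_fmul

end

locale rel_evaluation = evaluation +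
  assumes ev_Rel: "\<rho> \<in> Rel \<Longrightarrow> feval \<iota> \<theta> \<rho> = 0"
begin

lemma ev_I: "x \<in> I \<Longrightarrow> ev x = 0"
proof (induction rule: fa_ideal.induct)
  case (gen \<rho> a b)
  then show ?case using Rel_sub by (auto simp: ev_fmul fa_fmul ev_Rel subset_eq)
qed (simp_all add: ev_zero ev_fadd ev_neg I_sub)

end

text \<open>A type in bijection with the quotient carries the ring structure as type class
  operations, so that sums, powers, list products and their simplification rules apply to the
  quotient.\<close>

locale presented = presentation Gen K Rel
  for Gen :: "'g set" and K :: "'k::comm_ring_1 set" and Rel :: "('g list \<Rightarrow> 'k) set" +
  fixes Rep :: "'b::{ring,monoid_mult} \<Rightarrow> ('g list \<Rightarrow> 'k) set" and Abs
  assumes td: "type_definition Rep Abs (carrier (pres Gen K Rel))"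
    and Rep_add: "Rep (x + y) = Rep x \<oplus>\<^bsub>pres Gen K Rel\<^esub> Rep y"
    and Rep_mult: "Rep (x * y) = Rep x \<otimes>\<^bsub>pres Gen K Rel\<^esub> Rep y"
    and Rep_one: "Rep 1 = \<one>\<^bsub>pres Gen K Rel\<^esub>"
begin

definition cl where "cl p = Abs (cls p)"

lemma Rep_cl: "p \<in> fa Gen K \<Longrightarrow> Rep (cl p) = cls p"
  unfolding cl_def by (rule type_definition.Abs_inverse[OF td]) (simp add: carrier_P)

lemma Rep_inject: "Rep x = Rep y \<longleftrightarrow> x = y"
  by (rule type_definition.Rep_inject[OF td])

lemma cl_surj: obtains p where "p \<in> fa Gen K" "x = cl p"
  using type_definition.Rep[OF td, of x] type_definition.Rep_inverse[OF td, of x]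
  by (auto simp: carrier_P cl_def)

lemma cl_eq: "p \<in> fa Gen K \<Longrightarrow> q \<in> fa Gen K \<Longrightarrow> cl p = cl q \<longleftrightarrow> fsub p q \<in> I"
  by (simp add: Rep_inject[symmetric] Rep_cl cls_eq)

lemma cl_fadd: "p \<in> fa Gen K \<Longrightarrow> q \<in> fa Gen K \<Longrightarrow> cl (fadd p q) = cl p + cl q"
  by (simp add: Rep_inject[symmetric] Rep_cl Rep_add add_P fa_fadd)

lemma cl_fmul: "p \<in> fa Gen K \<Longrightarrow> q \<in> fa Gen K \<Longrightarrow> cl (fmul p q) = cl p * cl q"
  by (simp add: Rep_inject[symmetric] Rep_cl Rep_mult mult_P fa_fmul)

lemma cl_one: "cl (fw []) = 1"
  by (simp add: Rep_inject[symmetric] Rep_cl Rep_one one_P fa_fw)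

lemma cl_zero: "cl (\<lambda>w. 0) = 0"
  using cl_fadd[OF fa_zero fa_zero] by (simp add: fadd_def)

definition sc where "sc c = cl (fsc c (fw []))"
definition gn where "gn g = cl (fw [g])"

lemma sc_one: "sc 1 = 1"
  using cl_one by (simp add: sc_def fsc_def)

lemma sc_mult: "a \<in> K \<Longrightarrow> b \<in> K \<Longrightarrow> sc (a * b) = sc a * sc b"
  using cl_fmul[of "fsc a (fw [])" "fsc b (fw [])"]
  by (simp add: sc_def fa_fsc fa_fw fmul_fsc_left fmul_one_left)
    (simp add: fsc_def mult.assoc)

lemma sc_add: "a \<in> K \<Longrightarrow> b \<in> K \<Longrightarrow> sc (a + b) = sc a + sc b"
  using cl_fadd[of "fsc a (fw [])" "fsc b (fw [])"]
  by (simp add: sc_def fa_fsc fa_fw) (simp add: fsc_def fadd_def algebra_simps)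

lemma cl_fsc: "c \<in> K \<Longrightarrow> p \<in> fa Gen K \<Longrightarrow> cl (fsc c p) = sc c * cl p"
  using cl_fmul[of "fsc c (fw [])" p]
  by (simp add: sc_def fa_fsc fa_fw fmul_fsc_left fmul_one_left)

lemma sc_comm: "c \<in> K \<Longrightarrow> sc c * x = x * sc c"
proof -
  assume c: "c \<in> K"
  obtain p where p: "p \<in> fa Gen K" "x = cl p" by (rule cl_surj)
  have "fmul (fsc c (fw [])) p = fmul p (fsc c (fw []))"
    by (simp add: fmul_fsc_left fmul_fsc_right fmul_one_left fmul_one_right)
  then show ?thesis using p c by (simp add: sc_def fa_fsc fa_fw flip: cl_fmul)
qed

sublocale can: evaluation Gen K Rel sc gn
  by unfold_locales (assumption | rule sc_add sc_mult sc_one sc_comm)+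

lemma cl_fw: "set u \<subseteq> Gen \<Longrightarrow> cl (fw u) = prod_list (map gn u)"
proof (induction u)
  case (Cons g u)
  then have "cl (fw (g # u)) = cl (fmul (fw [g]) (fw u))" by (simp add: fmul_fw)
  then show ?case using Cons by (simp add: cl_fmul fa_fw gn_def)
qed (simp add: cl_one)

lemma cl_eq_ev: "p \<in> fa Gen K \<Longrightarrow> cl p = can.ev p"
  by (induction rule: fa_induct)
    (simp_all add: cl_zero can.ev_simps cl_fadd cl_fsc cl_fw fa_fsc fa_fw)

text \<open>Sending every generator to its own class is again an evaluation, and it agrees with the
  class map. So the quotient itself falls under the lemmas that turn vanishing relators into
  identities between the images of the generators.\<close>

lemma can_Rel: "\<rho> \<in> Rel \<Longrightarrow> can.ev \<rho> = 0"
  using cl_eq[of \<rho> "\<lambda>w. 0"] Rel_sub Rel_I[of \<rho>]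
  by (auto simp: fsub_def fa_zero cl_zero cl_eq_ev subset_eq)

lemma presented_induct [case_names zero step]:
  assumes "P 0" "\<And>c u x. c \<in> K \<Longrightarrow> set u \<subseteq> Gen \<Longrightarrow> P x \<Longrightarrow> P (sc c * prod_list (map gn u) + x)"
  shows "P x"
proof -
  obtain p where p: "p \<in> fa Gen K" "x = cl p" by (rule cl_surj)
  have "P (cl p)" using p(1)
    by (induction rule: fa_induct) (simp_all add: cl_zero assms cl_fadd cl_fsc cl_fw fa_fsc fa_fw)
  then show ?thesis by (simp add: p)
qed

lemma Rep_zero: "Rep 0 = \<zero>\<^bsub>Pr\<^esub>"
  using Rep_cl[OF fa_zero] by (simp add: zero_P cl_zero)

lemma Rep_carrier: "Rep x \<in> carrier Pr"
  by (rule type_definition.Rep[OF td])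

lemma Rep_sc: "c \<in> K \<Longrightarrow> psc Gen K Rel c (Rep x) = Rep (sc c * x)"
proof -
  assume c: "c \<in> K"
  obtain p where p: "p \<in> fa Gen K" "x = cl p" by (rule cl_surj)
  then show ?thesis using c by (simp add: Rep_cl psc_P fa_fsc flip: cl_fsc)
qed

lemma Rep_gn: "g \<in> Gen \<Longrightarrow> pgen Gen K Rel g = Rep (gn g)"
  by (simp add: pgen_def gn_def Rep_cl fa_fw)

end

locale lifting_hom = presented Gen K Rel Rep Abs + rel_evaluation Gen K Rel \<iota> \<theta>
  for Gen :: "'g set" and K :: "'k::comm_ring_1 set" and Rel and Rep :: "'b::{ring,monoid_mult} \<Rightarrow> _" and Abs
    and \<iota> :: "'k \<Rightarrow> 'c::{ring,monoid_mult}" and \<theta>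
begin

text \<open>The universal property: evaluation kills the ideal, so the choice of the representative
  is immaterial, as \<open>lift_cl\<close> shows.\<close>

definition lift where "lift x = ev (SOME p. p \<in> fa Gen K \<and> x = cl p)"

lemma lift_cl:
  assumes "p \<in> fa Gen K"
  shows "lift (cl p) = ev p"
proof -
  let ?q = "SOME q. q \<in> fa Gen K \<and> cl p = cl q"
  have "?q \<in> fa Gen K \<and> cl p = cl ?q"
    by (rule someI[of "\<lambda>q. q \<in> fa Gen K \<and> cl p = cl q" p]) (simp add: assms)
  then have q: "?q \<in> fa Gen K" "fsub p ?q \<in> I" using cl_eq[OF assms, of ?q] by simp_all
  then have "ev p = ev ?q" using ev_I[OF q(2)] assms by (simp add: ev_fsub)
  then show ?thesis by (simp add: lift_def)
qed

lemma lift_add: "lift (x + y) = lift x + lift y"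
proof -
  obtain p where p: "p \<in> fa Gen K" "x = cl p" by (rule cl_surj)
  obtain q where q: "q \<in> fa Gen K" "y = cl q" by (rule cl_surj)
  show ?thesis using p q by (simp add: lift_cl ev_fadd fa_fadd flip: cl_fadd)
qed

lemma lift_mult: "lift (x * y) = lift x * lift y"
proof -
  obtain p where p: "p \<in> fa Gen K" "x = cl p" by (rule cl_surj)
  obtain q where q: "q \<in> fa Gen K" "y = cl q" by (rule cl_surj)
  show ?thesis using p q by (simp add: lift_cl ev_fmul fa_fmul flip: cl_fmul)
qed

lemma lift_one: "lift 1 = 1"
  using lift_cl[of "fw []"] by (simp add: cl_one fa_fw ev_fw)

lemma lift_zero: "lift 0 = 0"
  using lift_add[of 0 0] by simp

lemma lift_sum: "lift (sum f S) = (\<Sum>i\<in>S. lift (f i))"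
  by (induction S rule: infinite_finite_induct) (simp_all add: lift_zero lift_add)

lemma lift_prod_list: "lift (prod_list xs) = prod_list (map lift xs)"
  by (induction xs) (simp_all add: lift_one lift_mult)

lemma lift_power: "lift (x ^ k) = lift x ^ k"
  by (induction k) (simp_all add: lift_one lift_mult)

lemma lift_sc: "c \<in> K \<Longrightarrow> lift (sc c) = \<iota> c"
  using lift_cl[of "fsc c (fw [])"] by (simp add: sc_def fa_fsc fa_fw ev_fsc ev_fw)

lemma lift_gn: "g \<in> Gen \<Longrightarrow> lift (gn g) = \<theta> g"
  using lift_cl[of "fw [g]"] by (simp add: gn_def fa_fw ev_fw)

end

section \<open>Reduced words in the symmetric group\<close>

lemma sw_sw [simp]: "sw i (sw i a) = a"
  by (auto simp: sw_def)

lemma sw_comp_sw: "sw i \<circ> (sw i \<circ> w) = w"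
  by (simp add: fun_eq_iff)

lemma sw_permutes: "1 \<le> i \<Longrightarrow> i < n \<Longrightarrow> sw i permutes {1..n}"
  by (rule bij_imp_permutes, rule bij_betwI[of _ _ _ "sw i"]) (auto simp: sw_def)

lemma inv_sw: "inv (sw i) = sw i"
  by (rule inv_unique_comp) (auto simp: fun_eq_iff)

lemma inv_sw_comp:
  assumes "1 \<le> i" "i < n" "w permutes {1..n}"
  shows "inv (sw i \<circ> w) = inv w \<circ> sw i"
  using o_inv_distrib[of "sw i" w] permutes_bij[OF sw_permutes[of i n]] permutes_bij[of w] assms
  by (simp add: inv_sw)

lemma sw_comm: "i + 2 \<le> j \<or> j + 2 \<le> i \<Longrightarrow> sw i \<circ> (sw j \<circ> w) = sw j \<circ> (sw i \<circ> w)"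
  by (auto simp: sw_def fun_eq_iff)

lemma sw_braid: "sw i \<circ> (sw (Suc i) \<circ> (sw i \<circ> w)) = sw (Suc i) \<circ> (sw i \<circ> (sw (Suc i) \<circ> w))"
  by (auto simp: sw_def fun_eq_iff)

definition inversions :: "nat \<Rightarrow> (nat \<Rightarrow> nat) \<Rightarrow> (nat \<times> nat) set" where
  "inversions n u = {(a, b). 1 \<le> a \<and> a < b \<and> b \<le> n \<and> u b < u a}"

text \<open>Words act by composition on the left, and composing w with \<open>sw i\<close> swaps the
  entries of \<open>inv w\<close> at positions i and i + 1. Counting inversions of the inverse keeps
  the change in neighbouring positions.\<close>

definition ilen :: "nat \<Rightarrow> (nat \<Rightarrow> nat) \<Rightarrow> nat" where
  "ilen n w = card (inversions n (inv w))"

text \<open>Left descents: by \<open>ldesc_iff_ilen\<close> this holds exactly if s_i w is shorter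
  than w.\<close>

definition ldesc :: "nat \<Rightarrow> (nat \<Rightarrow> nat) \<Rightarrow> bool" where
  "ldesc i w \<longleftrightarrow> inv w (Suc i) < inv w i"

lemma finite_inversions: "finite (inversions n u)"
  by (rule finite_subset[of _ "{1..n} \<times> {1..n}"]) (auto simp: inversions_def)

text \<open>Swapping i and i + 1 in both entries preserves the order of every pair other than (i, i
  + 1). The old inversions are carried over bijectively and that single pair is new.\<close>

lemma inversions_sw:
  assumes i: "1 \<le> i" "i < n" and u: "u i < u (Suc i)"
  shows "inversions n (u \<circ> sw i) = insert (i, Suc i) (map_prod (sw i) (sw i) ` inversions n u)"
proof -
  have mono: "sw i a < sw i b" if "a < b" "(a, b) \<noteq> (i, Suc i)" for a b
    using that by (auto simp: sw_def)
  have range: "1 \<le> sw i a \<and> sw i a \<le> n \<longleftrightarrow> 1 \<le> a \<and> a \<le> n" for a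
    using i by (auto simp: sw_def)
  have "(a, b) \<in> inversions n (u \<circ> sw i) \<longleftrightarrow> (a, b) = (i, Suc i) \<or> (sw i a, sw i b) \<in> inversions n u" for a b
  proof (cases "(a, b) = (i, Suc i)")
    case True
    then show ?thesis using i u by (auto simp: inversions_def sw_def)
  next
    case False
    have "a < b \<longleftrightarrow> sw i a < sw i b" if "u (sw i b) < u (sw i a)"
    proof
      assume "sw i a < sw i b"
      moreover have "(sw i a, sw i b) \<noteq> (i, Suc i)" using that u by auto
      ultimately show "a < b" using mono[of "sw i a" "sw i b"] by simp
    qed (use mono False in auto)
    then show ?thesis using False range[of a] range[of b] by (auto simp: inversions_def)
  qed
  moreover have "(a, b) \<in> map_prod (sw i) (sw i) ` inversions n u \<longleftrightarrow> (sw i a, sw i b) \<in> inversions n u" for a b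
    by (force simp: image_iff)
  ultimately show ?thesis unfolding set_eq_iff split_paired_All insert_iff by blast
qed

lemma card_inversions_sw:
  assumes i: "1 \<le> i" "i < n" and u: "u i < u (Suc i)"
  shows "card (inversions n (u \<circ> sw i)) = Suc (card (inversions n u))"
proof -
  have "(i, Suc i) \<notin> map_prod (sw i) (sw i) ` inversions n u"
  proof
    assume "(i, Suc i) \<in> map_prod (sw i) (sw i) ` inversions n u"
    then obtain a b where "i = sw i a" "Suc i = sw i b" "a < b" by (auto simp: inversions_def)
    then have "a = sw i i" "b = sw i (Suc i)" "a < b" by (metis sw_sw)+
    then show False by (simp add: sw_def)
  qed
  moreover have "inj_on (map_prod (sw i) (sw i)) (inversions n u)"
    by (rule inj_onI) (metis map_prod_def prod.collapse prod.inject sw_sw case_prod_conv)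
  ultimately show ?thesis
    by (simp add: inversions_sw[OF assms] finite_inversions card_image)
qed

lemma ilen_up:
  assumes "1 \<le> i" "i < n" "w permutes {1..n}" "\<not> ldesc i w"
  shows "ilen n (sw i \<circ> w) = Suc (ilen n w)"
proof -
  have "inv w i \<noteq> inv w (Suc i)"
    using permutes_inj[OF permutes_inv[OF assms(3)]] by (metis inj_eq n_not_Suc_n)
  then have "inv w i < inv w (Suc i)" using assms(4) by (simp add: ldesc_def)
  then show ?thesis
    using card_inversions_sw[of i n "inv w"] assms by (simp add: ilen_def inv_sw_comp)
qed

lemma ldesc_sw:
  assumes "1 \<le> i" "i < n" "w permutes {1..n}"
  shows "ldesc i (sw i \<circ> w) \<longleftrightarrow> \<not> ldesc i w"
proof -
  have "inv w i \<noteq> inv w (Suc i)"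
    using permutes_inj[OF permutes_inv[OF assms(3)]] by (metis inj_eq n_not_Suc_n)
  then show ?thesis unfolding ldesc_def inv_sw_comp[OF assms] by (auto simp: sw_def)
qed

lemma sw_comp_permutes: "1 \<le> i \<Longrightarrow> i < n \<Longrightarrow> w permutes {1..n} \<Longrightarrow> sw i \<circ> w permutes {1..n}"
  by (intro permutes_compose sw_permutes)

lemma ilen_down:
  assumes "1 \<le> i" "i < n" "w permutes {1..n}" "ldesc i w"
  shows "ilen n w = Suc (ilen n (sw i \<circ> w))"
  using ilen_up[of i n "sw i \<circ> w"] ldesc_sw[of i n w] sw_comp_permutes[of i n w] assms
  by (simp add: sw_comp_sw)

lemma ldesc_iff_ilen:
  assumes "1 \<le> i" "i < n" "w permutes {1..n}"
  shows "ldesc i w \<longleftrightarrow> ilen n (sw i \<circ> w) < ilen n w"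
  using ilen_up[OF assms] ilen_down[OF assms] by linarith

text \<open>Without left descents u = \<open>inv w\<close> increases on 1, ..., n. Counting from the
  bottom gives i \<le> u i, counting from the top gives u i \<le> i.\<close>

lemma no_ldesc_imp_id:
  assumes w: "w permutes {1..n}" and nd: "\<And>i. 1 \<le> i \<Longrightarrow> i < n \<Longrightarrow> \<not> ldesc i w"
  shows "w = id"
proof -
  let ?u = "inv w"
  have u: "?u permutes {1..n}" by (rule permutes_inv[OF w])
  have step: "?u i < ?u (Suc i)" if "1 \<le> i" "i < n" for i
    using nd[OF that] permutes_inj[OF u] unfolding ldesc_def by (metis inj_eq n_not_Suc_n not_less_iff_gr_or_eq)
  have lower: "1 \<le> i \<Longrightarrow> i \<le> n \<Longrightarrow> i \<le> ?u i" for i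
  proof (induction i rule: nat_induct_at_least)
    case base
    then show ?case using permutes_in_image[OF u, of 1] by simp
  next
    case (Suc i)
    then show ?case using step[of i] by simp
  qed
  have upper: "k < n \<Longrightarrow> ?u (n - k) \<le> n - k" for k
  proof (induction k)
    case 0
    then show ?case using permutes_in_image[OF u, of n] by simp
  next
    case (Suc k)
    then show ?case using step[of "n - Suc k"] by (simp add: Suc_diff_Suc Suc_le_eq)
  qed
  have "?u i = i" for i
  proof (cases "i \<in> {1..n}")
    case True
    then show ?thesis using lower[of i] upper[of "n - i"] by simp
  next
    case False
    then show ?thesis using permutes_not_in[OF u] by blast
  qed
  then have "?u = id" by (simp add: fun_eq_iff)
  then show ?thesis using permutes_inv_inv[OF w] by simp
qed

definition letters :: "nat \<Rightarrow> nat list \<Rightarrow> bool" where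
  "letters n v \<longleftrightarrow> (\<forall>i\<in>set v. 1 \<le> i \<and> i < n)"

definition reduced :: "nat \<Rightarrow> (nat \<Rightarrow> nat) \<Rightarrow> nat list \<Rightarrow> bool" where
  "reduced n w v \<longleftrightarrow> letters n v \<and> sprod v = w \<and> length v = ilen n w"

lemma sprod_Nil [simp]: "sprod [] = id" and sprod_Cons [simp]: "sprod (i # v) = sw i \<circ> sprod v"
  by (simp_all add: sprod_def)

lemma letters_simps [simp]: "letters n []" "letters n (i # v) \<longleftrightarrow> 1 \<le> i \<and> i < n \<and> letters n v"
  by (auto simp: letters_def)

lemma sprod_permutes: "letters n v \<Longrightarrow> sprod v permutes {1..n}"
  by (induction v) (simp_all add: permutes_id sw_comp_permutes del: id_apply One_nat_def)

lemma ilen_id: "ilen n id = 0"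
proof -
  have "inversions n (inv id) = {}" by (auto simp: inversions_def)
  then show ?thesis by (simp only: ilen_def card.empty)
qed

lemma ilen_le_length: "letters n v \<Longrightarrow> ilen n (sprod v) \<le> length v"
proof (induction v)
  case (Cons i v)
  then have *: "1 \<le> i" "i < n" "sprod v permutes {1..n}" "ilen n (sprod v) \<le> length v"
    using sprod_permutes by simp_all
  have "ilen n (sw i \<circ> sprod v) \<le> Suc (length v)"
    using ilen_up[OF *(1-3)] ilen_down[OF *(1-3)] *(4) by linarith
  then show ?case unfolding sprod_Cons length_Cons .
qed (simp add: ilen_id)

lemma ilen_pos_imp_ldesc:
  assumes "w permutes {1..n}" "0 < ilen n w"
  obtains i where "1 \<le> i" "i < n" "ldesc i w"
  using no_ldesc_imp_id[OF assms(1)] assms(2) ilen_id by (metis less_irrefl)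

lemma ex_reduced: "w permutes {1..n} \<Longrightarrow> \<exists>v. reduced n w v"
proof (induction "ilen n w" arbitrary: w)
  case 0
  then have "w = id" using ilen_down no_ldesc_imp_id by (metis nat.distinct(1))
  then have "reduced n w []"
    by (simp only: reduced_def letters_simps sprod_Nil list.size ilen_id simp_thms)
  then show ?case by blast
next
  case (Suc k)
  then obtain i where i: "1 \<le> i" "i < n" "ldesc i w" using ilen_pos_imp_ldesc[OF Suc(3)] by (metis zero_less_Suc)
  have "ilen n (sw i \<circ> w) = k" "sw i \<circ> w permutes {1..n}"
    using ilen_down[OF i(1,2) Suc(3) i(3)] Suc(2) sw_comp_permutes[OF i(1,2) Suc(3)] by simp_all
  then obtain v where "reduced n (sw i \<circ> w) v" using Suc(1) by blast
  then have "reduced n w (i # v)"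
    using i \<open>ilen n (sw i \<circ> w) = k\<close> Suc(2)
    by (simp only: reduced_def sw_comp_sw letters_simps sprod_Cons list.size) simp
  then show ?case by blast
qed

text \<open>No word is shorter than the inversion number, by \<open>ilen_le_length\<close>, and
  \<open>ex_reduced\<close> attains it. Minimality among all words therefore amounts to having that
  length.\<close>

lemma is_redword_iff: "w permutes {1..n} \<Longrightarrow> is_redword n w v \<longleftrightarrow> reduced n w v"
proof -
  assume w: "w permutes {1..n}"
  obtain v' where v': "reduced n w v'" using ex_reduced[OF w] by blast
  show ?thesis
  proof
    assume "is_redword n w v"
    then have "letters n v" "sprod v = w" "length v \<le> length v'"
      using v' by (auto simp: is_redword_def reduced_def letters_def)
    then show "reduced n w v" using v' ilen_le_length[of n v] by (simp add: reduced_def)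
  next
    assume "reduced n w v"
    then show "is_redword n w v"
      unfolding is_redword_def reduced_def letters_def[symmetric] using ilen_le_length[of n] by metis
  qed
qed

lemma reduced_redword: "w permutes {1..n} \<Longrightarrow> reduced n w (redword n w)"
  unfolding redword_def using ex_reduced is_redword_iff by (metis someI_ex)

lemma reduced_Cons:
  assumes "w permutes {1..n}" "reduced n w (i # v)"
  shows "1 \<le> i" "i < n" "ldesc i w" "reduced n (sw i \<circ> w) v"
proof -
  have *: "1 \<le> i" "i < n" "letters n v" "sprod v = sw i \<circ> w" "ilen n w = Suc (length v)"
    using assms(2) by (auto simp only: reduced_def letters_simps sprod_Cons list.size sw_comp_sw)
  moreover have "ldesc i w"
    using ldesc_iff_ilen[OF *(1,2) assms(1)] ilen_le_length[OF *(3)] * by simp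
  ultimately show "1 \<le> i" "i < n" "ldesc i w" "reduced n (sw i \<circ> w) v"
    using ilen_down[of i n w] assms(1) by (simp_all add: reduced_def)
qed

lemma reduced_ConsI:
  assumes "w permutes {1..n}" "1 \<le> i" "i < n" "ldesc i w" "reduced n (sw i \<circ> w) v"
  shows "reduced n w (i # v)"
  using assms ilen_down[of i n w]
  by (simp only: reduced_def sw_comp_sw letters_simps sprod_Cons list.size) simp

text \<open>Both descents mean that \<open>inv w\<close> is decreasing on i, i + 1, i + 2. Three
  letters can then be removed in either order of the braid relation, each removal being a
  descent.\<close>

lemma sprod_braid_ldesc:
  assumes w: "w permutes {1..n}" and i: "1 \<le> i" "Suc i < n" and d: "ldesc i w" "ldesc (Suc i) w"
  shows "ldesc (Suc i) (sw i \<circ> w)" "ldesc i (sw (Suc i) \<circ> (sw i \<circ> w))"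
    "ldesc i (sw (Suc i) \<circ> w)" "ldesc (Suc i) (sw i \<circ> (sw (Suc i) \<circ> w))"
proof -
  have i': "i < n" "1 \<le> Suc i" using i by simp_all
  note 1 = inv_sw_comp[OF i(1) i'(1) w] and 2 = inv_sw_comp[OF i'(2) i(2) w]
  have 3: "inv (sw (Suc i) \<circ> (sw i \<circ> w)) = inv w \<circ> sw i \<circ> sw (Suc i)"
    using inv_sw_comp[OF i'(2) i(2) sw_comp_permutes[OF i(1) i'(1) w]] by (simp only: 1)
  have 4: "inv (sw i \<circ> (sw (Suc i) \<circ> w)) = inv w \<circ> sw (Suc i) \<circ> sw i"
    using inv_sw_comp[OF i(1) i'(1) sw_comp_permutes[OF i'(2) i(2) w]] by (simp only: 2)
  show "ldesc (Suc i) (sw i \<circ> w)" "ldesc i (sw (Suc i) \<circ> (sw i \<circ> w))"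
    "ldesc i (sw (Suc i) \<circ> w)" "ldesc (Suc i) (sw i \<circ> (sw (Suc i) \<circ> w))"
    using d unfolding ldesc_def 1 2 3 4 by (auto simp: sw_def)
qed

locale braid_family =
  fixes n :: nat and gs :: "nat \<Rightarrow> 'b::monoid_mult"
  assumes gs_comm: "1 \<le> i \<Longrightarrow> i + 2 \<le> j \<Longrightarrow> j < n \<Longrightarrow> gs i * gs j = gs j * gs i"
    and gs_braid: "1 \<le> i \<Longrightarrow> Suc i < n \<Longrightarrow> gs i * gs (Suc i) * gs i = gs (Suc i) * gs i * gs (Suc i)"
begin

abbreviation gprod where "gprod v \<equiv> prod_list (map gs v)"

text \<open>Two reduced words starting with different letters i and j are both compared with a reduced
  word starting with the longest element of the subgroup generated by i and j.\<close>

lemma gprod_reduced_aux: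
  assumes IH: "\<And>u v v'. ilen n u < ilen n w \<Longrightarrow> u permutes {1..n} \<Longrightarrow> reduced n u v \<Longrightarrow> reduced n u v' \<Longrightarrow>
      gprod v = gprod v'"
    and w: "w permutes {1..n}" and v: "reduced n w (i # v)" "reduced n w (j # v')" and "i < j"
  shows "gprod (i # v) = gprod (j # v')"
proof -
  note r = reduced_Cons[OF w v(1)] reduced_Cons[OF w v(2)]
  have wi: "sw i \<circ> w permutes {1..n}" and wj: "sw j \<circ> w permutes {1..n}"
    by (rule sw_comp_permutes[OF r(1,2) w], rule sw_comp_permutes[OF r(5,6) w])
  have li: "ilen n (sw i \<circ> w) < ilen n w" and lj: "ilen n (sw j \<circ> w) < ilen n w"
    using ldesc_iff_ilen[OF r(1,2) w] r(3) ldesc_iff_ilen[OF r(5,6) w] r(7) by simp_all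
  show ?thesis
  proof (cases "j = Suc i")
    case True
    note d = sprod_braid_ldesc[OF w _ _ r(3), folded True, OF r(1) r(6) r(7)]
    obtain t where t: "reduced n (sw i \<circ> (sw j \<circ> (sw i \<circ> w))) t"
      using ex_reduced[OF sw_comp_permutes[OF r(1,2) sw_comp_permutes[OF r(5,6) wi]]] by blast
    \<comment> \<open>The two triple products of the braid relation are equal, so one tail t
      completes both reduced words.\<close>
    then have t': "reduced n (sw j \<circ> (sw i \<circ> (sw j \<circ> w))) t" by (simp add: True sw_braid)
    have "reduced n (sw i \<circ> w) (j # i # t)" "reduced n (sw j \<circ> w) (i # j # t)"
      using reduced_ConsI[OF wi r(5,6) d(1) reduced_ConsI[OF sw_comp_permutes[OF r(5,6) wi] r(1,2) d(2) t]]
        reduced_ConsI[OF wj r(1,2) d(3) reduced_ConsI[OF sw_comp_permutes[OF r(1,2) wj] r(5,6) d(4) t']]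
      by blast+
    then have "gprod v = gprod (j # i # t)" "gprod v' = gprod (i # j # t)"
      using IH[OF li wi r(4)] IH[OF lj wj r(8)] by blast+
    then show ?thesis using gs_braid[of i] r True by (simp flip: mult.assoc)
  next
    case False
    then have ij: "i + 2 \<le> j" using \<open>i < j\<close> by simp
    have d: "ldesc j (sw i \<circ> w)" "ldesc i (sw j \<circ> w)"
      using r ij unfolding ldesc_def inv_sw_comp[OF r(1,2) w] inv_sw_comp[OF r(5,6) w]
      by (auto simp: sw_def)
    obtain t where t: "reduced n (sw j \<circ> (sw i \<circ> w)) t"
      using ex_reduced[OF sw_comp_permutes[OF r(5,6) wi]] by blast
    then have t': "reduced n (sw i \<circ> (sw j \<circ> w)) t" using ij by (simp add: sw_comm)
    have "reduced n (sw i \<circ> w) (j # t)" "reduced n (sw j \<circ> w) (i # t)"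
      using reduced_ConsI[OF wi r(5,6) d(1) t] reduced_ConsI[OF wj r(1,2) d(2) t'] by blast+
    then have "gprod v = gprod (j # t)" "gprod v' = gprod (i # t)"
      using IH[OF li wi r(4)] IH[OF lj wj r(8)] by blast+
    then show ?thesis using gs_comm[of i j] r ij by (simp flip: mult.assoc)
  qed
qed

text \<open>Matsumoto's theorem. Equal first letters are cancelled by induction on the length,
  different ones are handled by \<open>gprod_reduced_aux\<close>. Only the braid and commutation
  relations enter, so it serves every ring in which the \<open>gs\<close> satisfy them.\<close>

lemma gprod_reduced:
  "w permutes {1..n} \<Longrightarrow> reduced n w v \<Longrightarrow> reduced n w v' \<Longrightarrow> gprod v = gprod v'"
proof (induction "ilen n w" arbitrary: w v v' rule: less_induct)
  case less
  have len: "length v = ilen n w" "length v' = ilen n w" using less.prems by (simp_all add: reduced_def)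
  show ?case
  proof (cases v)
    case Nil
    then show ?thesis using len by simp
  next
    case (Cons i u)
    then obtain j u' where v': "v' = j # u'" using len by (cases v') auto
    note r = reduced_Cons[OF less.prems(1) less.prems(2)[unfolded Cons]]
      reduced_Cons[OF less.prems(1) less.prems(3)[unfolded v']]
    consider "i < j" | "j < i" | "i = j" by linarith
    then show ?thesis
    proof cases
      case 3
      then have "gprod u = gprod u'"
        using less.hyps[of "sw i \<circ> w" u u'] r ldesc_iff_ilen[OF r(1,2) less.prems(1)]
          sw_comp_permutes[OF r(1,2) less.prems(1)] by blast
      then show ?thesis using 3 Cons v' by simp
    next
      case 1
      show ?thesis unfolding Cons v'
        by (rule gprod_reduced_aux[OF less.hyps less.prems(1) less.prems(2)[unfolded Cons] less.prems(3)[unfolded v'] 1])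
    next
      case 2
      show ?thesis unfolding Cons v'
        by (rule gprod_reduced_aux[OF less.hyps less.prems(1) less.prems(3)[unfolded v'] less.prems(2)[unfolded Cons] 2, symmetric])
    qed
  qed
qed

definition gw where "gw w = gprod (redword n w)"

lemma gw_id: "gw id = 1"
  using reduced_redword[of id n] by (simp add: gw_def reduced_def ilen_id permutes_id)

lemma gw_down:
  assumes "w permutes {1..n}" "1 \<le> i" "i < n" "ldesc i w"
  shows "gw w = gs i * gw (sw i \<circ> w)"
proof -
  have "reduced n (sw i \<circ> w) (redword n (sw i \<circ> w))"
    using assms by (intro reduced_redword sw_comp_permutes)
  then have "reduced n w (i # redword n (sw i \<circ> w))" using assms reduced_ConsI by blast
  then show ?thesis using gprod_reduced[OF assms(1) reduced_redword[OF assms(1)]] by (simp add: gw_def)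
qed

lemma gw_up:
  assumes "w permutes {1..n}" "1 \<le> i" "i < n" "\<not> ldesc i w"
  shows "gs i * gw w = gw (sw i \<circ> w)"
  using gw_down[of "sw i \<circ> w" i] ldesc_sw[of i n w] sw_comp_permutes[of i n w] assms
  by (simp add: sw_comp_sw)

end

section \<open>The Bernstein presentation\<close>

lemma finite_lam: "1 \<le> r \<Longrightarrow> finite (lam r n)"
proof -
  assume "1 \<le> r"
  then have "finite {z::complex. z ^ r = 1}" by (intro finite_roots_unity) auto
  then have "finite {l. set l \<subseteq> {z::complex. z ^ r = 1} \<and> length l = n}" by (rule finite_lists_length_eq)
  moreover have "lam r n = {l. set l \<subseteq> {z::complex. z ^ r = 1} \<and> length l = n}"
    by (auto simp: lam_def)
  ultimately show ?thesis by simp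
qed

lemma length_slam [simp]: "length (slam i l) = length l"
  by (simp add: slam_def)

lemma nth_slam: "1 \<le> i \<Longrightarrow> i < length l \<Longrightarrow> k < length l \<Longrightarrow>
    slam i l ! k = (if k = i - 1 then l ! i else if k = i then l ! (i - 1) else l ! k)"
  by (auto simp: slam_def nth_list_update)

lemma slam_slam: "1 \<le> i \<Longrightarrow> i < length l \<Longrightarrow> slam i (slam i l) = l"
  by (rule nth_equalityI) (auto simp: nth_slam)

lemma slam_lam: "1 \<le> i \<Longrightarrow> i < n \<Longrightarrow> l \<in> lam r n \<Longrightarrow> slam i l \<in> lam r n"
  by (auto simp: lam_def all_set_conv_all_nth nth_slam)

lemma sfix_iff: "1 \<le> i \<Longrightarrow> i < length l \<Longrightarrow> sfix i l \<longleftrightarrow> l ! (i - 1) = l ! i"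
proof
  assume i: "1 \<le> i" "i < length l"
  show "l ! (i - 1) = l ! i" if "sfix i l"
    using nth_slam[OF i, of "i - 1"] that i by (simp add: sfix_def)
  show "sfix i l" if "l ! (i - 1) = l ! i"
    unfolding sfix_def using that i by (intro nth_equalityI) (auto simp: nth_slam)
qed

lemma bij_betw_slam: "1 \<le> i \<Longrightarrow> i < n \<Longrightarrow> bij_betw (slam i) (lam r n) (lam r n)"
  by (rule bij_betw_byWitness[of _ "slam i"]) (auto simp: slam_lam, auto simp: lam_def slam_slam)

lemma mult_commute_closed:
  fixes a :: "'b::monoid_mult"
  shows "a * b = b * a \<Longrightarrow> a * c = c * a \<Longrightarrow> a * (b * c) = b * c * a"
  by (metis mult.assoc)

lemma prod_list_update_commuting:
  fixes f :: "nat \<Rightarrow> 'b::monoid_mult"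
  assumes "distinct xs" "i \<in> set xs" "\<And>j. j \<in> set xs \<Longrightarrow> y * f j = f j * y"
  shows "y * prod_list (map f xs) = prod_list (map (f(i := y * f i)) xs)"
  using assms
proof (induction xs)
  case (Cons a xs)
  show ?case
  proof (cases "a = i")
    case True
    then have "map (f(i := y * f i)) xs = map f xs" using Cons.prems(1) by auto
    then show ?thesis using True by (simp only: True list.map fun_upd_same prod_list.Cons mult.assoc)
  next
    case False
    have "y * (f a * prod_list (map f xs)) = f a * (y * prod_list (map f xs))"
      using Cons.prems(3)[of a] by (simp flip: mult.assoc)
    then show ?thesis using False Cons by simp
  qed
qed simp

text \<open>With y = X_k, a = g_k and b = g_(k+1) this says that X_(k+1) and X_(k+2) commute. Both
  sides reduce to a b y a y a b a: b moves past y, the braid relation is applied to a and b, and the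
  four-term relation reverses y a y a.\<close>

lemma braid_conjugates_commute:
  fixes a b y :: "'b::monoid_mult"
  assumes yb: "b * y = y * b" and ay: "a * y * a * y = y * a * y * a" and ab: "a * b * a = b * a * b"
  shows "(a * y * a) * (b * (a * y * a) * b) = (b * (a * y * a) * b) * (a * y * a)"
proof -
  have yb': "b * (y * z) = y * (b * z)" and ab': "a * (b * (a * z)) = b * (a * (b * z))"
    and ay': "a * (y * (a * (y * z))) = y * (a * (y * (a * z)))" for z
    using yb ab ay by (simp_all flip: mult.assoc)
  have "(a * y * a) * (b * (a * y * a) * b) = a * (y * (a * (b * (a * (y * (a * b))))))"
    by (simp add: mult.assoc)
  also have "\<dots> = a * (b * (y * (a * (y * (b * (a * b))))))"
    by (simp add: ab' yb')
  also have "\<dots> = a * (b * (y * (a * (y * (a * (b * a))))))"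
    using ab by (simp add: mult.assoc)
  also have "\<dots> = b * (a * (y * (a * (b * (a * (y * a))))))"
  proof -
    have "y * (a * (y * (a * (b * a)))) = a * (y * (a * (y * (b * a))))" by (simp add: ay')
    then have "a * (b * (y * (a * (y * (a * (b * a)))))) = a * (b * (a * (y * (a * (y * (b * a))))))" by simp
    also have "\<dots> = b * (a * (y * (b * (a * (b * (y * a))))))" by (simp add: ab' yb')
    finally show ?thesis by (simp add: ab')
  qed
  finally show ?thesis by (simp add: mult.assoc)
qed

text \<open>The relations are stated in an arbitrary ring because four rings satisfy them: the
  algebra over A, its base change, the Yokonuma algebra with its eigenprojections, and a ring of
  operators. The parameter \<open>qd\<close> stands for q - 1/q; it is only asked to commute with
  the \<open>gs\<close>, since it is not central among the operators.\<close>

locale yokonuma_hecke =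
  fixes r n :: nat and gs :: "nat \<Rightarrow> 'b::{ring,monoid_mult}" and es :: "complex list \<Rightarrow> 'b"
    and x xi qd :: 'b
  assumes r_pos: "1 \<le> r"
    and g_comm: "1 \<le> i \<Longrightarrow> i + 2 \<le> j \<Longrightarrow> j < n \<Longrightarrow> gs i * gs j = gs j * gs i"
    and g_braid: "1 \<le> i \<Longrightarrow> Suc i < n \<Longrightarrow> gs i * gs (Suc i) * gs i = gs (Suc i) * gs i * gs (Suc i)"
    and g_e: "1 \<le> i \<Longrightarrow> i < n \<Longrightarrow> l \<in> lam r n \<Longrightarrow> gs i * es l = es (slam i l) * gs i"
    and sum_e: "(\<Sum>l\<in>lam r n. es l) = 1"
    and e_e: "l \<in> lam r n \<Longrightarrow> l' \<in> lam r n \<Longrightarrow> es l * es l' = (if l = l' then es l else 0)"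
    and g_sq: "1 \<le> i \<Longrightarrow> i < n \<Longrightarrow> gs i * gs i = 1 + qd * (\<Sum>l\<in>{l \<in> lam r n. sfix i l}. gs i * es l)"
    and x_xi: "x * xi = 1" and xi_x: "xi * x = 1"
    and g_x_g_x: "2 \<le> n \<Longrightarrow> gs 1 * x * gs 1 * x = x * gs 1 * x * gs 1"
    and g_x: "2 \<le> i \<Longrightarrow> i < n \<Longrightarrow> gs i * x = x * gs i"
    and x_e: "l \<in> lam r n \<Longrightarrow> x * es l = es l * x"
    and qd_g: "1 \<le> i \<Longrightarrow> i < n \<Longrightarrow> qd * gs i = gs i * qd"
begin

sublocale braid_family n gs
  by unfold_locales (fact g_comm, fact g_braid)

definition ee where "ee i = (\<Sum>l\<in>{l \<in> lam r n. sfix i l}. es l)"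
text \<open>The inverse of g: the quadratic relation g g = 1 + qd e g gives g (g - qd e) =
  1.\<close>

definition gi where "gi i = gs i - qd * ee i"

text \<open>Indices are shifted: \<open>Xp i\<close> is X_(i+1), matching list positions that start
  at 0, while \<open>gs\<close> keeps its numbering from 1. \<open>Xq i\<close> is the inverse of
  \<open>Xp i\<close> for i < n.\<close>

primrec Xp :: "nat \<Rightarrow> 'b" where
  "Xp 0 = x" | "Xp (Suc i) = gs (Suc i) * Xp i * gs (Suc i)"
primrec Xq :: "nat \<Rightarrow> 'b" where
  "Xq 0 = xi" | "Xq (Suc i) = gi (Suc i) * Xq i * gi (Suc i)"

lemma g_ee: "1 \<le> i \<Longrightarrow> i < n \<Longrightarrow> gs i * ee i = ee i * gs i"
  unfolding ee_def sum_distrib_left sum_distrib_right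
  by (rule sum.cong) (auto simp: g_e sfix_def)

lemma g_sq': "1 \<le> i \<Longrightarrow> i < n \<Longrightarrow> gs i * gs i = 1 + qd * (ee i * gs i)"
  using g_sq[of i] by (simp add: ee_def g_ee[unfolded ee_def] flip: sum_distrib_left)

lemma g_gi: "1 \<le> i \<Longrightarrow> i < n \<Longrightarrow> gs i * gi i = 1"
proof -
  assume i: "1 \<le> i" "i < n"
  have "gs i * (qd * ee i) = qd * gs i * ee i" using qd_g[OF i] by (simp flip: mult.assoc)
  then show ?thesis using i by (simp add: gi_def right_diff_distrib g_sq' g_ee mult.assoc)
qed

lemma gi_g: "1 \<le> i \<Longrightarrow> i < n \<Longrightarrow> gi i * gs i = 1"
  by (simp add: gi_def left_diff_distrib g_sq' mult.assoc)

lemma inverse_commute: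
  assumes "a * b = b * a" "b * b' = 1" "b' * b = 1"
  shows "a * b' = b' * (a::'b)"
proof -
  have "a * b' = b' * (b * a) * b'" using assms(3) by (simp flip: mult.assoc)
  also have "\<dots> = b' * a * (b * b')" by (simp only: assms(1)[symmetric] mult.assoc)
  finally show ?thesis using assms(2) by simp
qed

lemma Xp_Xq: "i < n \<Longrightarrow> Xp i * Xq i = 1 \<and> Xq i * Xp i = 1"
proof (induction i)
  case 0
  then show ?case by (simp add: x_xi xi_x)
next
  case (Suc i)
  then have *: "gs (Suc i) * gi (Suc i) = 1" "gi (Suc i) * gs (Suc i) = 1" by (simp_all add: g_gi gi_g)
  then have **: "gs (Suc i) * (gi (Suc i) * z) = z" "gi (Suc i) * (gs (Suc i) * z) = z"
    "Xp i * (Xq i * z) = z" "Xq i * (Xp i * z) = z" for z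
    using Suc by (simp_all flip: mult.assoc)
  show ?case by (simp add: mult.assoc * **)
qed

lemma Xp_e: "i < n \<Longrightarrow> l \<in> lam r n \<Longrightarrow> Xp i * es l = es l * Xp i"
proof (induction i arbitrary: l)
  case 0
  then show ?case by (simp add: x_e)
next
  case (Suc i)
  let ?l = "slam (Suc i) l"
  have l: "?l \<in> lam r n" "slam (Suc i) ?l = l"
    using slam_lam[of "Suc i" n l r] slam_slam[of "Suc i" l] Suc.prems by (simp_all add: lam_def)
  have "Xp (Suc i) * es l = gs (Suc i) * (Xp i * es ?l) * gs (Suc i)"
    using Suc by (simp add: mult.assoc g_e)
  also have "\<dots> = gs (Suc i) * es ?l * (Xp i * gs (Suc i))"
    using Suc l by (simp add: mult.assoc)
  also have "\<dots> = es l * Xp (Suc i)"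
    using Suc l by (simp add: mult.assoc g_e)
  finally show ?case .
qed

lemma gX_above: "k < j \<Longrightarrow> 1 \<le> j \<Longrightarrow> Suc k < j \<Longrightarrow> j < n \<Longrightarrow> gs j * Xp k = Xp k * gs j"
proof (induction k)
  case 0
  then show ?case by (simp add: g_x)
next
  case (Suc k)
  then have "gs j * gs (Suc k) = gs (Suc k) * gs j" using g_comm[of "Suc k" j] by simp
  moreover have "gs j * Xp k = Xp k * gs j" using Suc by simp
  ultimately show ?case by (auto simp: mult_commute_closed)
qed

text \<open>Only the case j = k of the induction step needs the braid relation: there a b a y a b =
  b a b y a b = b a y b a b = b a y a b a, where b passes y = \<open>Xp m\<close>.\<close>

lemma gX_below: "j < k \<Longrightarrow> 1 \<le> j \<Longrightarrow> k < n \<Longrightarrow> gs j * Xp k = Xp k * gs j"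
proof (induction k)
  case (Suc k)
  consider "j < k" | "j = k" using Suc by linarith
  then show ?case
  proof cases
    case 1
    then have "gs j * gs (Suc k) = gs (Suc k) * gs j" using g_comm[of j "Suc k"] Suc by simp
    moreover have "gs j * Xp k = Xp k * gs j" using Suc 1 by simp
    ultimately show ?thesis by (auto simp: mult_commute_closed)
  next
    case 2
    then obtain m where m: "k = Suc m" using Suc by (cases k) auto
    let ?a = "gs (Suc m)" and ?b = "gs (Suc (Suc m))" and ?y = "Xp m"
    have ab: "?a * ?b * ?a = ?b * ?a * ?b" using g_braid[of "Suc m"] Suc m by simp
    have yb: "?b * ?y = ?y * ?b" using gX_above[of m "Suc (Suc m)"] Suc m by simp
    have r: "?a * (?b * (?a * z)) = ?b * (?a * (?b * z))" "?b * (?y * z) = ?y * (?b * z)" for z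
      using ab yb by (simp_all flip: mult.assoc)
    have "?a * (?b * (?a * (?y * (?a * ?b)))) = ?b * (?a * (?y * (?b * (?a * ?b))))"
      by (simp add: r)
    also have "\<dots> = ?b * (?a * (?y * (?a * (?b * ?a))))"
      using ab by (simp add: mult.assoc)
    finally show ?thesis using 2 m by (simp add: mult.assoc)
  qed
qed simp

text \<open>Commutation of y = \<open>Xp i\<close> with g y g is the four-term relation between g
  and y. The induction hypothesis is thus exactly what \<open>braid_conjugates_commute\<close>
  requires for the next pair.\<close>

lemma X_step: "Suc i < n \<Longrightarrow> Xp i * Xp (Suc i) = Xp (Suc i) * Xp i"
proof (induction i)
  case 0
  then show ?case using g_x_g_x by (simp add: mult.assoc)
next
  case (Suc i)
  have "gs (Suc i) * Xp i * gs (Suc i) * Xp i = Xp i * gs (Suc i) * Xp i * gs (Suc i)"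
    using Suc by (simp add: mult.assoc)
  then show ?case
    using braid_conjugates_commute[of "gs (Suc (Suc i))" "Xp i" "gs (Suc i)"]
      gX_above[of i "Suc (Suc i)"] g_braid[of "Suc i"] Suc
    by simp
qed

lemma X_less: "i < j \<Longrightarrow> j < n \<Longrightarrow> Xp i * Xp j = Xp j * Xp i"
proof (induction j)
  case (Suc j)
  show ?case
  proof (cases "i = j")
    case True
    then show ?thesis using X_step Suc by blast
  next
    case False
    then have "Xp i * Xp j = Xp j * Xp i" "gs (Suc j) * Xp i = Xp i * gs (Suc j)"
      using Suc gX_above[of i "Suc j"] by simp_all
    then show ?thesis by (auto simp: mult_commute_closed)
  qed
qed simp

lemma X_comm: "i < n \<Longrightarrow> j < n \<Longrightarrow> Xp i * Xp j = Xp j * Xp i"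
  using X_less by (metis linorder_neq_iff)

lemma Xp_Xq_comm: "i < n \<Longrightarrow> j < n \<Longrightarrow> Xp i * Xq j = Xq j * Xp i"
  using inverse_commute[OF X_comm] Xp_Xq by blast

lemma Xq_comm: "i < n \<Longrightarrow> j < n \<Longrightarrow> Xq i * Xq j = Xq j * Xq i"
  using inverse_commute[OF Xp_Xq_comm[symmetric]] Xp_Xq by blast

lemma Xq_e: "i < n \<Longrightarrow> l \<in> lam r n \<Longrightarrow> Xq i * es l = es l * Xq i"
  using inverse_commute[OF Xp_e[symmetric]] Xp_Xq by metis

lemma gX_comm: "1 \<le> j \<Longrightarrow> j < n \<Longrightarrow> k < n \<Longrightarrow> k \<noteq> j \<Longrightarrow> Suc k \<noteq> j \<Longrightarrow> gs j * Xp k = Xp k * gs j"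
  using gX_above[of k j] gX_below[of j k] by linarith

lemma gXq_comm: "1 \<le> j \<Longrightarrow> j < n \<Longrightarrow> k < n \<Longrightarrow> k \<noteq> j \<Longrightarrow> Suc k \<noteq> j \<Longrightarrow> gs j * Xq k = Xq k * gs j"
  using inverse_commute[OF gX_comm] Xp_Xq by blast

text \<open>A Bernstein relation without denominators: if X' = g X g, then g X is X' times the
  inverse of g, which is g - qd e. The next three lemmas treat X' and the inverses of X and X'
  similarly.\<close>

lemma gX_low: "Suc j < n \<Longrightarrow> gs (Suc j) * Xp j = Xp (Suc j) * gs (Suc j) - Xp (Suc j) * (qd * ee (Suc j))"
  using g_gi[of "Suc j"] by (simp add: mult.assoc gi_def flip: right_diff_distrib)

lemma gX_high: "Suc j < n \<Longrightarrow> gs (Suc j) * Xp (Suc j) = Xp j * gs (Suc j) + qd * ee (Suc j) * Xp (Suc j)"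
proof -
  assume "Suc j < n"
  then have sq: "gs (Suc j) * gs (Suc j) = 1 + qd * (ee (Suc j) * gs (Suc j))" using g_sq' by simp
  have "gs (Suc j) * Xp (Suc j) = (gs (Suc j) * gs (Suc j)) * Xp j * gs (Suc j)"
    by (simp add: mult.assoc)
  then show ?thesis unfolding sq by (simp add: distrib_right mult.assoc)
qed

lemma gXq_high: "Suc j < n \<Longrightarrow> gs (Suc j) * Xq (Suc j) = Xq j * gs (Suc j) - Xq j * (qd * ee (Suc j))"
  using g_gi[of "Suc j"] by (simp add: gi_def right_diff_distrib flip: mult.assoc)

lemma gXq_low: "Suc j < n \<Longrightarrow> gs (Suc j) * Xq j = Xq (Suc j) * gs (Suc j) + qd * ee (Suc j) * Xq j"
proof -
  assume j: "Suc j < n"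
  have "gs (Suc j) * Xq (Suc j) * gs (Suc j) = (gs (Suc j) * gi (Suc j)) * Xq j * (gi (Suc j) * gs (Suc j))"
    by (simp add: mult.assoc)
  then have *: "Xq j = gs (Suc j) * Xq (Suc j) * gs (Suc j)" using j by (simp add: g_gi gi_g del: Xq.simps)
  then have "gs (Suc j) * Xq j = (gs (Suc j) * gs (Suc j)) * Xq (Suc j) * gs (Suc j)"
    by (metis mult.assoc)
  also have "\<dots> = Xq (Suc j) * gs (Suc j) + qd * ee (Suc j) * (gs (Suc j) * Xq (Suc j) * gs (Suc j))"
    using j by (simp add: g_sq' distrib_right mult.assoc del: Xq.simps)
  finally show ?thesis by (simp only: *[symmetric])
qed

definition xpw :: "nat \<Rightarrow> int \<Rightarrow> 'b" where
  "xpw i k = (if 0 \<le> k then Xp i ^ nat k else Xq i ^ nat (- k))"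

definition mon :: "int list \<Rightarrow> 'b" where
  "mon \<alpha> = prod_list (map (\<lambda>i. xpw i (\<alpha> ! i)) [0..<n])"

lemma comm_xpw: "y * Xp i = Xp i * y \<Longrightarrow> y * Xq i = Xq i * y \<Longrightarrow> y * xpw i k = xpw i k * y"
  using power_commuting_commutes[of "Xp i" y] power_commuting_commutes[of "Xq i" y]
  by (simp add: xpw_def)

lemma Xp_xpw: "i < n \<Longrightarrow> Xp i * xpw i k = xpw i (k + 1)"
proof -
  assume i: "i < n"
  consider "0 \<le> k" | "k < 0" by linarith
  then show ?thesis
  proof cases
    case 1
    then show ?thesis by (simp add: xpw_def nat_add_distrib)
  next
    case 2
    then have "nat (- k) = Suc (nat (- (k + 1)))" by simp
    then have "Xp i * xpw i k = Xq i ^ nat (- (k + 1))"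
      using 2 Xp_Xq[OF i] by (simp add: xpw_def flip: mult.assoc)
    then show ?thesis using 2 by (cases "k = - 1") (simp_all add: xpw_def)
  qed
qed

lemma Xq_xpw: "i < n \<Longrightarrow> Xq i * xpw i k = xpw i (k - 1)"
proof -
  assume i: "i < n"
  have "Xq i * (Xp i * xpw i (k - 1)) = xpw i (k - 1)" using Xp_Xq[OF i] by (simp flip: mult.assoc)
  then show ?thesis using Xp_xpw[OF i, of "k - 1"] by simp
qed

lemma Xp_mon:
  assumes i: "i < n" and \<alpha>: "length \<alpha> = n"
  shows "Xp i * mon \<alpha> = mon (\<alpha>[i := \<alpha> ! i + 1])"
proof -
  let ?f = "\<lambda>j. xpw j (\<alpha> ! j)"
  have "Xp i * mon \<alpha> = prod_list (map (?f(i := Xp i * ?f i)) [0..<n])"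
    unfolding mon_def using i
    by (intro prod_list_update_commuting) (auto intro!: comm_xpw simp: X_comm Xp_Xq_comm)
  also have "map (?f(i := Xp i * ?f i)) [0..<n] = map (\<lambda>j. xpw j (\<alpha>[i := \<alpha> ! i + 1] ! j)) [0..<n]"
    using i \<alpha> by (intro map_cong) (auto simp: Xp_xpw)
  finally show ?thesis by (simp add: mon_def)
qed

lemma Xq_mon:
  assumes i: "i < n" and \<alpha>: "length \<alpha> = n"
  shows "Xq i * mon \<alpha> = mon (\<alpha>[i := \<alpha> ! i - 1])"
proof -
  let ?f = "\<lambda>j. xpw j (\<alpha> ! j)"
  have "Xq i * mon \<alpha> = prod_list (map (?f(i := Xq i * ?f i)) [0..<n])"
    unfolding mon_def using i
    by (intro prod_list_update_commuting) (auto intro!: comm_xpw simp: Xq_comm Xp_Xq_comm)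
  also have "map (?f(i := Xq i * ?f i)) [0..<n] = map (\<lambda>j. xpw j (\<alpha>[i := \<alpha> ! i - 1] ! j)) [0..<n]"
    using i \<alpha> by (intro map_cong) (auto simp: Xq_xpw)
  finally show ?thesis by (simp add: mon_def)
qed

lemma comm_mon: "(\<And>i. i < n \<Longrightarrow> y * Xp i = Xp i * y \<and> y * Xq i = Xq i * y) \<Longrightarrow> y * mon \<alpha> = mon \<alpha> * y"
proof -
  assume a: "\<And>i. i < n \<Longrightarrow> y * Xp i = Xp i * y \<and> y * Xq i = Xq i * y"
  have "y * prod_list (map (\<lambda>i. xpw i (\<alpha> ! i)) is) = prod_list (map (\<lambda>i. xpw i (\<alpha> ! i)) is) * y"
    if "set is \<subseteq> {..<n}" for "is"
    using that
  proof (induction "is")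
    case (Cons i "is")
    then have "y * xpw i (\<alpha> ! i) = xpw i (\<alpha> ! i) * y" using a by (intro comm_xpw) auto
    then show ?case using Cons by (auto simp: mult_commute_closed)
  qed simp
  then show ?thesis by (simp add: mon_def atLeast_upt subset_eq)
qed

lemma e_mon: "l \<in> lam r n \<Longrightarrow> es l * mon \<alpha> = mon \<alpha> * es l"
  by (rule comm_mon) (simp add: Xp_e Xq_e)

lemma mon_zero: "mon (replicate n 0) = 1"
proof -
  have "map (\<lambda>i. xpw i (replicate n 0 ! i)) [0..<n] = map (\<lambda>_. 1) [0..<n]"
    by (simp add: xpw_def)
  then show ?thesis unfolding mon_def by (simp only: map_replicate_const prod_list_replicate power_one)
qed

end

text \<open>Linear combinations are built one term at a time, with repetitions. Closure under
  multiplication becomes a rule induction, and coefficient functions are recovered once, in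
  \<open>lspan_coefficients\<close>.\<close>

inductive_set lspan :: "('k \<Rightarrow> 'b::{ring,monoid_mult}) \<Rightarrow> 'b set \<Rightarrow> 'b set" for sc B where
  zero: "0 \<in> lspan sc B"
| step: "b \<in> B \<Longrightarrow> s \<in> lspan sc B \<Longrightarrow> sc c * b + s \<in> lspan sc B"

lemma lspan_add: "s \<in> lspan sc B \<Longrightarrow> t \<in> lspan sc B \<Longrightarrow> s + t \<in> lspan sc B"
  by (induction rule: lspan.induct) (auto simp: add.assoc intro: lspan.step)

lemma lspan_sum: "(\<And>i. i \<in> I \<Longrightarrow> f i \<in> lspan sc B) \<Longrightarrow> sum f I \<in> lspan sc B"
  by (induction I rule: infinite_finite_induct) (auto intro: lspan.zero lspan_add)

lemma lspan_base: "sc 1 = 1 \<Longrightarrow> b \<in> B \<Longrightarrow> b \<in> lspan sc B"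
  using lspan.step[OF _ lspan.zero, of b B sc 1] by simp

lemma lspan_mult:
  assumes "s \<in> lspan sc B" "\<And>b. b \<in> B \<Longrightarrow> y * b * z \<in> lspan sc B'"
    and "\<And>c v. sc c * v = v * sc c" "\<And>c d. sc c * sc d = sc (c * d)"
  shows "y * s * z \<in> lspan sc B'"
  using assms(1)
proof (induction rule: lspan.induct)
  case (step b s c)
  have *: "sc c * t \<in> lspan sc B'" if "t \<in> lspan sc B'" for t
    using that by (induction rule: lspan.induct)
      (auto simp: distrib_left assms(4) simp flip: mult.assoc intro: lspan.intros)
  have "y * (sc c * b) * z = sc c * (y * b * z)"
    by (metis assms(3) mult.assoc)
  then show ?case using step assms(2) * by (simp add: distrib_left distrib_right lspan_add)
qed (simp add: lspan.zero)

section \<open>Spanning by Laurent monomials, idempotents and reduced words\<close>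

locale yokonuma_hecke_scalars = yokonuma_hecke r n gs es x xi "sc d"
  for r n and gs :: "nat \<Rightarrow> 'b::{ring,monoid_mult}" and es x xi
    and sc :: "'k::comm_ring_1 \<Rightarrow> 'b" and d +
  assumes sc_add: "sc (a + b) = sc a + sc b" and sc_mult: "sc (a * b) = sc a * sc b"
    and sc_one: "sc 1 = 1" and sc_central: "sc c * y = y * sc c"
begin

definition monomials where "monomials = {mon \<alpha> * es l |\<alpha> l. length \<alpha> = n \<and> l \<in> lam r n}"
definition standard where
  "standard = {mon \<alpha> * es l * gw w |\<alpha> l w. length \<alpha> = n \<and> l \<in> lam r n \<and> w permutes {1..n}}"

text \<open>The subalgebra generated by scalars, idempotents and the X-elements with their inverses,
  described by closure and not as a span. Commutation with g is then checked on generators, sums and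
  products, without treating integer exponents.\<close>

inductive_set Psub :: "'b set" where
  sc: "sc c \<in> Psub"
| e: "l \<in> lam r n \<Longrightarrow> es l \<in> Psub"
| X: "i < n \<Longrightarrow> Xp i \<in> Psub"
| Xi: "i < n \<Longrightarrow> Xq i \<in> Psub"
| add: "p \<in> Psub \<Longrightarrow> p' \<in> Psub \<Longrightarrow> p + p' \<in> Psub"
| mult: "p \<in> Psub \<Longrightarrow> p' \<in> Psub \<Longrightarrow> p * p' \<in> Psub"

lemma sc_zero: "sc 0 = 0"
  using sc_add[of 0 0] by simp

lemma sc_neg: "sc (- a) = - sc a"
  using sc_add[of a "- a"] by (simp add: sc_zero eq_neg_iff_add_eq_0 add.commute)

lemma Psub_one: "1 \<in> Psub" and Psub_zero: "0 \<in> Psub"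
  using Psub.sc[of 1] Psub.sc[of 0] by (simp_all add: sc_one sc_zero)

lemma Psub_neg: "p \<in> Psub \<Longrightarrow> - p \<in> Psub"
  using Psub.mult[OF Psub.sc, of p "- 1"] by (simp add: sc_neg sc_one)

lemma Psub_sum: "(\<And>i. i \<in> I \<Longrightarrow> f i \<in> Psub) \<Longrightarrow> sum f I \<in> Psub"
  by (induction I rule: infinite_finite_induct) (auto intro: Psub.add Psub_zero)

lemma Psub_ee: "ee i \<in> Psub"
  unfolding ee_def by (intro Psub_sum Psub.e) auto

lemma Psub_power: "p \<in> Psub \<Longrightarrow> p ^ k \<in> Psub"
  by (induction k) (auto intro: Psub_one Psub.mult)

lemma Psub_mon: "mon \<alpha> \<in> Psub"
proof -
  have "prod_list (map (\<lambda>i. xpw i (\<alpha> ! i)) is) \<in> Psub" if "set is \<subseteq> {..<n}" for "is"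
    using that by (induction "is") (auto simp: xpw_def intro!: Psub_one Psub.mult Psub_power Psub.X Psub.Xi)
  then show ?thesis by (simp add: mon_def atLeast_upt subset_eq)
qed

lemma g_PsubI: "p1 \<in> Psub \<Longrightarrow> p2 \<in> Psub \<Longrightarrow> gs j * p = p1 * gs j + p2 \<Longrightarrow>
    \<exists>p1\<in>Psub. \<exists>p2\<in>Psub. gs j * p = p1 * gs j + p2"
  by blast

text \<open>Passing from p to p1 mimics the simple reflection, and p2 is the correction term of a
  twisted derivation: products are handled by g p p' = p1 (g p') + p2 p'. The generators are covered
  by the Bernstein relations.\<close>

lemma g_Psub:
  assumes j: "Suc j < n" and "p \<in> Psub"
  shows "\<exists>p1\<in>Psub. \<exists>p2\<in>Psub. gs (Suc j) * p = p1 * gs (Suc j) + p2"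
  using assms(2)
proof (induction rule: Psub.induct)
  case (sc c)
  then show ?case using sc_central[of c "gs (Suc j)"]
    by (intro g_PsubI[of "sc c" 0]) (auto intro: Psub.sc Psub_zero)
next
  case (e l)
  then show ?case using j slam_lam[of "Suc j" n l r]
    by (intro g_PsubI[of "es (slam (Suc j) l)" 0]) (auto simp: g_e intro: Psub.e Psub_zero)
next
  case (X k)
  consider "k = j" | "k = Suc j" | "k \<noteq> j" "k \<noteq> Suc j" by blast
  then show ?case
  proof cases
    case 1
    then show ?thesis using j gX_low[of j]
      by (intro g_PsubI[of "Xp (Suc j)" "- (Xp (Suc j) * (sc d * ee (Suc j)))"])
        (auto intro!: Psub.X Psub_neg Psub.mult Psub.sc Psub_ee Psub_zero simp del: Xp.simps)
  next
    case 2
    then show ?thesis using j gX_high[of j]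
      by (intro g_PsubI[of "Xp j" "sc d * ee (Suc j) * Xp (Suc j)"])
        (auto intro!: Psub.X Psub.mult Psub.sc Psub_ee simp del: Xp.simps)
  next
    case 3
    then show ?thesis using j X gX_comm[of "Suc j" k]
      by (intro g_PsubI[of "Xp k" 0]) (auto intro: Psub.X Psub_zero)
  qed
next
  case (Xi k)
  consider "k = j" | "k = Suc j" | "k \<noteq> j" "k \<noteq> Suc j" by blast
  then show ?case
  proof cases
    case 2
    then show ?thesis using j gXq_high[of j]
      by (intro g_PsubI[of "Xq j" "- (Xq j * (sc d * ee (Suc j)))"])
        (auto intro!: Psub.Xi Psub_neg Psub.mult Psub.sc Psub_ee Psub_zero simp del: Xq.simps)
  next
    case 1
    then show ?thesis using j gXq_low[of j]
      by (intro g_PsubI[of "Xq (Suc j)" "sc d * ee (Suc j) * Xq j"])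
        (auto intro!: Psub.Xi Psub.mult Psub.sc Psub_ee simp del: Xq.simps)
  next
    case 3
    then show ?thesis using j Xi gXq_comm[of "Suc j" k]
      by (intro g_PsubI[of "Xq k" 0]) (auto intro: Psub.Xi Psub_zero)
  qed
next
  case (add p p')
  then obtain p1 p2 p1' p2' where p: "p1 \<in> Psub" "p2 \<in> Psub" "p1' \<in> Psub" "p2' \<in> Psub"
    "gs (Suc j) * p = p1 * gs (Suc j) + p2" "gs (Suc j) * p' = p1' * gs (Suc j) + p2'" by blast
  show ?case
    by (intro g_PsubI[of "p1 + p1'" "p2 + p2'"])
      (use p in \<open>simp_all add: distrib_left distrib_right Psub.add\<close>)
next
  case (mult p p')
  then obtain p1 p2 p1' p2' where p: "p1 \<in> Psub" "p2 \<in> Psub" "p1' \<in> Psub" "p2' \<in> Psub"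
    "gs (Suc j) * p = p1 * gs (Suc j) + p2" "gs (Suc j) * p' = p1' * gs (Suc j) + p2'" by blast
  have "gs (Suc j) * (p * p') = p1 * (gs (Suc j) * p') + p2 * p'"
    by (simp add: p(5) distrib_right mult.assoc flip: mult.assoc[of "gs (Suc j)"])
  then show ?case using p(1-4) mult.hyps
    by (intro g_PsubI[of "p1 * p1'" "p1 * p2' + p2 * p'"])
      (simp_all add: p(6) distrib_left mult.assoc add.assoc Psub.add Psub.mult)
qed

lemmas lspan_mult_sc = lspan_mult[where sc = sc, OF _ _ sc_central sc_mult[symmetric]]

lemma lspan_lmult: "s \<in> lspan sc B \<Longrightarrow> (\<And>b. b \<in> B \<Longrightarrow> y * b \<in> lspan sc B') \<Longrightarrow> y * s \<in> lspan sc B'"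
  using lspan_mult_sc[of s B y 1 B'] by simp

lemma lspan_rmult: "s \<in> lspan sc B \<Longrightarrow> (\<And>b. b \<in> B \<Longrightarrow> b * z \<in> lspan sc B') \<Longrightarrow> s * z \<in> lspan sc B'"
  using lspan_mult_sc[of s B 1 z B'] by simp

lemma monomials_base: "length \<alpha> = n \<Longrightarrow> l \<in> lam r n \<Longrightarrow> mon \<alpha> * es l \<in> lspan sc monomials"
  by (rule lspan_base[where sc = sc, OF sc_one]) (auto simp: monomials_def)

lemma Psub_mult_monomials: "p \<in> Psub \<Longrightarrow> t \<in> lspan sc monomials \<Longrightarrow> p * t \<in> lspan sc monomials"
proof (induction arbitrary: t rule: Psub.induct)
  case (sc c)
  show ?case
    by (rule lspan_lmult[OF sc]) (use lspan.step[OF _ lspan.zero, of _ monomials sc c] in simp)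
next
  case (e l)
  show ?case
  proof (rule lspan_lmult[OF e(2)])
    fix b assume "b \<in> monomials"
    then obtain \<alpha> l' where b: "b = mon \<alpha> * es l'" "length \<alpha> = n" "l' \<in> lam r n"
      by (auto simp: monomials_def)
    have "es l * b = mon \<alpha> * (es l * es l')" using e(1) b by (simp add: e_mon flip: mult.assoc)
    then show "es l * b \<in> lspan sc monomials"
      using e(1) b by (auto simp: e_e monomials_base lspan.zero)
  qed
next
  case (X i)
  show ?case
  proof (rule lspan_lmult[OF X(2)])
    fix b assume "b \<in> monomials"
    then obtain \<alpha> l where b: "b = mon \<alpha> * es l" "length \<alpha> = n" "l \<in> lam r n"
      by (auto simp: monomials_def)
    then show "Xp i * b \<in> lspan sc monomials"
      using X(1) by (simp add: Xp_mon monomials_base flip: mult.assoc)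
  qed
next
  case (Xi i)
  show ?case
  proof (rule lspan_lmult[OF Xi(2)])
    fix b assume "b \<in> monomials"
    then obtain \<alpha> l where b: "b = mon \<alpha> * es l" "length \<alpha> = n" "l \<in> lam r n"
      by (auto simp: monomials_def)
    then show "Xq i * b \<in> lspan sc monomials"
      using Xi(1) by (simp add: Xq_mon monomials_base flip: mult.assoc)
  qed
next
  case (add p p')
  then show ?case by (simp add: distrib_right lspan_add)
next
  case (mult p p')
  then show ?case by (simp add: mult.assoc)
qed

text \<open>Every monomial carries an idempotent, so 1 enters as the sum of all 1_\<lambda> with
  zero exponents.\<close>

lemma one_monomials: "1 \<in> lspan sc monomials"
proof -
  have "(\<Sum>l\<in>lam r n. es l) \<in> lspan sc monomials"
    using monomials_base[of "replicate n 0"] by (intro lspan_sum) (simp add: mon_zero)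
  then show ?thesis by (simp add: sum_e)
qed

lemma Psub_gw: "p \<in> Psub \<Longrightarrow> w permutes {1..n} \<Longrightarrow> p * gw w \<in> lspan sc standard"
proof -
  assume p: "p \<in> Psub" and w: "w permutes {1..n}"
  have "p \<in> lspan sc monomials" using Psub_mult_monomials[OF p one_monomials] by simp
  then show ?thesis
    by (rule lspan_rmult) (use w in \<open>auto simp: monomials_def standard_def intro!: lspan_base[where sc = sc, OF sc_one]\<close>)
qed

lemma Psub_mult_standard: "p \<in> Psub \<Longrightarrow> s \<in> lspan sc standard \<Longrightarrow> p * s \<in> lspan sc standard"
proof -
  assume p: "p \<in> Psub" and s: "s \<in> lspan sc standard"
  show ?thesis
  proof (rule lspan_lmult[OF s])
    fix b assume "b \<in> standard"
    then obtain \<alpha> l w where b: "b = mon \<alpha> * es l * gw w" "l \<in> lam r n" "w permutes {1..n}"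
      by (auto simp: standard_def)
    then have "p * b = (p * (mon \<alpha> * es l)) * gw w" by (simp add: mult.assoc)
    then show "p * b \<in> lspan sc standard"
      using Psub_gw p b by (simp add: Psub.mult Psub_mon Psub.e)
  qed
qed

lemma g_gw:
  assumes j: "Suc j < n" and w: "w permutes {1..n}"
  shows "gs (Suc j) * gw w \<in> lspan sc standard"
proof -
  have sw: "sw (Suc j) \<circ> w permutes {1..n}" using j w by (intro sw_comp_permutes) auto
  have base: "gw (sw (Suc j) \<circ> w) \<in> lspan sc standard" using Psub_gw[OF Psub_one sw] by simp
  show ?thesis
  proof (cases "ldesc (Suc j) w")
    case True
    \<comment> \<open>A descent lets one factor g be split off. The quadratic relation then turns g
      g into a shorter element plus a multiple of \<open>gw w\<close> itself.\<close>
    then have "gw w = gs (Suc j) * gw (sw (Suc j) \<circ> w)" using gw_down[OF w, of "Suc j"] j by simp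
    then have "gs (Suc j) * gw w = gw (sw (Suc j) \<circ> w) + sc d * ee (Suc j) * gw w"
      using g_sq'[of "Suc j"] j by (simp add: distrib_right flip: mult.assoc)
    then show ?thesis
      using base Psub_gw[of "sc d * ee (Suc j)", OF _ w] by (simp add: lspan_add Psub.mult Psub.sc Psub_ee)
  next
    case False
    then have "gs (Suc j) * gw w = gw (sw (Suc j) \<circ> w)" using gw_up[OF w, of "Suc j"] j by simp
    then show ?thesis using base by simp
  qed
qed

lemma g_mult_standard:
  assumes j: "Suc j < n" and s: "s \<in> lspan sc standard"
  shows "gs (Suc j) * s \<in> lspan sc standard"
proof (rule lspan_lmult[OF s])
  fix b assume "b \<in> standard"
  then obtain \<alpha> l w where b: "b = mon \<alpha> * es l * gw w" "l \<in> lam r n" "w permutes {1..n}"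
    by (auto simp: standard_def)
  have "mon \<alpha> * es l \<in> Psub" using b by (simp add: Psub.mult Psub_mon Psub.e)
  then obtain p1 p2 where p: "p1 \<in> Psub" "p2 \<in> Psub"
    "gs (Suc j) * (mon \<alpha> * es l) = p1 * gs (Suc j) + p2"
    using g_Psub[OF j] by blast
  have "gs (Suc j) * b = gs (Suc j) * (mon \<alpha> * es l) * gw w" by (simp add: b mult.assoc)
  also have "\<dots> = p1 * (gs (Suc j) * gw w) + p2 * gw w"
    by (simp add: p(3) distrib_right mult.assoc)
  finally show "gs (Suc j) * b \<in> lspan sc standard"
    using p b by (simp add: lspan_add Psub_mult_standard g_gw[OF j] Psub_gw)
qed

lemma one_standard: "1 \<in> lspan sc standard"
  using Psub_gw[OF Psub_one permutes_id] by (simp add: gw_id)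

end

section \<open>Evaluation of Laurent polynomials\<close>

definition evl :: "real \<Rightarrow> (int \<Rightarrow>\<^sub>0 int) \<Rightarrow> real" where
  "evl t p = (\<Sum>k\<in>Poly_Mapping.keys p. of_int (Poly_Mapping.lookup p k) * t powi k)"

lemma evl_superset:
  "finite S \<Longrightarrow> Poly_Mapping.keys p \<subseteq> S \<Longrightarrow> evl t p = (\<Sum>k\<in>S. of_int (Poly_Mapping.lookup p k) * t powi k)"
  unfolding evl_def by (intro sum.mono_neutral_left) (auto simp: in_keys_iff)

lemma evl_add: "evl t (p + q) = evl t p + evl t q"
proof -
  let ?S = "Poly_Mapping.keys p \<union> Poly_Mapping.keys q"
  have "evl t (p + q) = (\<Sum>k\<in>?S. of_int (Poly_Mapping.lookup (p + q) k) * t powi k)"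
    by (rule evl_superset) (auto dest: subsetD[OF keys_add])
  also have "\<dots> = evl t p + evl t q"
    by (subst (1 2) evl_superset[of ?S]) (auto simp: lookup_add distrib_right sum.distrib)
  finally show ?thesis .
qed

lemma evl_zero: "evl t 0 = 0"
  by (simp add: evl_def)

lemma evl_sum: "evl t (sum f S) = (\<Sum>i\<in>S. evl t (f i))"
  by (induction S rule: infinite_finite_induct) (simp_all add: evl_zero evl_add)

lemma evl_single: "evl t (Poly_Mapping.single k c) = of_int c * t powi k"
  using evl_superset[of "{k}" "Poly_Mapping.single k c" t] by simp

lemma poly_mapping_sum_single: "p = (\<Sum>k\<in>Poly_Mapping.keys p. Poly_Mapping.single k (Poly_Mapping.lookup p k))"
  by (rule poly_mapping_eqI) (auto simp: lookup_sum lookup_single when_def in_keys_iff)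

lemma evl_mult:
  assumes "t \<noteq> 0"
  shows "evl t (p * q) = evl t p * evl t q"
proof -
  let ?s = "\<lambda>p k. Poly_Mapping.single k (Poly_Mapping.lookup p k)"
  have "p * q = (\<Sum>i\<in>Poly_Mapping.keys p. ?s p i) * (\<Sum>j\<in>Poly_Mapping.keys q. ?s q j)"
    using poly_mapping_sum_single[of p] poly_mapping_sum_single[of q] by simp
  also have "\<dots> = (\<Sum>i\<in>Poly_Mapping.keys p. \<Sum>j\<in>Poly_Mapping.keys q. ?s p i * ?s q j)"
    by (simp add: sum_product)
  finally have "evl t (p * q) = (\<Sum>i\<in>Poly_Mapping.keys p. \<Sum>j\<in>Poly_Mapping.keys q. evl t (?s p i * ?s q j))"
    by (simp only: evl_sum)
  then show ?thesis
    unfolding mult_single evl_single unfolding evl_def sum_product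
    using assms by (simp add: power_int_add mult_ac)
qed

lemma evl_one: "evl t 1 = 1"
  using evl_single[of t 0 1] by simp

lemma evl_uminus: "evl t (- p) = - evl t p"
  using evl_add[of t p "- p"] by (simp add: evl_zero)

lemma evl_qd: "evl t (qL - qLinv) = t - 1 / t"
  using evl_add[of t qL "- qLinv"]
  by (simp add: evl_uminus qL_def qLinv_def evl_single power_int_minus_divide)

lemma powi_inj: "1 < t \<Longrightarrow> t powi a = t powi b \<longleftrightarrow> a = (b::int)" for t :: real
  using power_int_strict_increasing[of a b t] power_int_strict_increasing[of b a t]
  by (cases a b rule: linorder_cases) auto

text \<open>Multiplication by a large power of t turns the sum into a polynomial that vanishes at
  every t > 1, hence has infinitely many roots.\<close>

lemma powi_sum_eq_zero:
  fixes a :: "'i \<Rightarrow> real" and e :: "'i \<Rightarrow> int"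
  assumes fin: "finite S" and inj: "inj_on e S"
    and zero: "\<And>t. 1 < t \<Longrightarrow> (\<Sum>i\<in>S. a i * t powi e i) = 0"
    and i: "i \<in> S"
  shows "a i = 0"
proof -
  obtain N where N: "\<And>j. j \<in> S \<Longrightarrow> 0 \<le> N + e j"
  proof
    fix j assume "j \<in> S"
    then have "\<bar>e j\<bar> \<le> (\<Sum>k\<in>S. \<bar>e k\<bar>)" using fin by (intro member_le_sum) auto
    then show "0 \<le> (\<Sum>k\<in>S. \<bar>e k\<bar>) + e j" by linarith
  qed
  define p where "p = (\<Sum>j\<in>S. monom (a j) (nat (N + e j)))"
  have "poly p t = 0" if "1 < t" for t
  proof -
    have "poly p t = (\<Sum>j\<in>S. a j * t powi (N + e j))"
      unfolding p_def poly_sum poly_monom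
      by (rule sum.cong) (use N in \<open>auto simp: power_int_def\<close>)
    also have "\<dots> = t powi N * (\<Sum>j\<in>S. a j * t powi e j)"
      using that by (simp add: power_int_add sum_distrib_left mult_ac)
    finally show ?thesis using zero[OF that] by simp
  qed
  then have "{1<..} \<subseteq> {t. poly p t = 0}" by auto
  then have "infinite {t. poly p t = 0}" using infinite_Ioi finite_subset by blast
  then have "p = 0" using poly_roots_finite by blast
  moreover have "coeff p (nat (N + e i)) = (\<Sum>j\<in>S. if j = i then a j else 0)"
    unfolding p_def coeff_sum coeff_monom
  proof (rule sum.cong)
    fix j assume "j \<in> S"
    then show "(if nat (N + e j) = nat (N + e i) then a j else 0) = (if j = i then a j else 0)"
      using N[of i] N[of j] i inj by (auto simp: nat_eq_iff inj_on_def)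
  qed simp
  ultimately show ?thesis using i fin by simp
qed

fun horner :: "int \<Rightarrow> int list \<Rightarrow> int" where
  "horner M [] = 0"
| "horner M (a # as) = a + M * horner M as"

text \<open>Uniqueness of expansions in base M with signed digits: the lowest digits are congruent
  modulo M and smaller than M/2 in absolute value, so they agree, and M can be cancelled from the
  rest.\<close>

lemma horner_inj:
  assumes "length as = length bs" "\<forall>a\<in>set as. 2 * \<bar>a\<bar> < M" "\<forall>b\<in>set bs. 2 * \<bar>b\<bar> < M"
    "horner M as = horner M bs"
  shows "as = bs"
  using assms
proof (induction as bs rule: list_induct2)
  case (Cons a as b bs)
  have "a - b = M * (horner M bs - horner M as)" using Cons.prems(3) by (simp add: algebra_simps)
  moreover have "\<bar>a - b\<bar> < M" using Cons.prems(1,2) by force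
  ultimately have "a = b" using zdvd_not_zless[of "\<bar>a - b\<bar>" M] by (metis abs_dvd_iff dvd_abs_iff dvd_triv_left eq_iff_diff_eq_0 zero_less_abs_iff)
  moreover have "M \<noteq> 0" using Cons.prems(1) by auto
  ultimately show ?case using Cons by auto
qed simp

text \<open>Substituting powers t^(M^(i+k)) for the variables turns a monomial into a single power
  of t. The later choice k = 1 leaves the digit at M^0 free for the exponent of q.\<close>

lemma prod_powi_horner:
  fixes t :: real
  assumes "t \<noteq> 0"
  shows "(\<Prod>i<length as. (t powi (M ^ (i + k))) powi (as ! i)) = t powi (M ^ k * horner M as)"
proof (induction as arbitrary: k)
  case (Cons a as)
  have "(\<Prod>i<length (a # as). (t powi (M ^ (i + k))) powi ((a # as) ! i)) =
      (t powi (M ^ k)) powi a * (\<Prod>i<length as. (t powi (M ^ (i + Suc k))) powi (as ! i))"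
    by (simp add: prod.lessThan_Suc_shift del: prod.lessThan_Suc)
  also have "\<dots> = t powi (M ^ k * a) * t powi (M ^ Suc k * horner M as)"
    by (simp only: Cons power_int_mult)
  also have "\<dots> = t powi (M ^ k * horner M (a # as))"
    using assms by (simp add: algebra_simps flip: power_int_add)
  finally show ?case .
qed simp

text \<open>Nonzero coordinates make X_1 invertible, distinct ones give nonzero denominators, and
  the condition with t^2 keeps the reflection coefficients nonzero.\<close>

definition generic :: "nat \<Rightarrow> real \<Rightarrow> (nat \<Rightarrow> real) \<Rightarrow> bool" where
  "generic n t x \<longleftrightarrow> 1 < t \<and> (\<forall>i\<in>{1..n}. x i \<noteq> 0) \<and>
     (\<forall>i\<in>{1..n}. \<forall>j\<in>{1..n}. i \<noteq> j \<longrightarrow> x i \<noteq> x j \<and> x i \<noteq> t\<^sup>2 * x j)"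

text \<open>A coincidence involving t^2 would force M^i - M^j = 2 for some i, j \<ge> 1. The
  difference is divisible by M, which is impossible once M \<ge> 3.\<close>

lemma generic_powers:
  assumes "1 < t" "3 \<le> M"
  shows "generic n t (\<lambda>i. t powi (M ^ i))"
proof -
  have "M ^ i \<noteq> M ^ j" if "i \<noteq> j" for i j
    using that assms(2) by (simp add: power_inject_exp)
  moreover have "t powi (M ^ i) \<noteq> t\<^sup>2 * t powi (M ^ j)" if "1 \<le> i" "1 \<le> j" for i j
  proof
    assume "t powi (M ^ i) = t\<^sup>2 * t powi (M ^ j)"
    also have "\<dots> = t powi (2 + M ^ j)" using assms(1) by (simp add: power_int_add)
    finally have "M ^ i = 2 + M ^ j" using powi_inj[OF assms(1)] by blast
    then have "M ^ i - M ^ j = 2" by simp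
    moreover have "M dvd M ^ i - M ^ j" using that by (intro dvd_diff dvd_power) auto
    ultimately show False using assms(2) zdvd_imp_le[of M 2] by simp
  qed
  ultimately show ?thesis using assms(1) by (auto simp: generic_def powi_inj)
qed

lemma laurent_eq_zero:
  fixes c :: "int list \<Rightarrow> (int \<Rightarrow>\<^sub>0 int)"
  assumes F: "finite F" "\<And>\<alpha>. \<alpha> \<in> F \<Longrightarrow> length \<alpha> = n"
    and zero: "\<And>t x. generic n t x \<Longrightarrow> (\<Sum>\<alpha>\<in>F. evl t (c \<alpha>) * (\<Prod>i<n. x (Suc i) powi (\<alpha> ! i))) = 0"
    and "\<alpha> \<in> F"
  shows "c \<alpha> = 0"
proof -
  define J where "J = (SIGMA \<alpha>:F. Poly_Mapping.keys (c \<alpha>))"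
  have J: "finite J" using F(1) by (simp add: J_def)
  \<comment> \<open>The exponent of q is put in front as the lowest digit, so that one integer
    encodes a whole Laurent monomial in q and the x_k.\<close>
  define L where "L = (\<lambda>(\<alpha>, k). k # \<alpha> :: int list)"
  \<comment> \<open>M exceeds twice every digit that occurs, as uniqueness of signed digits demands;
    the summand 3 serves genericity.\<close>
  define M where "M = 3 + 2 * (\<Sum>j\<in>J. \<Sum>a\<in>set (L j). \<bar>a\<bar>)"
  have bound: "2 * \<bar>a\<bar> < M" if "j \<in> J" "a \<in> set (L j)" for j a
  proof -
    have "\<bar>a\<bar> \<le> (\<Sum>a\<in>set (L j). \<bar>a\<bar>)" using that by (intro member_le_sum) auto
    also have "\<dots> \<le> (\<Sum>j\<in>J. \<Sum>a\<in>set (L j). \<bar>a\<bar>)"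
      using that J by (intro member_le_sum[of j J "\<lambda>j. \<Sum>a\<in>set (L j). \<bar>a\<bar>"]) (auto intro: sum_nonneg)
    finally show ?thesis by (simp add: M_def)
  qed
  have M: "3 \<le> M" unfolding M_def by (simp add: sum_nonneg)
  have inj: "inj_on (horner M \<circ> L) J"
  proof (rule inj_onI)
    fix j j' assume a: "j \<in> J" "j' \<in> J" "(horner M \<circ> L) j = (horner M \<circ> L) j'"
    have "L j = L j'"
      by (rule horner_inj[of _ _ M]) (use a bound F(2) in \<open>auto simp: J_def L_def\<close>)
    then show "j = j'" by (cases j; cases j') (simp add: L_def)
  qed
  have eq: "(\<Sum>j\<in>J. of_int (Poly_Mapping.lookup (c (fst j)) (snd j)) * t powi ((horner M \<circ> L) j)) = 0"
    if t: "1 < t" for t :: real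
  proof -
    have "(\<Sum>j\<in>J. of_int (Poly_Mapping.lookup (c (fst j)) (snd j)) * t powi ((horner M \<circ> L) j)) =
      (\<Sum>\<alpha>\<in>F. \<Sum>k\<in>Poly_Mapping.keys (c \<alpha>).
          of_int (Poly_Mapping.lookup (c \<alpha>) k) * t powi horner M (k # \<alpha>))"
      unfolding J_def using F(1) by (subst sum.Sigma) (auto simp: L_def case_prod_unfold)
    also have "\<dots> = (\<Sum>\<alpha>\<in>F. evl t (c \<alpha>) * (\<Prod>i<n. (t powi (M ^ Suc i)) powi (\<alpha> ! i)))"
    proof (rule sum.cong)
      fix \<alpha> assume "\<alpha> \<in> F"
      then have "(\<Prod>i<n. (t powi (M ^ Suc i)) powi (\<alpha> ! i)) = t powi (M * horner M \<alpha>)"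
        using prod_powi_horner[of t M 1 \<alpha>] F(2) t by simp
      then show "(\<Sum>k\<in>Poly_Mapping.keys (c \<alpha>). of_int (Poly_Mapping.lookup (c \<alpha>) k) * t powi horner M (k # \<alpha>)) =
          evl t (c \<alpha>) * (\<Prod>i<n. (t powi (M ^ Suc i)) powi (\<alpha> ! i))"
        using t by (simp add: evl_def power_int_add sum_distrib_right mult.assoc)
    qed simp
    also have "\<dots> = 0" using zero[OF generic_powers[OF t M]] by simp
    finally show ?thesis .
  qed
  have "Poly_Mapping.lookup (c \<alpha>) k = 0" for k
  proof (cases "k \<in> Poly_Mapping.keys (c \<alpha>)")
    case True
    then have "(\<alpha>, k) \<in> J" using \<open>\<alpha> \<in> F\<close> by (simp add: J_def)
    from powi_sum_eq_zero[OF J inj eq this] show ?thesis by simp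
  qed (simp add: in_keys_iff)
  then show ?thesis by (intro poly_mapping_eqI) simp
qed

section \<open>A representation by operators on functions\<close>

text \<open>Additivity is what makes f (g + h) = f g + f h hold for composition, so these maps form
  a ring.\<close>

typedef 'p op = "{f :: ('p \<Rightarrow> real) \<Rightarrow> 'p \<Rightarrow> real. \<forall>\<phi> \<psi>. f (\<lambda>p. \<phi> p + \<psi> p) = (\<lambda>p. f \<phi> p + f \<psi> p)}"
  morphisms app Op
  by (rule exI[of _ id]) simp

setup_lifting type_definition_op

instantiation op :: (type) "{ring,monoid_mult}"
begin

lift_definition plus_op :: "'a op \<Rightarrow> 'a op \<Rightarrow> 'a op" is "\<lambda>f g \<phi> p. f \<phi> p + g \<phi> p"
  by (simp add: algebra_simps)
lift_definition minus_op :: "'a op \<Rightarrow> 'a op \<Rightarrow> 'a op" is "\<lambda>f g \<phi> p. f \<phi> p - g \<phi> p"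
  by (simp add: algebra_simps)
lift_definition uminus_op :: "'a op \<Rightarrow> 'a op" is "\<lambda>f \<phi> p. - f \<phi> p"
  by (simp add: algebra_simps)
lift_definition times_op :: "'a op \<Rightarrow> 'a op \<Rightarrow> 'a op" is "\<lambda>f g \<phi>. f (g \<phi>)"
  by simp
lift_definition zero_op :: "'a op" is "\<lambda>\<phi> p. 0"
  by simp
lift_definition one_op :: "'a op" is "\<lambda>\<phi>. \<phi>"
  by simp

instance
  by standard (transfer; simp add: algebra_simps)+

end

lemma op_eqI: "(\<And>\<phi> p. app A \<phi> p = app B \<phi> p) \<Longrightarrow> A = B"
  by (simp add: app_inject[symmetric] fun_eq_iff)

lemmas app_simps = plus_op.rep_eq minus_op.rep_eq uminus_op.rep_eq times_op.rep_eq zero_op.rep_eq one_op.rep_eq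

lemma app_sum: "app (sum f S) \<phi> p = (\<Sum>i\<in>S. app (f i) \<phi> p)"
  by (induction S rule: infinite_finite_induct) (simp_all add: app_simps)

lift_definition mop :: "('p \<Rightarrow> real) \<Rightarrow> 'p op" is "\<lambda>f \<phi> p. f p * \<phi> p"
  by (simp add: algebra_simps)

lift_definition refl_op :: "('p \<Rightarrow> real) \<Rightarrow> ('p \<Rightarrow> real) \<Rightarrow> ('p \<Rightarrow> 'p) \<Rightarrow> 'p op"
  is "\<lambda>a b s \<phi> p. a p * \<phi> p + b p * \<phi> (s p)"
  by (simp add: algebra_simps)

lemmas app_mop = mop.rep_eq and app_refl_op = refl_op.rep_eq

lemma mop_mult: "mop (\<lambda>p. f p * g p) = mop f * mop g"
  by (rule op_eqI) (simp add: app_mop app_simps)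

lemma mop_add: "mop (\<lambda>p. f p + g p) = mop f + mop g"
  by (rule op_eqI) (simp add: app_mop app_simps algebra_simps)

lemma mop_one: "mop (\<lambda>p. 1) = 1"
  by (rule op_eqI) (simp add: app_mop app_simps)

text \<open>The operator of a simple reflection is a Demazure-Lusztig operator on the points where the two
  labels agree and the plain reflection elsewhere.\<close>

definition dl_a :: "real \<Rightarrow> real \<Rightarrow> real \<Rightarrow> bool \<Rightarrow> real" where
  "dl_a t a b e = (if e then (t - 1 / t) * b / (b - a) else 0)"
definition dl_b :: "real \<Rightarrow> real \<Rightarrow> real \<Rightarrow> bool \<Rightarrow> real" where
  "dl_b t a b e = (if e then t - dl_a t a b e else 1)"

lemma dl_a_swap: "a \<noteq> b \<Longrightarrow> dl_a t b a True = (t - 1 / t) - dl_a t a b True"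
  by (simp add: dl_a_def divide_simps) (simp add: algebra_simps)

text \<open>With A = b/(b-a), B = c/(c-b), C = c/(c-a) one has A B = C (A + B - 1); scaling by t -
  1/t gives the homogeneous form. This is the relation between the three coefficients that lies
  behind the braid relation.\<close>

lemma dl_a_cocycle:
  assumes "a \<noteq> b" "b \<noteq> c" "a \<noteq> c"
  shows "dl_a t a b True * dl_a t b c True =
    dl_a t a c True * (dl_a t a b True + dl_a t b c True - (t - 1 / t))"
proof -
  have "b / (b - a) * (c / (c - b)) = c / (c - a) * (b / (b - a) + c / (c - b) - 1)"
    using assms by (simp add: divide_simps) (simp add: algebra_simps)
  moreover have "(d * A) * (d * B) = (d * C) * (d * A + d * B - d)" if "A * B = C * (A + B - 1)" for A B C d :: real
  proof -
    have "(d * A) * (d * B) = d * d * (A * B)" by simp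
    then show ?thesis unfolding that by (simp add: algebra_simps)
  qed
  moreover have "dl_a t x y True = (t - 1 / t) * (y / (y - x))" for x y
    by (simp add: dl_a_def)
  ultimately show ?thesis by metis
qed

text \<open>Put d = t - 1/t and let \<alpha> be the coefficient for (a, b). The swapped coefficient
  is d - \<alpha>, and t (t - d) = 1 simplifies the product (t - \<alpha>)(t - d +
  \<alpha>).\<close>

lemma dl_quadratic:
  assumes "a \<noteq> b" "t \<noteq> 0"
  shows "dl_b t a b True * dl_b t b a True = 1 + (t - 1 / t) * dl_a t a b True - dl_a t a b True * dl_a t a b True"
proof -
  have "(t - \<alpha>) * (t - ((t - s) - \<alpha>)) = 1 + (t - s) * \<alpha> - \<alpha> * \<alpha>" if "t * s = 1" for \<alpha> s
    using that by (simp add: algebra_simps)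
  note this[of "1 / t" "dl_a t a b True"]
  moreover have "t * (1 / t) = 1" using assms(2) by simp
  ultimately show ?thesis unfolding dl_b_def dl_a_swap[OF assms(1)] by (simp only: if_True)
qed

text \<open>Both triple products of the braid relation evaluated at a point with three equal labels.
  The coefficients \<alpha>, \<beta>, \<gamma> belong to the pairs (1,2), (2,3), (1,3) of
  coordinates, and f0, ..., f121 are the values of the function on the orbit of the point under the
  symmetric group on three letters.\<close>

lemma dl_braid_identity:
  fixes \<alpha> \<beta> \<gamma> d t f0 f1 f2 f12 f21 f121 :: real
  assumes "\<alpha> * \<beta> = \<gamma> * (\<alpha> + \<beta> - d)"
  shows "\<alpha> * (\<beta> * (\<alpha> * f0 + (t - \<alpha>) * f1) + (t - \<beta>) * (\<gamma> * f2 + (t - \<gamma>) * f12)) +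
      (t - \<alpha>) * (\<gamma> * ((d - \<alpha>) * f1 + (t - (d - \<alpha>)) * f0) + (t - \<gamma>) * (\<beta> * f21 + (t - \<beta>) * f121)) =
    \<beta> * (\<alpha> * (\<beta> * f0 + (t - \<beta>) * f2) + (t - \<alpha>) * (\<gamma> * f1 + (t - \<gamma>) * f21)) +
      (t - \<beta>) * (\<gamma> * ((d - \<beta>) * f2 + (t - (d - \<beta>)) * f0) + (t - \<gamma>) * (\<alpha> * f12 + (t - \<alpha>) * f121))"
    (is "?L = ?R")
proof -
  \<comment> \<open>The relation assumed for \<alpha>, \<beta>, \<gamma> splits off as a factor of
    the difference.\<close>
  have "?L - ?R = (\<alpha> * \<beta> - \<gamma> * (\<alpha> + \<beta> - d)) * ((\<alpha> - \<beta>) * f0 + (t - \<alpha>) * f1 - (t - \<beta>) * f2)"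
    by (simp add: algebra_simps)
  then show ?thesis using assms by simp
qed

text \<open>Points are accessed through their coordinates only; the type of points is defined later,
  for fixed r and n. \<open>point_ex\<close> supplies every generic parameter, as testing a Laurent
  polynomial for zero requires.\<close>

locale generic_points =
  fixes r n :: nat and tv :: "'p \<Rightarrow> real" and xv :: "'p \<Rightarrow> nat \<Rightarrow> real" and lv :: "'p \<Rightarrow> complex list"
    and act :: "nat \<Rightarrow> 'p \<Rightarrow> 'p"
  assumes r_pos: "1 \<le> r" and n_pos: "1 \<le> n"
    and generic: "generic n (tv p) (xv p)" and lv_lam: "lv p \<in> lam r n"
    and point_eqI: "tv p = tv p' \<Longrightarrow> xv p = xv p' \<Longrightarrow> lv p = lv p' \<Longrightarrow> p = p'"
    and tv_act: "1 \<le> i \<Longrightarrow> i < n \<Longrightarrow> tv (act i p) = tv p"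
    and xv_act: "1 \<le> i \<Longrightarrow> i < n \<Longrightarrow> xv (act i p) = xv p \<circ> sw i"
    and lv_act: "1 \<le> i \<Longrightarrow> i < n \<Longrightarrow> lv (act i p) = slam i (lv p)"
    and point_ex: "generic n t x \<Longrightarrow> l \<in> lam r n \<Longrightarrow> \<exists>p. tv p = t \<and> xv p = x \<and> lv p = l"
begin

lemma length_lv [simp]: "length (lv p) = n"
  using lv_lam[of p] by (simp add: lam_def)

lemma tv_pos: "1 < tv p" "tv p \<noteq> 0"
  using generic[of p] by (auto simp: generic_def)

lemma xv_neq: "1 \<le> i \<Longrightarrow> i \<le> n \<Longrightarrow> 1 \<le> j \<Longrightarrow> j \<le> n \<Longrightarrow> i \<noteq> j \<Longrightarrow> xv p i \<noteq> xv p j"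
  and xv_nz: "1 \<le> i \<Longrightarrow> i \<le> n \<Longrightarrow> xv p i \<noteq> 0"
  and xv_neq_sq: "1 \<le> i \<Longrightarrow> i \<le> n \<Longrightarrow> 1 \<le> j \<Longrightarrow> j \<le> n \<Longrightarrow> i \<noteq> j \<Longrightarrow> xv p i \<noteq> (tv p)\<^sup>2 * xv p j"
  using generic[of p] by (auto simp: generic_def)

text \<open>List positions start at 0: entries i - 1 and i are the labels \<lambda>_i and
  \<lambda>_(i+1).\<close>

definition same :: "nat \<Rightarrow> 'p \<Rightarrow> bool" where
  "same i p \<longleftrightarrow> lv p ! (i - 1) = lv p ! i"
definition ca where "ca i p = dl_a (tv p) (xv p i) (xv p (Suc i)) (same i p)"
definition cb where "cb i p = dl_b (tv p) (xv p i) (xv p (Suc i)) (same i p)"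
definition gop where "gop i = refl_op (ca i) (cb i) (act i)"
definition eop where "eop l = mop (\<lambda>p. of_bool (lv p = l))"

lemma app_gop: "app (gop i) \<phi> p = ca i p * \<phi> p + cb i p * \<phi> (act i p)"
  by (simp add: gop_def app_refl_op)

lemma act_act: "1 \<le> i \<Longrightarrow> i < n \<Longrightarrow> act i (act i p) = p"
  by (rule point_eqI) (simp_all add: tv_act xv_act lv_act slam_slam fun_eq_iff)

lemma act_comm: "1 \<le> i \<Longrightarrow> i + 2 \<le> j \<Longrightarrow> j < n \<Longrightarrow> act i (act j p) = act j (act i p)"
  by (rule point_eqI)
    (auto simp: tv_act xv_act lv_act nth_slam sw_def intro!: nth_equalityI)

lemma act_braid: "1 \<le> i \<Longrightarrow> Suc i < n \<Longrightarrow>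
    act i (act (Suc i) (act i p)) = act (Suc i) (act i (act (Suc i) p))"
  by (rule point_eqI)
    (auto simp: tv_act xv_act lv_act nth_slam sw_def intro!: nth_equalityI)

lemma same_act: "1 \<le> i \<Longrightarrow> i < n \<Longrightarrow> same i (act i p) \<longleftrightarrow> same i p"
  by (auto simp: same_def lv_act nth_slam)

lemma ca_act_far:
  assumes "1 \<le> i" "i < n" "1 \<le> j" "j < n" "i + 2 \<le> j \<or> j + 2 \<le> i"
  shows "ca i (act j p) = ca i p" "cb i (act j p) = cb i p"
proof -
  have "i - 1 \<noteq> j" "i \<noteq> j" "i \<noteq> j - 1" "i - 1 \<noteq> j - 1" "Suc i \<noteq> j" "i \<noteq> Suc j" using assms by auto
  then show "ca i (act j p) = ca i p" "cb i (act j p) = cb i p"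
    using assms by (simp_all add: ca_def cb_def same_def tv_act xv_act lv_act nth_slam sw_def)
qed

lemma g_comm: "1 \<le> i \<Longrightarrow> i + 2 \<le> j \<Longrightarrow> j < n \<Longrightarrow> gop i * gop j = gop j * gop i"
  using act_comm[of i j]
  by (intro op_eqI) (simp add: app_simps app_gop ca_act_far algebra_simps)

lemma g_braid:
  assumes i: "1 \<le> i" "Suc i < n"
  shows "gop i * gop (Suc i) * gop i = gop (Suc i) * gop i * gop (Suc i)"
proof (rule op_eqI)
  fix \<phi> p
  let ?t = "tv p" and ?a = "xv p i" and ?b = "xv p (Suc i)" and ?c = "xv p (Suc (Suc i))"
  let ?u = "lv p ! (i - 1)" and ?v = "lv p ! i" and ?w = "lv p ! (Suc i)"
  have ne: "?a \<noteq> ?b" "?b \<noteq> ?c" "?a \<noteq> ?c" using i xv_neq[of i "Suc i" p] xv_neq[of "Suc i" "Suc (Suc i)" p] xv_neq[of i "Suc (Suc i)" p] by auto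
  have i': "i - 1 \<noteq> i" "i - 1 \<noteq> Suc i" using i by auto
  let ?s1 = "act i p" and ?s2 = "act (Suc i) p" and ?s21 = "act (Suc i) (act i p)" and ?s12 = "act i (act (Suc i) p)"
  note S = same_def tv_act xv_act lv_act nth_slam sw_def
  have c:
    "same i p \<longleftrightarrow> ?u = ?v" "same (Suc i) p \<longleftrightarrow> ?v = ?w"
    "same i ?s1 \<longleftrightarrow> ?u = ?v" "same (Suc i) ?s1 \<longleftrightarrow> ?u = ?w"
    "same i ?s2 \<longleftrightarrow> ?u = ?w" "same (Suc i) ?s2 \<longleftrightarrow> ?v = ?w"
    "same i ?s21 \<longleftrightarrow> ?v = ?w" "same (Suc i) ?s12 \<longleftrightarrow> ?u = ?v"
    using i i' by (simp_all add: S) auto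
  have x: "xv ?s1 i = ?b" "xv ?s1 (Suc i) = ?a" "xv ?s1 (Suc (Suc i)) = ?c"
    "xv ?s2 i = ?a" "xv ?s2 (Suc i) = ?c" "xv ?s2 (Suc (Suc i)) = ?b"
    "xv ?s21 i = ?b" "xv ?s21 (Suc i) = ?c" "xv ?s12 (Suc i) = ?a" "xv ?s12 (Suc (Suc i)) = ?b"
    using i i' by (auto simp: S)
  have t: "tv ?s1 = ?t" "tv ?s2 = ?t" "tv ?s21 = ?t" "tv ?s12 = ?t" using i by (simp_all add: tv_act)
  note expand = app_simps app_gop ca_def cb_def c x t act_act[OF i(1)] act_act[of "Suc i"] act_braid[OF i]
  \<comment> \<open>Unless all three labels agree, at most one pair does. Then at most one factor of
    each product acts other than as a plain reflection, and both sides match termwise.\<close>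
  consider "?u = ?v" "?v = ?w" | "?u = ?v" "?v \<noteq> ?w" | "?u \<noteq> ?v" "?v = ?w" | "?u \<noteq> ?v" "?u = ?w"
    | "?u \<noteq> ?v" "?v \<noteq> ?w" "?u \<noteq> ?w" by metis
  then show "app (gop i * gop (Suc i) * gop i) \<phi> p = app (gop (Suc i) * gop i * gop (Suc i)) \<phi> p"
  proof cases
    case 1
    let ?\<alpha> = "dl_a ?t ?a ?b True" and ?\<beta> = "dl_a ?t ?b ?c True" and ?\<gamma> = "dl_a ?t ?a ?c True"
    have swap: "dl_a ?t ?b ?a True = (?t - 1 / ?t) - ?\<alpha>" "dl_a ?t ?c ?b True = (?t - 1 / ?t) - ?\<beta>"
      by (rule dl_a_swap[OF ne(1)], rule dl_a_swap[OF ne(2)])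
    have b: "dl_b ?t a b True = ?t - dl_a ?t a b True" for a b by (simp add: dl_b_def)
    show ?thesis
      using dl_braid_identity[OF dl_a_cocycle[OF ne, of ?t], of "\<phi> p" ?t "\<phi> ?s1" "\<phi> ?s2" "\<phi> ?s12" "\<phi> ?s21"
          "\<phi> (act (Suc i) ?s12)"] i
      by (simp add: expand 1[unfolded One_nat_def] b swap)
  qed (use i in \<open>simp_all add: expand dl_a_def dl_b_def algebra_simps\<close>)
qed

text \<open>If s_i moves l, a point labelled l or s_i l has different labels at i and i + 1, so the
  operator is the plain reflection there. If s_i fixes l, the indicator is invariant under the
  action.\<close>

lemma g_e: "1 \<le> i \<Longrightarrow> i < n \<Longrightarrow> l \<in> lam r n \<Longrightarrow> gop i * eop l = eop (slam i l) * gop i"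
proof (rule op_eqI)
  fix \<phi> p assume i: "1 \<le> i" "i < n" "l \<in> lam r n"
  have len: "length l = n" using i by (simp add: lam_def)
  have 1: "slam i (lv p) = l \<longleftrightarrow> lv p = slam i l"
    using slam_slam[of i l] slam_slam[of i "lv p"] i len length_lv by metis
  have "cb i p = 1 \<and> ca i p = 0" if "slam i l \<noteq> l" "lv p = l \<or> lv p = slam i l"
  proof -
    have "\<not> sfix i (lv p)" using that 1 by (auto simp: sfix_def)
    then have "\<not> same i p" using i by (simp add: same_def sfix_iff)
    then show ?thesis by (simp add: ca_def cb_def dl_a_def dl_b_def)
  qed
  then show "app (gop i * eop l) \<phi> p = app (eop (slam i l) * gop i) \<phi> p"
    using i 1 by (cases "slam i l = l") (auto simp: app_simps app_gop eop_def app_mop lv_act)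
qed

lemma sum_e: "(\<Sum>l\<in>lam r n. eop l) = 1"
proof (rule op_eqI)
  fix \<phi> :: "'p \<Rightarrow> real" and p
  have "(\<Sum>l\<in>lam r n. of_bool (lv p = l) * \<phi> p) = (\<Sum>l\<in>lam r n. if l = lv p then \<phi> p else 0)"
    by (rule sum.cong) auto
  then show "app (\<Sum>l\<in>lam r n. eop l) \<phi> p = app 1 \<phi> p"
    using finite_lam[OF r_pos] lv_lam by (simp add: app_sum eop_def app_mop app_simps)
qed

text \<open>These are the coefficients of \<phi> at \<open>act i p\<close> and at p in the square of
  \<open>gop i\<close>.\<close>

lemma ca_quadratic:
  assumes i: "1 \<le> i" "i < n"
  shows "ca i p * cb i p + cb i p * ca i (act i p) = (tv p - 1 / tv p) * of_bool (same i p) * cb i p"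
    and "ca i p * ca i p + cb i p * cb i (act i p) = 1 + (tv p - 1 / tv p) * of_bool (same i p) * ca i p"
proof -
  have x: "xv (act i p) i = xv p (Suc i)" "xv (act i p) (Suc i) = xv p i" "tv (act i p) = tv p"
    using i by (simp_all add: xv_act tv_act sw_def)
  have ne: "xv p i \<noteq> xv p (Suc i)" using i xv_neq[of i "Suc i" p] by auto
  show "ca i p * cb i p + cb i p * ca i (act i p) = (tv p - 1 / tv p) * of_bool (same i p) * cb i p"
  proof -
    have "ca i p + ca i (act i p) = (tv p - 1 / tv p) * of_bool (same i p)"
      using dl_a_swap[OF ne, of "tv p"] i
      by (cases "same i p") (simp_all add: ca_def same_act x, simp add: dl_a_def)
    moreover have "ca i p * cb i p + cb i p * ca i (act i p) = (ca i p + ca i (act i p)) * cb i p"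
      by (simp add: algebra_simps)
    ultimately show ?thesis by simp
  qed
  show "ca i p * ca i p + cb i p * cb i (act i p) = 1 + (tv p - 1 / tv p) * of_bool (same i p) * ca i p"
    using dl_quadratic[OF ne tv_pos(2)] i
    by (cases "same i p") (simp_all add: ca_def cb_def same_act x, simp_all add: dl_a_def dl_b_def)
qed

lemma app_eop_sum: "1 \<le> i \<Longrightarrow> i < n \<Longrightarrow>
    app (\<Sum>l\<in>{l \<in> lam r n. sfix i l}. gop i * eop l) \<phi> p = of_bool (same i p) * app (gop i) \<phi> p"
proof -
  assume i: "1 \<le> i" "i < n"
  let ?S = "{l \<in> lam r n. sfix i l}"
  have fin: "finite ?S" using finite_lam[OF r_pos] by simp
  have "(\<Sum>l\<in>?S. of_bool (lv p' = l) * \<phi> p') = of_bool (same i p') * \<phi> p'" for p'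
  proof -
    have "(\<Sum>l\<in>?S. of_bool (lv p' = l) * \<phi> p') = (\<Sum>l\<in>?S. if l = lv p' then \<phi> p' else 0)"
      by (rule sum.cong) auto
    then show ?thesis using fin lv_lam[of p'] i by (simp add: same_def sfix_iff)
  qed
  then have "app (\<Sum>l\<in>?S. eop l) \<phi> = (\<lambda>p. of_bool (same i p) * \<phi> p)"
    by (simp add: fun_eq_iff app_sum eop_def app_mop)
  moreover have "(\<Sum>l\<in>?S. gop i * eop l) = gop i * (\<Sum>l\<in>?S. eop l)" by (simp add: sum_distrib_left)
  ultimately show ?thesis using i by (simp add: app_simps app_gop same_act algebra_simps)
qed

lemma g_sq: "1 \<le> i \<Longrightarrow> i < n \<Longrightarrow>
    gop i * gop i = 1 + mop (\<lambda>p. tv p - 1 / tv p) * (\<Sum>l\<in>{l \<in> lam r n. sfix i l}. gop i * eop l)"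
proof (rule op_eqI)
  fix \<phi> p assume i: "1 \<le> i" "i < n"
  have "app (gop i * gop i) \<phi> p = (ca i p * ca i p + cb i p * cb i (act i p)) * \<phi> p +
      (ca i p * cb i p + cb i p * ca i (act i p)) * \<phi> (act i p)"
    using i by (simp add: app_simps app_gop act_act algebra_simps)
  also have "\<dots> = \<phi> p + (tv p - 1 / tv p) * of_bool (same i p) * (ca i p * \<phi> p + cb i p * \<phi> (act i p))"
    unfolding ca_quadratic[OF i] by (simp add: algebra_simps)
  finally show "app (gop i * gop i) \<phi> p =
    app (1 + mop (\<lambda>p. tv p - 1 / tv p) * (\<Sum>l\<in>{l \<in> lam r n. sfix i l}. gop i * eop l)) \<phi> p"
    unfolding plus_op.rep_eq times_op.rep_eq[of "mop _"] app_mop app_eop_sum[OF i]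
    by (simp add: app_simps app_gop mult.assoc)
qed

definition xop where "xop k = mop (\<lambda>p. xv p k)"

lemma g_x_far: "1 \<le> i \<Longrightarrow> i < n \<Longrightarrow> k \<noteq> i \<Longrightarrow> k \<noteq> Suc i \<Longrightarrow> gop i * xop k = xop k * gop i"
  by (rule op_eqI) (simp add: app_simps app_gop xop_def app_mop xv_act sw_def algebra_simps)

text \<open>The coefficient at the reflected point vanishes by fact \<open>1\<close>; the quadratic
  relation and fact \<open>2\<close> reduce the diagonal coefficient to x_(i+1). Hence all X_k act
  by multiplication, although only X_1 is a generator.\<close>

lemma g_x_near: "1 \<le> i \<Longrightarrow> i < n \<Longrightarrow> gop i * xop i * gop i = xop (Suc i)"
proof (rule op_eqI)
  fix \<phi> p assume i: "1 \<le> i" "i < n"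
  let ?a = "xv p i" and ?b = "xv p (Suc i)"
  have x: "xv (act i p) i = ?b" "xv (act i p) (Suc i) = ?a" "tv (act i p) = tv p"
    using i by (simp_all add: xv_act tv_act sw_def)
  have ne: "?a \<noteq> ?b" using i xv_neq[of i "Suc i" p] by auto
  have 1: "ca i p * ?a + ca i (act i p) * ?b = 0"
    using ne i by (simp add: ca_def dl_a_def same_act x divide_simps) (simp add: algebra_simps)
  have 2: "ca i p * (?b - ?a) = (tv p - 1 / tv p) * of_bool (same i p) * ?b"
    using ne by (simp add: ca_def dl_a_def)
  have "app (gop i * xop i * gop i) \<phi> p =
      (ca i p * ca i p * ?a + cb i p * cb i (act i p) * ?b) * \<phi> p +
      cb i p * (ca i p * ?a + ca i (act i p) * ?b) * \<phi> (act i p)"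
    using i x by (simp add: app_simps app_gop xop_def app_mop act_act algebra_simps)
  also have "cb i p * cb i (act i p) = 1 + (tv p - 1 / tv p) * of_bool (same i p) * ca i p - ca i p * ca i p"
    using ca_quadratic(2)[OF i, of p] by simp
  also have "ca i p * ca i p * ?a + (1 + (tv p - 1 / tv p) * of_bool (same i p) * ca i p - ca i p * ca i p) * ?b =
      ?b + ca i p * ((tv p - 1 / tv p) * of_bool (same i p) * ?b - ca i p * (?b - ?a))"
    by (simp add: algebra_simps)
  finally show "app (gop i * xop i * gop i) \<phi> p = app (xop (Suc i)) \<phi> p"
    unfolding 1 2 by (simp add: xop_def app_mop)
qed

lemma xop_comm: "xop i * xop j = xop j * xop i"
  by (rule op_eqI) (simp add: app_simps xop_def app_mop)

sublocale ops: yokonuma_hecke r n gop eop "xop (Suc 0)" "mop (\<lambda>p. 1 / xv p (Suc 0))" "mop (\<lambda>p. tv p - 1 / tv p)"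
proof
  show "1 \<le> r" by (fact r_pos)
  show "eop l * eop l' = (if l = l' then eop l else 0)" for l l'
    by (rule op_eqI) (simp add: app_simps eop_def app_mop)
  show "xop (Suc 0) * mop (\<lambda>p. 1 / xv p (Suc 0)) = 1" "mop (\<lambda>p. 1 / xv p (Suc 0)) * xop (Suc 0) = 1"
    using n_pos xv_nz[of "Suc 0"] by (auto intro!: op_eqI simp: app_simps xop_def app_mop)
  show "gop 1 * xop (Suc 0) * gop 1 * xop (Suc 0) = xop (Suc 0) * gop 1 * xop (Suc 0) * gop 1" if "2 \<le> n"
  proof -
    \<comment> \<open>Conjugation by g_1 gives multiplication by x_2, so the four-term relation says
      that two multiplication operators commute.\<close>
    have *: "gop 1 * xop (Suc 0) * gop 1 = xop 2" using g_x_near[of 1] that by (simp add: numeral_2_eq_2)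
    have "xop (Suc 0) * gop 1 * xop (Suc 0) * gop 1 = xop (Suc 0) * (gop 1 * xop (Suc 0) * gop 1)" by (simp add: mult.assoc)
    then show ?thesis unfolding * by (simp add: xop_comm)
  qed
  show "gop i * xop (Suc 0) = xop (Suc 0) * gop i" if "2 \<le> i" "i < n" for i
    using g_x_far[of i "Suc 0"] that by simp
  show "xop (Suc 0) * eop l = eop l * xop (Suc 0)" for l
    by (rule op_eqI) (simp add: app_simps eop_def xop_def app_mop)
  show "mop (\<lambda>p. tv p - 1 / tv p) * gop i = gop i * mop (\<lambda>p. tv p - 1 / tv p)" if "1 \<le> i" "i < n" for i
    using that by (intro op_eqI) (simp add: app_simps app_gop app_mop tv_act algebra_simps add_divide_distrib)
qed (auto intro: g_comm g_braid g_e sum_e g_sq)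

lemma ops_Xp: "i < n \<Longrightarrow> ops.Xp i = xop (Suc i)"
proof (induction i)
  case (Suc i)
  then show ?case using g_x_near[of "Suc i"] by simp
qed simp

lemma ops_Xq: "i < n \<Longrightarrow> ops.Xq i = mop (\<lambda>p. 1 / xv p (Suc i))"
proof -
  assume i: "i < n"
  have "mop (\<lambda>p. 1 / xv p (Suc i)) * xop (Suc i) = 1"
    using xv_nz[of "Suc i"] i by (auto intro!: op_eqI simp: app_simps xop_def app_mop)
  then have "mop (\<lambda>p. 1 / xv p (Suc i)) * ops.Xp i = 1" by (simp add: ops_Xp i)
  then show ?thesis using ops.Xp_Xq[OF i] by (metis mult.assoc mult_1 mult.right_neutral)
qed

lemma mop_power: "mop f ^ k = mop (\<lambda>p. f p ^ k)"
  by (induction k) (simp_all add: mop_one mop_mult)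

lemma app_mon: "app (ops.mon \<alpha>) \<phi> p = (\<Prod>i<n. xv p (Suc i) powi (\<alpha> ! i)) * \<phi> p"
proof -
  have "ops.xpw i k = mop (\<lambda>p. xv p (Suc i) powi k)" if "i < n" for i k
    using that by (cases "0 \<le> k")
      (simp_all add: ops.xpw_def ops_Xp ops_Xq, simp_all add: xop_def mop_power power_int_def inverse_eq_divide)
  then have "app (prod_list (map (\<lambda>i. ops.xpw i (\<alpha> ! i)) is)) \<phi> p =
      prod_list (map (\<lambda>i. xv p (Suc i) powi (\<alpha> ! i)) is) * \<phi> p" if "set is \<subseteq> {..<n}" for "is"
    using that by (induction "is") (auto simp: app_simps app_mop)
  moreover have "prod_list (map f [0..<m]) = (\<Prod>i<m. f i)" for f :: "nat \<Rightarrow> real" and m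
    by (induction m) simp_all
  ultimately show ?thesis by (simp add: ops.mon_def lessThan_atLeast0)
qed

text \<open>Triangularity with respect to the length: in a product of ilen n u operators or fewer, only
  the term that applies a reflection at every letter of a reduced word of u moves p by u.\<close>

lemma app_gprod_delta:
  assumes "letters n v" "u permutes {1..n}"
  shows "length v \<le> ilen n u \<Longrightarrow>
    app (ops.gprod v) (\<lambda>p'. of_bool (xv p' = xv p \<circ> u)) p \<noteq> 0 \<longleftrightarrow> length v = ilen n u \<and> sprod v = u"
  using assms
proof (induction v arbitrary: p u)
  case Nil
  \<comment> \<open>The coordinates of a generic point are distinct, so only the identity fixes
    them.\<close>
  have inj: "xv p = xv p \<circ> u \<longleftrightarrow> u = id"
  proof
    assume a: "xv p = xv p \<circ> u"
    show "u = id"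
    proof
      fix i
      show "u i = id i"
      proof (cases "i \<in> {1..n}")
        case True
        then have "u i \<in> {1..n}" using permutes_in_image[OF Nil(3)] by blast
        then show ?thesis using fun_cong[OF a, of i] xv_neq[of i "u i" p] True by (cases "i = u i") auto
      next
        case False
        then show ?thesis using permutes_not_in[OF Nil(3)] by simp
      qed
    qed
  qed simp
  have "ilen n u = 0 \<longleftrightarrow> u = id"
    using ilen_id no_ldesc_imp_id[OF Nil(3)] ilen_down[OF _ _ Nil(3)] by (metis nat.distinct(1))
  then show ?case
    using inj by (simp only: list.map prod_list.Nil one_op.rep_eq sprod_Nil list.size of_bool_eq_0_iff) metis
next
  case (Cons i v)
  then have i: "1 \<le> i" "i < n" "letters n v" by simp_all
  have su: "sw i \<circ> u permutes {1..n}" by (rule sw_comp_permutes[OF i(1,2) Cons.prems(3)])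
  have len: "ilen n (sw i \<circ> u) = Suc (ilen n u) \<or> ilen n u = Suc (ilen n (sw i \<circ> u))"
    using ilen_up[OF i(1,2) Cons.prems(3)] ilen_down[OF i(1,2) Cons.prems(3)] by blast
  let ?\<phi> = "\<lambda>p'. of_bool (xv p' = xv p \<circ> u) :: real"
  have lv: "length v < ilen n u" using Cons.prems(1) by simp
  \<comment> \<open>With one letter removed, v is too short to reach u, and the summand that stays
    at p contributes 0.\<close>
  have "app (ops.gprod v) ?\<phi> p \<noteq> 0 \<longleftrightarrow> length v = ilen n u \<and> sprod v = u"
    by (rule Cons.IH[OF less_imp_le[OF lv] i(3) Cons.prems(3)])
  then have "app (ops.gprod v) ?\<phi> p = 0" using lv by (metis less_irrefl)
  moreover have "app (ops.gprod v) ?\<phi> (act i p) \<noteq> 0 \<longleftrightarrow> length v = ilen n (sw i \<circ> u) \<and> sprod v = sw i \<circ> u"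
  proof -
    have "xv (act i p) \<circ> (sw i \<circ> u) = xv p \<circ> u"
      using i by (simp add: xv_act fun_eq_iff)
    moreover have "length v \<le> ilen n (sw i \<circ> u)" using len lv by linarith
    ultimately show ?thesis using Cons.IH[of "sw i \<circ> u" "act i p", OF _ i(3) su] by (simp only:)
  qed
  \<comment> \<open>The coefficient vanishes only for equal labels with x_(i+1) = t^2 x_i, which
    genericity excludes.\<close>
  moreover have "cb i p \<noteq> 0"
  proof -
    have ne: "xv p (Suc i) \<noteq> xv p i" "xv p (Suc i) \<noteq> (tv p)\<^sup>2 * xv p i"
      using i xv_neq[of i "Suc i" p] xv_neq_sq[of "Suc i" i p] by auto
    have "tv p * (tv p * (xv p (Suc i) - xv p i)) - (tv p * tv p - 1) * xv p (Suc i) =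
        xv p (Suc i) - (tv p)\<^sup>2 * xv p i"
      by (simp add: algebra_simps power2_eq_square)
    then have "tv p * (tv p * (xv p (Suc i) - xv p i)) \<noteq> (tv p * tv p - 1) * xv p (Suc i)"
      using ne(2) by auto
    then show ?thesis
      using ne(1) tv_pos[of p] by (simp add: cb_def dl_b_def dl_a_def divide_simps)
  qed
  ultimately have "app (ops.gprod (i # v)) ?\<phi> p \<noteq> 0 \<longleftrightarrow> length v = ilen n (sw i \<circ> u) \<and> sprod v = sw i \<circ> u"
    by (simp add: app_simps app_gop)
  also have "\<dots> \<longleftrightarrow> length (i # v) = ilen n u \<and> sprod (i # v) = u"
  proof -
    have "sprod v = sw i \<circ> u \<longleftrightarrow> sprod (i # v) = u"
      using sw_comp_sw by (metis sprod_Cons)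
    moreover have "ilen n (sw i \<circ> u) = length v \<longleftrightarrow> ilen n u = Suc (length v)" if "sprod v = sw i \<circ> u"
      using len Cons.prems(1) ilen_le_length[OF i(3)] that by auto
    ultimately show ?thesis by auto
  qed
  finally show ?case .
qed

text \<open>Take w0 of maximal length among the nonzero coefficients and apply the sum to the
  indicator of the coordinates x permuted by w0. At a point with coordinates x and label l0 every
  term with another w or l vanishes, which leaves a Laurent polynomial in x times a nonzero
  factor.\<close>

lemma standard_independent:
  fixes c :: "int list \<times> complex list \<times> (nat \<Rightarrow> nat) \<Rightarrow> (int \<Rightarrow>\<^sub>0 int)"
  assumes F: "finite F" "F \<subseteq> {(\<alpha>, l, w). length \<alpha> = n \<and> l \<in> lam r n \<and> w permutes {1..n}}"
    and zero: "(\<Sum>(\<alpha>, l, w)\<in>F. mop (\<lambda>p. evl (tv p) (c (\<alpha>, l, w))) * (ops.mon \<alpha> * eop l * ops.gw w)) = 0"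
    and j: "j \<in> F"
  shows "c j = 0"
proof (rule ccontr)
  assume "c j \<noteq> 0"
  define F' where "F' = {j \<in> F. c j \<noteq> 0}"
  have "j \<in> F'" "finite F'" using F(1) j \<open>c j \<noteq> 0\<close> by (simp_all add: F'_def)
  then have "F' \<noteq> {}" by blast
  define len where "len = (\<lambda>(\<alpha>::int list, l::complex list, w). ilen n w)"
  have "Max (len ` F') \<in> len ` F'" using \<open>finite F'\<close> \<open>F' \<noteq> {}\<close> by (intro Max_in) auto
  then obtain \<alpha>0 l0 w0 where j0: "(\<alpha>0, l0, w0) \<in> F'" "len (\<alpha>0, l0, w0) = Max (len ` F')"
    by (metis (no_types, lifting) imageE prod_cases3)
  have max: "ilen n w \<le> ilen n w0" if "(\<alpha>, l, w) \<in> F'" for \<alpha> l w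
  proof -
    have "len (\<alpha>, l, w) \<le> len (\<alpha>0, l0, w0)"
      unfolding j0(2) using \<open>finite F'\<close> that by (intro Max_ge) auto
    then show ?thesis by (simp add: len_def)
  qed
  have w0: "w0 permutes {1..n}" "l0 \<in> lam r n" using j0(1) F(2) by (auto simp: F'_def)
  define H where "H = {\<alpha>. (\<alpha>, l0, w0) \<in> F}"
  have H: "finite H"
    by (rule finite_subset[OF _ finite_imageI[OF F(1), of fst]]) (force simp: H_def)
  have "c (\<alpha>0, l0, w0) = 0"
  proof (rule laurent_eq_zero[of H n "\<lambda>\<alpha>. c (\<alpha>, l0, w0)"])
    fix t x assume "generic n t x"
    then obtain p where p: "tv p = t" "xv p = x" "lv p = l0" using point_ex w0(2) by blast
    define \<phi> where "\<phi> = (\<lambda>p'. of_bool (xv p' = xv p \<circ> w0) :: real)"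
    define \<kappa> where "\<kappa> = app (ops.gw w0) \<phi> p"
    have gw: "app (ops.gw w) \<phi> p \<noteq> 0 \<longleftrightarrow> w = w0" if "w permutes {1..n}" "ilen n w \<le> ilen n w0" for w
    proof -
      have "reduced n w (redword n w)" by (rule reduced_redword[OF that(1)])
      then show ?thesis
        using app_gprod_delta[of "redword n w" w0 p] w0(1) that(2)
        by (auto simp: ops.gw_def \<phi>_def reduced_def)
    qed
    have "0 = app (\<Sum>(\<alpha>, l, w)\<in>F. mop (\<lambda>p. evl (tv p) (c (\<alpha>, l, w))) * (ops.mon \<alpha> * eop l * ops.gw w)) \<phi> p"
      unfolding zero by (simp add: app_simps)
    also have "\<dots> = (\<Sum>(\<alpha>, l, w)\<in>F. evl t (c (\<alpha>, l, w)) *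
        ((\<Prod>i<n. x (Suc i) powi (\<alpha> ! i)) * (of_bool (l0 = l) * app (ops.gw w) \<phi> p)))"
      by (simp add: app_sum case_prod_unfold app_simps app_mop app_mon eop_def p)
    also have "\<dots> = (\<Sum>j\<in>(\<lambda>\<alpha>. (\<alpha>, l0, w0)) ` H. case j of (\<alpha>, l, w) \<Rightarrow> evl t (c (\<alpha>, l, w)) *
        ((\<Prod>i<n. x (Suc i) powi (\<alpha> ! i)) * (of_bool (l0 = l) * app (ops.gw w) \<phi> p)))"
    proof (rule sum.mono_neutral_right[OF F(1)])
      show "(\<lambda>\<alpha>. (\<alpha>, l0, w0)) ` H \<subseteq> F" by (auto simp: H_def)
      show "\<forall>j\<in>F - (\<lambda>\<alpha>. (\<alpha>, l0, w0)) ` H. (case j of (\<alpha>, l, w) \<Rightarrow> evl t (c (\<alpha>, l, w)) *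
        ((\<Prod>i<n. x (Suc i) powi (\<alpha> ! i)) * (of_bool (l0 = l) * app (ops.gw w) \<phi> p))) = 0"
      proof
        fix j assume j: "j \<in> F - (\<lambda>\<alpha>. (\<alpha>, l0, w0)) ` H"
        obtain \<alpha> l w where jj: "j = (\<alpha>, l, w)" by (cases j)
        have "l0 \<noteq> l \<or> w \<noteq> w0" using j jj by (auto simp: H_def)
        \<comment> \<open>Longer w are ruled out by maximality, the remaining ones by
          triangularity.\<close>
        moreover have "app (ops.gw w) \<phi> p = 0" if "w \<noteq> w0" "c j \<noteq> 0"
          using gw[of w] max[of \<alpha> l w] that j jj F(2) by (auto simp: F'_def)
        ultimately show "(case j of (\<alpha>, l, w) \<Rightarrow> evl t (c (\<alpha>, l, w)) *
        ((\<Prod>i<n. x (Suc i) powi (\<alpha> ! i)) * (of_bool (l0 = l) * app (ops.gw w) \<phi> p))) = 0"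
          unfolding jj by (cases "c (\<alpha>, l, w) = 0") (auto simp: evl_zero jj)
      qed
    qed
    also have "\<dots> = (\<Sum>\<alpha>\<in>H. evl t (c (\<alpha>, l0, w0)) * (\<Prod>i<n. x (Suc i) powi (\<alpha> ! i))) * \<kappa>"
      by (subst sum.reindex) (auto simp: inj_on_def \<kappa>_def sum_distrib_right mult.assoc)
    finally show "(\<Sum>\<alpha>\<in>H. evl t (c (\<alpha>, l0, w0)) * (\<Prod>i<n. x (Suc i) powi (\<alpha> ! i))) = 0"
      using gw[OF w0(1)] by (simp add: \<kappa>_def)
  qed (use H j0(1) F(2) in \<open>auto simp: H_def F'_def\<close>)
  then show False using j0(1) by (simp add: F'_def)
qed

end

section \<open>The Yokonuma presentation\<close>

lemma Zrz_zero: "0 \<in> Zrz r"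
  using Zrz.add[OF Zrz.one Zrz.neg[OF Zrz.one]] by simp

lemma Zrz_power: "a \<in> Zrz r \<Longrightarrow> a ^ k \<in> Zrz r"
  by (induction k) (auto intro: Zrz.one Zrz.mult)

lemma Zrz_sum: "(\<And>i. i \<in> I \<Longrightarrow> f i \<in> Zrz r) \<Longrightarrow> sum f I \<in> Zrz r"
  by (induction I rule: infinite_finite_induct) (auto intro: Zrz_zero Zrz.add)

definition roots :: "nat \<Rightarrow> complex set" where
  "roots r = {z. z ^ r = 1}"

lemma zeta_power: "zeta r ^ k = cis (2 * pi * real k / real r)"
  by (simp add: zeta_def DeMoivre mult_ac)

lemma roots_zeta: "1 \<le> r \<Longrightarrow> z \<in> roots r \<Longrightarrow> \<exists>k<r. z = zeta r ^ k"
  using bij_betw_roots_unity[of r] by (auto simp: roots_def bij_betw_def zeta_power)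

lemma zeta_root: "1 \<le> r \<Longrightarrow> zeta r \<in> roots r"
  using zeta_power[of r r] by (simp add: roots_def)

lemma zeta_power_neq_one:
  assumes "0 < k" "k < r"
  shows "zeta r ^ k \<noteq> 1"
proof
  assume "zeta r ^ k = 1"
  then have "zeta r ^ k = zeta r ^ 0" by simp
  then have "k = 0"
    using bij_betw_roots_unity[of r] assms unfolding zeta_power bij_betw_def inj_on_def by auto
  then show False using assms by simp
qed

lemma roots_Zrz: "1 \<le> r \<Longrightarrow> z \<in> roots r \<Longrightarrow> z \<in> Zrz r"
  using roots_zeta[of r z] by (auto intro: Zrz_power Zrz.zeta)

lemma roots_inverse: "z \<in> roots r \<Longrightarrow> inverse z \<in> roots r"
  by (simp add: roots_def power_inverse)

lemma roots_mult: "z \<in> roots r \<Longrightarrow> w \<in> roots r \<Longrightarrow> z * w \<in> roots r"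
  by (simp add: roots_def power_mult_distrib)

lemma roots_nonzero: "1 \<le> r \<Longrightarrow> z \<in> roots r \<Longrightarrow> z \<noteq> 0"
  by (auto simp: roots_def power_0_left)

lemma sum_root_powers:
  assumes "1 \<le> r" "z \<in> roots r"
  shows "1 / of_nat r * (\<Sum>s<r. z ^ s) = of_bool (z = 1)"
  using assms geometric_sum[of z r] by (cases "z = 1") (auto simp: roots_def)

text \<open>Multiplication by \<open>zeta r\<close> permutes the roots but changes the sum by a
  factor zeta^(-s), which is not 1 for 0 < s < r. Together with the geometric sum this gives both
  orthogonality relations for the characters of a cyclic group.\<close>

lemma sum_over_roots:
  assumes r: "1 \<le> r" "s < r"
  shows "1 / of_nat r * (\<Sum>z\<in>roots r. inverse z ^ s) = (of_bool (s = 0) :: complex)"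
proof (cases "s = 0")
  case True
  have "card (roots r) = r" using card_roots_unity_eq[of r] r by (simp add: roots_def)
  then show ?thesis using True r by simp
next
  case False
  let ?w = "inverse (zeta r)"
  have w: "?w \<in> roots r" using zeta_root r roots_inverse by blast
  have w0: "zeta r \<noteq> 0" using zeta_root r roots_nonzero by blast
  have "bij_betw (\<lambda>z. zeta r * z) (roots r) (roots r)"
    by (rule bij_betw_byWitness[of _ "\<lambda>z. ?w * z"]) (use w w0 zeta_root[of r] r in \<open>auto intro: roots_mult\<close>)
  then have "(\<Sum>z\<in>roots r. inverse z ^ s) = (\<Sum>z\<in>roots r. inverse (zeta r * z) ^ s)"
    by (rule sum.reindex_bij_betw[symmetric])
  also have "\<dots> = inverse (zeta r ^ s) * (\<Sum>z\<in>roots r. inverse z ^ s)"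
    by (simp add: power_mult_distrib power_inverse sum_distrib_left)
  finally have "(1 - inverse (zeta r ^ s)) * (\<Sum>z\<in>roots r. inverse z ^ s) = 0"
    by (simp add: algebra_simps)
  moreover have "inverse (zeta r ^ s) \<noteq> 1" using zeta_power_neq_one[of s r] False r by simp
  ultimately show ?thesis using False by simp
qed

lemma lam_roots: "l \<in> lam r n \<longleftrightarrow> length l = n \<and> set l \<subseteq> roots r"
  by (auto simp: lam_def roots_def)

lemma nth_lam: "l \<in> lam r n \<Longrightarrow> k < n \<Longrightarrow> l ! k \<in> roots r"
  by (auto simp: lam_roots)

lemma lam_Suc: "lam r (Suc n) = (\<lambda>(z, l). z # l) ` (roots r \<times> lam r n)"
  by (auto simp: lam_roots length_Suc_conv image_iff)

text \<open>The constant scalars: \<kappa> will embed Laurent polynomials of degree 0. It is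
  controlled on \<open>Zrz r\<close> only, because other complex numbers are not
  coefficients.\<close>

locale root_scalars =
  fixes r :: nat and \<kappa> :: "complex \<Rightarrow> 'b::{ring,monoid_mult}"
  assumes r_pos: "1 \<le> r"
    and \<kappa>_add: "a \<in> Zrz r \<Longrightarrow> b \<in> Zrz r \<Longrightarrow> \<kappa> (a + b) = \<kappa> a + \<kappa> b"
    and \<kappa>_mult: "a \<in> Zrz r \<Longrightarrow> b \<in> Zrz r \<Longrightarrow> \<kappa> (a * b) = \<kappa> a * \<kappa> b"
    and \<kappa>_one: "\<kappa> 1 = 1"
    and \<kappa>_central: "a \<in> Zrz r \<Longrightarrow> \<kappa> a * v = v * \<kappa> a"
begin

lemma \<kappa>_zero: "\<kappa> 0 = 0"
  using \<kappa>_add[OF Zrz_zero Zrz_zero] by simp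

lemma \<kappa>_sum: "(\<And>i. i \<in> I \<Longrightarrow> f i \<in> Zrz r) \<Longrightarrow> \<kappa> (sum f I) = (\<Sum>i\<in>I. \<kappa> (f i))"
  by (induction I rule: infinite_finite_induct) (auto simp: \<kappa>_zero \<kappa>_add Zrz_sum)

lemmas root_Zrz = roots_Zrz[OF r_pos]

lemma inverse_power_Zrz: "z \<in> roots r \<Longrightarrow> inverse z ^ s \<in> Zrz r"
  by (intro Zrz_power root_Zrz roots_inverse)

lemma eigen_power:
  assumes "t * v = \<kappa> w * v" "w \<in> Zrz r"
  shows "t ^ s * v = \<kappa> (w ^ s) * v"
proof (induction s)
  case 0
  then show ?case by (simp add: \<kappa>_one)
next
  case (Suc s)
  have "t ^ Suc s * v = t * (\<kappa> (w ^ s) * v)" using Suc by (simp add: mult.assoc)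
  also have "\<dots> = \<kappa> (w ^ s) * (t * v)"
    using \<kappa>_central[OF Zrz_power[OF assms(2)], of s t] by (simp flip: mult.assoc)
  also have "\<dots> = \<kappa> (w ^ s * w) * v" using assms by (simp add: \<kappa>_mult Zrz_power mult.assoc)
  finally show ?case by (simp add: mult.commute)
qed

definition proj :: "'b \<Rightarrow> complex \<Rightarrow> 'b" where
  "proj t z = \<kappa> (1 / of_nat r) * (\<Sum>s<r. \<kappa> (inverse z ^ s) * t ^ s)"

text \<open>On an eigenvector with eigenvalue w the powers of t become scalars, and the average of
  (w/z)^s over s is 1 or 0.\<close>

lemma proj_eigen:
  assumes "t * v = \<kappa> w * v" "w \<in> roots r" "z \<in> roots r"
  shows "proj t z * v = (if z = w then v else 0)"
proof -
  have "\<kappa> (inverse z ^ s) * t ^ s * v = \<kappa> ((inverse z * w) ^ s) * v" for s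
    using eigen_power[OF assms(1)] assms(2,3)
    by (simp add: root_Zrz mult.assoc \<kappa>_mult inverse_power_Zrz Zrz_power power_mult_distrib)
  then have "proj t z * v = \<kappa> (1 / of_nat r) * (\<Sum>s<r. \<kappa> ((inverse z * w) ^ s)) * v"
    by (simp add: proj_def sum_distrib_right mult.assoc)
  also have "\<dots> = \<kappa> (1 / of_nat r * (\<Sum>s<r. (inverse z * w) ^ s)) * v"
    using assms by (simp only: \<kappa>_mult Zrz.invr Zrz_sum \<kappa>_sum Zrz_power Zrz.mult root_Zrz roots_inverse)
  also have "1 / of_nat r * (\<Sum>s<r. (inverse z * w) ^ s) = of_bool (inverse z * w = 1)"
    using assms by (intro sum_root_powers r_pos roots_mult roots_inverse)
  also have "inverse z * w = 1 \<longleftrightarrow> z = w"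
    using roots_nonzero[OF r_pos assms(3)] by (auto simp: field_simps)
  finally show ?thesis by (simp add: \<kappa>_one \<kappa>_zero)
qed

text \<open>Multiplication by t shifts the summation index, cyclically because t^r = 1 and z^r = 1,
  and the shift costs a factor z.\<close>

lemma t_proj:
  assumes "t ^ r = 1" "z \<in> roots r"
  shows "t * proj t z = \<kappa> z * proj t z"
proof -
  let ?f = "\<lambda>s. \<kappa> (inverse z ^ s) * t ^ s"
  have z: "z \<in> Zrz r" "z \<noteq> 0" using root_Zrz assms roots_nonzero[OF r_pos] by auto
  have step: "t * ?f s = \<kappa> z * ?f (Suc s)" for s
  proof -
    have "\<kappa> z * ?f (Suc s) = \<kappa> (z * inverse z ^ Suc s) * t ^ Suc s"
      using z assms(2) inverse_power_Zrz[of z "Suc s"] by (simp add: \<kappa>_mult mult.assoc)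
    also have "z * inverse z ^ Suc s = inverse z ^ s" using z by simp
    finally show ?thesis
      using \<kappa>_central[OF inverse_power_Zrz[OF assms(2)], of s t] by (simp flip: mult.assoc)
  qed
  have "?f r = ?f 0" using assms by (simp add: roots_def power_inverse)
  then have shift: "(\<Sum>s<r. ?f (Suc s)) = (\<Sum>s<r. ?f s)"
    using sum.lessThan_Suc_shift[of ?f r] by simp
  have "t * proj t z = \<kappa> (1 / of_nat r) * (\<Sum>s<r. t * ?f s)"
    using \<kappa>_central[OF Zrz.invr, of t] by (simp add: proj_def sum_distrib_left flip: mult.assoc)
  also have "\<dots> = \<kappa> (1 / of_nat r) * (\<kappa> z * (\<Sum>s<r. ?f s))"
    by (simp only: step flip: shift sum_distrib_left)
  also have "\<dots> = \<kappa> z * proj t z"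
    using \<kappa>_central[OF Zrz.invr, of "\<kappa> z"] by (simp add: proj_def flip: mult.assoc)
  finally show ?thesis .
qed

lemma comm_proj:
  assumes "u * t = t * u" "z \<in> roots r"
  shows "u * proj t z = proj t z * u"
proof -
  have "u * (\<kappa> (inverse z ^ s) * t ^ s) = \<kappa> (inverse z ^ s) * t ^ s * u" for s
    using \<kappa>_central[OF inverse_power_Zrz[OF assms(2)], of s u] power_commuting_commutes[of t u s] assms(1)
    by (intro mult_commute_closed) simp_all
  then have "u * (\<Sum>s<r. \<kappa> (inverse z ^ s) * t ^ s) = (\<Sum>s<r. \<kappa> (inverse z ^ s) * t ^ s) * u"
    unfolding sum_distrib_left sum_distrib_right by simp
  then show ?thesis
    unfolding proj_def by (intro mult_commute_closed \<kappa>_central[OF Zrz.invr, symmetric])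
qed

lemma sum_proj: "(\<Sum>z\<in>roots r. proj t z) = 1"
proof -
  have "(\<Sum>z\<in>roots r. proj t z) = (\<Sum>s<r. \<kappa> (1 / of_nat r) * (\<Sum>z\<in>roots r. \<kappa> (inverse z ^ s)) * t ^ s)"
    unfolding proj_def sum_distrib_left sum_distrib_right
    by (subst sum.swap) (simp add: mult.assoc)
  also have "\<dots> = (\<Sum>s<r. \<kappa> (1 / of_nat r * (\<Sum>z\<in>roots r. inverse z ^ s)) * t ^ s)"
    by (simp only: \<kappa>_mult Zrz.invr Zrz_sum \<kappa>_sum inverse_power_Zrz)
  also have "\<dots> = (\<Sum>s<r. if s = 0 then 1 else 0)"
    by (rule sum.cong) (auto simp: sum_over_roots[OF r_pos] \<kappa>_one \<kappa>_zero simp del: times_divide_eq_left)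
  also have "\<dots> = 1" using r_pos by simp
  finally show ?thesis .
qed

text \<open>A product along two lists, so that statements about n commuting elements follow by
  removing one entry. The catch-all clause is the empty product; the lists in use have equal
  lengths.\<close>

fun eps :: "'b list \<Rightarrow> complex list \<Rightarrow> 'b" where
  "eps (t # ts) (z # l) = proj t z * eps ts l"
| "eps _ _ = 1"

lemma sum_eps: "(\<Sum>l\<in>lam r (length ts). eps ts l) = 1"
proof (induction ts)
  case Nil
  have "lam r 0 = {[]}" by (auto simp: lam_def)
  then show ?case by simp
next
  case (Cons t ts)
  have "(\<Sum>l\<in>lam r (length (t # ts)). eps (t # ts) l) =
      (\<Sum>(z, l)\<in>roots r \<times> lam r (length ts). proj t z * eps ts l)"
    unfolding length_Cons lam_Suc by (subst sum.reindex) (auto simp: inj_on_def case_prod_unfold)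
  also have "\<dots> = (\<Sum>z\<in>roots r. proj t z) * (\<Sum>l\<in>lam r (length ts). eps ts l)"
    unfolding sum_product by (rule sum.cartesian_product[symmetric])
  finally show ?case by (simp add: Cons sum_proj)
qed

lemma eps_eigen:
  assumes "length ts = n" "l \<in> lam r n" "\<mu> \<in> lam r n"
    and "\<And>j. j < n \<Longrightarrow> ts ! j * v = \<kappa> (\<mu> ! j) * v"
  shows "eps ts l * v = (if l = \<mu> then v else 0)"
  using assms
proof (induction ts arbitrary: n l \<mu>)
  case Nil
  then show ?case by (auto simp: lam_def)
next
  case (Cons t ts)
  then obtain z l' w \<mu>' where l: "l = z # l'" "\<mu> = w # \<mu>'" "z \<in> roots r" "w \<in> roots r"
    "l' \<in> lam r (length ts)" "\<mu>' \<in> lam r (length ts)"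
    by (auto simp: lam_Suc)
  have "eps ts l' * v = (if l' = \<mu>' then v else 0)"
  proof (rule Cons.IH[OF refl l(5,6)])
    show "ts ! j * v = \<kappa> (\<mu>' ! j) * v" if "j < length ts" for j
      using Cons.prems(1) Cons.prems(4)[of "Suc j"] l that by simp
  qed
  moreover have "t * v = \<kappa> w * v" using Cons.prems(1) Cons.prems(4)[of 0] l by simp
  then have "proj t z * v = (if z = w then v else 0)" using l by (intro proj_eigen)
  ultimately show ?case using l by (cases "z = w"; cases "l' = \<mu>'") (simp_all add: mult.assoc)
qed

lemma t_eps:
  assumes "length ts = n" "l \<in> lam r n" "j < n"
    and "\<And>i k. i < n \<Longrightarrow> k < n \<Longrightarrow> ts ! i * ts ! k = ts ! k * ts ! i"
    and "\<And>i. i < n \<Longrightarrow> (ts ! i) ^ r = 1"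
  shows "ts ! j * eps ts l = \<kappa> (l ! j) * eps ts l"
  using assms
proof (induction ts arbitrary: n l j)
  case (Cons t ts)
  then obtain z l' where l: "l = z # l'" "z \<in> roots r" "l' \<in> lam r (length ts)"
    by (auto simp: lam_Suc)
  show ?case
  proof (cases j)
    case 0
    then show ?thesis using t_proj[of t z] Cons.prems(1) Cons.prems(5)[of 0] l by (simp flip: mult.assoc)
  next
    case (Suc k)
    have k: "k < length ts" using Cons.prems(1,3) Suc by simp
    have c: "ts ! k * t = t * ts ! k" using Cons.prems(1) Cons.prems(4)[of "Suc k" 0] k by simp
    have "ts ! k * eps ts l' = \<kappa> (l' ! k) * eps ts l'"
    proof (rule Cons.IH[OF refl l(3) k])
      show "ts ! i * ts ! m = ts ! m * ts ! i" if "i < length ts" "m < length ts" for i m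
        using Cons.prems(1) Cons.prems(4)[of "Suc i" "Suc m"] that by simp
      show "(ts ! i) ^ r = 1" if "i < length ts" for i
        using Cons.prems(1) Cons.prems(5)[of "Suc i"] that by simp
    qed
    moreover have "\<kappa> (l' ! k) * proj t z = proj t z * \<kappa> (l' ! k)"
      using nth_lam[OF l(3) k] by (intro \<kappa>_central root_Zrz)
    moreover have "ts ! k * (proj t z * eps ts l') = proj t z * (ts ! k * eps ts l')"
      using comm_proj[OF c l(2)] by (simp flip: mult.assoc)
    ultimately have "ts ! k * (proj t z * eps ts l') = \<kappa> (l' ! k) * (proj t z * eps ts l')"
      by (simp flip: mult.assoc)
    then show ?thesis using Suc l by simp
  qed
qed simp

lemma comm_eps:
  assumes "length ts = n" "l \<in> lam r n" "\<And>i. i < n \<Longrightarrow> ts ! i * u = u * ts ! i"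
  shows "u * eps ts l = eps ts l * u"
  using assms
proof (induction ts arbitrary: n l)
  case (Cons t ts)
  then obtain z l' where l: "l = z # l'" "z \<in> roots r" "l' \<in> lam r (length ts)"
    by (auto simp: lam_Suc)
  have "u * proj t z = proj t z * u"
    using Cons.prems(1) Cons.prems(3)[of 0] l by (intro comm_proj) auto
  moreover have "u * eps ts l' = eps ts l' * u"
  proof (rule Cons.IH[OF refl l(3)])
    show "ts ! i * u = u * ts ! i" if "i < length ts" for i
      using Cons.prems(1) Cons.prems(3)[of "Suc i"] that by simp
  qed
  ultimately show ?case using l by (metis eps.simps(1) mult.assoc)
qed simp

end

section \<open>From the Yokonuma relations to the idempotent relations\<close>

locale yokonuma = root_scalars r \<kappa> for r and \<kappa> :: "complex \<Rightarrow> 'b::{ring,monoid_mult}" +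
  fixes n :: nat and hs ts :: "nat \<Rightarrow> 'b" and y yi qd :: 'b
  assumes h_comm: "1 \<le> i \<Longrightarrow> i + 2 \<le> j \<Longrightarrow> j < n \<Longrightarrow> hs i * hs j = hs j * hs i"
    and h_braid: "1 \<le> i \<Longrightarrow> Suc i < n \<Longrightarrow> hs i * hs (Suc i) * hs i = hs (Suc i) * hs i * hs (Suc i)"
    and t_comm: "1 \<le> i \<Longrightarrow> i \<le> n \<Longrightarrow> 1 \<le> j \<Longrightarrow> j \<le> n \<Longrightarrow> ts i * ts j = ts j * ts i"
    and h_t: "1 \<le> i \<Longrightarrow> i < n \<Longrightarrow> 1 \<le> j \<Longrightarrow> j \<le> n \<Longrightarrow> hs i * ts j = ts (sw i j) * hs i"
    and t_power: "1 \<le> i \<Longrightarrow> i \<le> n \<Longrightarrow> ts i ^ r = 1"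
    and h_sq: "1 \<le> i \<Longrightarrow> i < n \<Longrightarrow> hs i * hs i =
      1 + qd * (\<kappa> (1 / of_nat r) * (\<Sum>s\<in>{0..<r}. ts i ^ s * ts (Suc i) ^ ((r - s) mod r)) * hs i)"
    and y_yi: "y * yi = 1" and yi_y: "yi * y = 1"
    and h_y_h_y: "2 \<le> n \<Longrightarrow> hs 1 * y * hs 1 * y = y * hs 1 * y * hs 1"
    and h_y: "2 \<le> i \<Longrightarrow> i < n \<Longrightarrow> hs i * y = y * hs i"
    and t_y: "1 \<le> j \<Longrightarrow> j \<le> n \<Longrightarrow> ts j * y = y * ts j"
    and qd_h: "1 \<le> i \<Longrightarrow> i < n \<Longrightarrow> qd * hs i = hs i * qd"
begin

definition tl where "tl = map (\<lambda>j. ts (Suc j)) [0..<n]"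
definition ep where "ep l = eps tl l"

lemma tl_simps [simp]: "length tl = n" "j < n \<Longrightarrow> tl ! j = ts (Suc j)"
  by (simp_all add: tl_def)

lemma sum_ep: "(\<Sum>l\<in>lam r n. ep l) = 1"
  using sum_eps[of tl] by (simp add: ep_def)

lemma t_ep: "l \<in> lam r n \<Longrightarrow> j < n \<Longrightarrow> ts (Suc j) * ep l = \<kappa> (l ! j) * ep l"
  using t_eps[of tl n l j] by (simp add: ep_def t_comm t_power)

lemma ep_eigen:
  "l \<in> lam r n \<Longrightarrow> \<mu> \<in> lam r n \<Longrightarrow> (\<And>j. j < n \<Longrightarrow> ts (Suc j) * v = \<kappa> (\<mu> ! j) * v) \<Longrightarrow>
    ep l * v = (if l = \<mu> then v else 0)"
  unfolding ep_def by (rule eps_eigen) auto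

lemma sum_\<kappa>_ep: "j < n \<Longrightarrow> (\<Sum>l\<in>lam r n. \<kappa> (l ! j) * ep l) = ts (Suc j)"
proof -
  assume "j < n"
  then have "(\<Sum>l\<in>lam r n. \<kappa> (l ! j) * ep l) = ts (Suc j) * (\<Sum>l\<in>lam r n. ep l)"
    unfolding sum_distrib_left by (intro sum.cong) (simp_all add: t_ep)
  then show ?thesis by (simp add: sum_ep)
qed

lemma t_h: "1 \<le> i \<Longrightarrow> i < n \<Longrightarrow> 1 \<le> j \<Longrightarrow> j \<le> n \<Longrightarrow> ts j * hs i = hs i * ts (sw i j)"
  using h_t[of i "sw i j"] by (auto simp: sw_def split: if_splits)

text \<open>Since t_j passes h_i with its index permuted, h_i 1_\<lambda> is again a simultaneous
  eigenvector, with eigenvalues permuted by s_i.\<close>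

lemma t_h_ep:
  assumes i: "1 \<le> i" "i < n" and l: "l \<in> lam r n" and j: "j < n"
  shows "ts (Suc j) * (hs i * ep l) = \<kappa> (slam i l ! j) * (hs i * ep l)"
proof -
  let ?k = "sw i (Suc j) - 1"
  have k: "?k < n" "sw i (Suc j) = Suc ?k" using i j by (auto simp: sw_def)
  have lk: "slam i l ! j = l ! ?k"
    using i j l by (auto simp: lam_def nth_slam sw_def)
  have "ts (Suc j) * (hs i * ep l) = hs i * (ts (Suc ?k) * ep l)"
    using t_h[OF i, of "Suc j"] j k(2) by (simp flip: mult.assoc)
  also have "\<dots> = hs i * (\<kappa> (l ! ?k) * ep l)" using t_ep[OF l k(1)] by simp
  also have "\<dots> = \<kappa> (l ! ?k) * (hs i * ep l)"
    using \<kappa>_central[OF root_Zrz[OF nth_lam[OF l k(1)]], of "hs i"] by (simp flip: mult.assoc)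
  finally show ?thesis by (simp add: lk)
qed

lemma ep_h_ep:
  "1 \<le> i \<Longrightarrow> i < n \<Longrightarrow> l \<in> lam r n \<Longrightarrow> m \<in> lam r n \<Longrightarrow>
    ep m * (hs i * ep l) = (if m = slam i l then hs i * ep l else 0)"
  by (rule ep_eigen) (auto simp: slam_lam t_h_ep)

text \<open>Insert 1 as the sum of all projections to the right of h_i. The projection on the left
  kills every summand except m = l, because each h_i 1_m is an eigenvector.\<close>

lemma h_ep:
  assumes i: "1 \<le> i" "i < n" and l: "l \<in> lam r n"
  shows "hs i * ep l = ep (slam i l) * hs i"
proof -
  have sl: "slam i l \<in> lam r n" using i l slam_lam by blast
  have eq: "slam i l = slam i m \<longleftrightarrow> m = l" if "m \<in> lam r n" for m
  proof -
    have "length l = n" "length m = n" using l that by (simp_all add: lam_def)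
    then show ?thesis using slam_slam[of i l] slam_slam[of i m] i by metis
  qed
  have "ep (slam i l) * hs i = ep (slam i l) * hs i * (\<Sum>m\<in>lam r n. ep m)" by (simp add: sum_ep)
  also have "\<dots> = (\<Sum>m\<in>lam r n. ep (slam i l) * (hs i * ep m))" by (simp add: sum_distrib_left mult.assoc)
  also have "\<dots> = (\<Sum>m\<in>lam r n. if m = l then hs i * ep m else 0)"
    by (rule sum.cong) (use i sl eq in \<open>auto simp: ep_h_ep\<close>)
  also have "\<dots> = hs i * ep l" using l finite_lam[OF r_pos] by simp
  finally show ?thesis by simp
qed

text \<open>e_i averages the powers of t_i / t_(i+1), which act on the eigenvector by the powers of
  \<mu>_i / \<mu>_(i+1). The average is 1 if the two entries agree and 0 otherwise.\<close>

lemma sum_t_eigen: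
  assumes i: "1 \<le> i" "i < n" and \<mu>: "\<mu> \<in> lam r n"
    and v: "\<And>j. j < n \<Longrightarrow> ts (Suc j) * v = \<kappa> (\<mu> ! j) * v"
  shows "\<kappa> (1 / of_nat r) * (\<Sum>s\<in>{0..<r}. ts i ^ s * ts (Suc i) ^ ((r - s) mod r)) * v =
    (if sfix i \<mu> then v else 0)"
proof -
  let ?a = "\<mu> ! (i - 1)" and ?b = "\<mu> ! i"
  have ab: "?a \<in> roots r" "?b \<in> roots r" using nth_lam[OF \<mu>] i by auto
  have b0: "?b \<noteq> 0" using roots_nonzero[OF r_pos ab(2)] .
  have va: "ts i * v = \<kappa> ?a * v" and vb: "ts (Suc i) * v = \<kappa> ?b * v"
    using v[of "i - 1"] v[of i] i by simp_all
  have summand: "ts i ^ s * ts (Suc i) ^ ((r - s) mod r) * v = \<kappa> ((?a * inverse ?b) ^ s) * v" if "s < r" for s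
  proof -
    \<comment> \<open>The exponent (r - s) mod r stands for -s. It is 0 and not r for s = 0, hence
      the case distinction.\<close>
    have "?b ^ ((r - s) mod r) * ?b ^ s = 1"
      using that ab(2) by (cases "s = 0") (auto simp: roots_def simp flip: power_add)
    then have pb: "?b ^ ((r - s) mod r) = inverse ?b ^ s"
      using b0 by (simp add: field_simps)
    have "ts i ^ s * ts (Suc i) ^ ((r - s) mod r) * v = ts i ^ s * (\<kappa> (inverse ?b ^ s) * v)"
      using eigen_power[OF vb root_Zrz[OF ab(2)]] by (simp add: mult.assoc pb)
    also have "\<dots> = \<kappa> (inverse ?b ^ s) * (ts i ^ s * v)"
      using \<kappa>_central[OF inverse_power_Zrz[OF ab(2)], of s "ts i ^ s"] by (simp flip: mult.assoc)
    also have "\<dots> = \<kappa> (inverse ?b ^ s * ?a ^ s) * v"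
      using eigen_power[OF va root_Zrz[OF ab(1)]] ab
      by (simp add: \<kappa>_mult inverse_power_Zrz root_Zrz Zrz_power mult.assoc)
    finally show ?thesis by (simp add: power_mult_distrib mult.commute)
  qed
  have Z: "(?a * inverse ?b) ^ s \<in> Zrz r" for s
    using ab by (intro Zrz_power root_Zrz roots_mult roots_inverse)
  have "\<kappa> (1 / of_nat r) * (\<Sum>s\<in>{0..<r}. ts i ^ s * ts (Suc i) ^ ((r - s) mod r)) * v =
      \<kappa> (1 / of_nat r) * (\<Sum>s<r. \<kappa> ((?a * inverse ?b) ^ s)) * v"
    using summand by (simp add: mult.assoc sum_distrib_right lessThan_atLeast0)
  also have "\<dots> = \<kappa> (1 / of_nat r * (\<Sum>s<r. (?a * inverse ?b) ^ s)) * v"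
    using Z by (simp only: \<kappa>_mult Zrz.invr Zrz_sum \<kappa>_sum)
  also have "1 / of_nat r * (\<Sum>s<r. (?a * inverse ?b) ^ s) = of_bool (?a * inverse ?b = 1)"
    using ab by (intro sum_root_powers r_pos roots_mult roots_inverse)
  also have "?a * inverse ?b = 1 \<longleftrightarrow> ?a = ?b" using b0 by (simp add: field_simps)
  also have "?a = ?b \<longleftrightarrow> sfix i \<mu>" using sfix_iff[of i \<mu>] i \<mu> by (simp add: lam_def)
  finally show ?thesis by (simp add: \<kappa>_one \<kappa>_zero)
qed

lemma sum_t_h:
  assumes i: "1 \<le> i" "i < n"
  shows "\<kappa> (1 / of_nat r) * (\<Sum>s\<in>{0..<r}. ts i ^ s * ts (Suc i) ^ ((r - s) mod r)) * hs i =
    (\<Sum>l\<in>{l \<in> lam r n. sfix i l}. hs i * ep l)"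
proof -
  let ?e = "\<kappa> (1 / of_nat r) * (\<Sum>s\<in>{0..<r}. ts i ^ s * ts (Suc i) ^ ((r - s) mod r))"
  have "?e * hs i = ?e * hs i * (\<Sum>l\<in>lam r n. ep l)" by (simp add: sum_ep)
  also have "\<dots> = (\<Sum>l\<in>lam r n. ?e * (hs i * ep l))" by (simp add: sum_distrib_left mult.assoc)
  also have "\<dots> = (\<Sum>l\<in>lam r n. if sfix i l then hs i * ep l else 0)"
  proof (rule sum.cong)
    fix l assume l: "l \<in> lam r n"
    have "sfix i (slam i l) \<longleftrightarrow> sfix i l"
      using slam_slam[of i l] i l unfolding sfix_def lam_def by (metis (mono_tags, lifting) mem_Collect_eq)
    then show "?e * (hs i * ep l) = (if sfix i l then hs i * ep l else 0)"
      using sum_t_eigen[OF i slam_lam[OF i l] t_h_ep[OF i l]] by simp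
  qed simp
  also have "\<dots> = (\<Sum>l\<in>{l \<in> lam r n. sfix i l}. hs i * ep l)"
    using finite_lam[OF r_pos] by (simp add: sum.inter_filter)
  finally show ?thesis .
qed

lemma y_ep: "l \<in> lam r n \<Longrightarrow> y * ep l = ep l * y"
  unfolding ep_def by (rule comm_eps[where n = n]) (simp_all add: t_y)

sublocale hecke: yokonuma_hecke r n hs ep y yi qd
proof
  show "ep l * ep l' = (if l = l' then ep l else 0)" if "l \<in> lam r n" "l' \<in> lam r n" for l l'
    using ep_eigen[of l l' "ep l'"] that by (auto simp: t_ep)
  show "hs i * hs i = 1 + qd * (\<Sum>l\<in>{l \<in> lam r n. sfix i l}. hs i * ep l)" if "1 \<le> i" "i < n" for i
    using h_sq[OF that] sum_t_h[OF that] by simp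
qed (fact r_pos h_comm h_braid sum_ep h_ep y_yi yi_y h_y_h_y h_y y_ep qd_h)+

end

section \<open>From the idempotent relations to the Yokonuma relations\<close>

locale hecke_roots = hecke: yokonuma_hecke r n gs es x xi qd + root_scalars r \<kappa>
  for r n and gs :: "nat \<Rightarrow> 'b::{ring,monoid_mult}" and es x xi qd and \<kappa> :: "complex \<Rightarrow> 'b"
begin

text \<open>The diagonal element with eigenvalue f l on 1_l. Products become pointwise, so
  identities between the t_j reduce to identities between numbers.\<close>

definition D :: "(complex list \<Rightarrow> complex) \<Rightarrow> 'b" where
  "D f = (\<Sum>l\<in>lam r n. \<kappa> (f l) * es l)"

text \<open>Keeps eigenvalues inside \<open>Zrz r\<close>, where \<kappa> is multiplicative.\<close>

definition valid :: "(complex list \<Rightarrow> complex) \<Rightarrow> bool" where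
  "valid f \<longleftrightarrow> (\<forall>l\<in>lam r n. f l \<in> Zrz r)"

lemma D_cong: "(\<And>l. l \<in> lam r n \<Longrightarrow> f l = g l) \<Longrightarrow> D f = D g"
  by (simp add: D_def)

lemma D_one: "D (\<lambda>l. 1) = 1"
  by (simp add: D_def \<kappa>_one hecke.sum_e)

lemma D_e: "valid f \<Longrightarrow> l \<in> lam r n \<Longrightarrow> D f * es l = \<kappa> (f l) * es l"
proof -
  assume l: "l \<in> lam r n"
  have "D f * es l = (\<Sum>m\<in>lam r n. if m = l then \<kappa> (f m) * es m else 0)"
    unfolding D_def sum_distrib_right by (rule sum.cong) (use l in \<open>auto simp: mult.assoc hecke.e_e\<close>)
  then show ?thesis using l finite_lam[OF r_pos] by simp
qed

lemma D_mult: "valid f \<Longrightarrow> valid g \<Longrightarrow> D f * D g = D (\<lambda>l. f l * g l)"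
proof -
  assume v: "valid f" "valid g"
  have "D f * D g = (\<Sum>l\<in>lam r n. D f * (\<kappa> (g l) * es l))"
    unfolding D_def[of g] by (simp add: sum_distrib_left)
  also have "\<dots> = (\<Sum>l\<in>lam r n. \<kappa> (f l * g l) * es l)"
  proof (rule sum.cong)
    fix l assume l: "l \<in> lam r n"
    then have Z: "f l \<in> Zrz r" "g l \<in> Zrz r" using v by (auto simp: valid_def)
    have "D f * (\<kappa> (g l) * es l) = \<kappa> (g l) * (D f * es l)"
      using \<kappa>_central[OF Z(2), of "D f"] by (simp flip: mult.assoc)
    also have "\<dots> = \<kappa> (g l * f l) * es l" using D_e[OF v(1) l] Z by (simp add: \<kappa>_mult mult.assoc)
    finally show "D f * (\<kappa> (g l) * es l) = \<kappa> (f l * g l) * es l" by (simp add: mult.commute)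
  qed simp
  finally show ?thesis by (simp add: D_def)
qed

lemma valid_mult: "valid f \<Longrightarrow> valid g \<Longrightarrow> valid (\<lambda>l. f l * g l)"
  by (simp add: valid_def Zrz.mult)

lemma valid_power: "valid f \<Longrightarrow> valid (\<lambda>l. f l ^ k)"
  by (simp add: valid_def Zrz_power)

lemma valid_const: "c \<in> Zrz r \<Longrightarrow> valid (\<lambda>l. c)"
  by (simp add: valid_def)

lemma valid_sum: "(\<And>i. i \<in> I \<Longrightarrow> valid (f i)) \<Longrightarrow> valid (\<lambda>l. \<Sum>i\<in>I. f i l)"
  by (simp add: valid_def Zrz_sum)

lemma D_power: "valid f \<Longrightarrow> D f ^ k = D (\<lambda>l. f l ^ k)"
  by (induction k) (simp_all add: D_one D_mult valid_power)

lemma D_sum: "(\<And>i. i \<in> I \<Longrightarrow> valid (f i)) \<Longrightarrow> (\<Sum>i\<in>I. D (f i)) = D (\<lambda>l. \<Sum>i\<in>I. f i l)"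
  unfolding D_def by (subst sum.swap) (simp add: \<kappa>_sum valid_def sum_distrib_right)

lemma D_const: "D (\<lambda>l. c) = \<kappa> c"
  by (simp add: D_def hecke.sum_e flip: sum_distrib_left)

lemma g_D:
  assumes i: "1 \<le> i" "i < n" and v: "valid f"
  shows "gs i * D f = D (\<lambda>l. f (slam i l)) * gs i"
proof -
  have "gs i * D f = (\<Sum>l\<in>lam r n. \<kappa> (f l) * es (slam i l) * gs i)"
    unfolding D_def sum_distrib_left
  proof (rule sum.cong)
    fix l assume l: "l \<in> lam r n"
    then have "gs i * (\<kappa> (f l) * es l) = \<kappa> (f l) * (gs i * es l)"
      using \<kappa>_central[of "f l" "gs i"] v by (simp add: valid_def flip: mult.assoc)
    then show "gs i * (\<kappa> (f l) * es l) = \<kappa> (f l) * es (slam i l) * gs i"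
      using i l by (simp add: hecke.g_e mult.assoc)
  qed simp
  also have "\<dots> = (\<Sum>l\<in>lam r n. \<kappa> (f (slam i l)) * es (slam i (slam i l)) * gs i)"
    by (rule sum.reindex_bij_betw[OF bij_betw_slam[OF i], symmetric])
  also have "\<dots> = (\<Sum>l\<in>lam r n. \<kappa> (f (slam i l)) * es l * gs i)"
    using i by (intro sum.cong) (auto simp: slam_slam lam_def)
  finally show ?thesis by (simp add: D_def sum_distrib_right)
qed

lemma x_D: "valid f \<Longrightarrow> D f * x = x * D f"
  unfolding D_def sum_distrib_left sum_distrib_right
proof (rule sum.cong)
  fix l assume v: "valid f" and l: "l \<in> lam r n"
  then show "\<kappa> (f l) * es l * x = x * (\<kappa> (f l) * es l)"
    using \<kappa>_central[of "f l" x] hecke.x_e[OF l] by (metis mult.assoc valid_def)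
qed simp

definition tD where "tD j = D (\<lambda>l. l ! (j - 1))"

lemma valid_nth: "1 \<le> j \<Longrightarrow> j \<le> n \<Longrightarrow> valid (\<lambda>l. l ! (j - 1))"
  unfolding valid_def using nth_lam root_Zrz by (metis One_nat_def Suc_le_eq diff_less less_le_trans zero_less_one diff_Suc_less)

text \<open>Both sides are diagonal, so only eigenvalues are compared: a geometric sum equals 1 if
  s_i fixes the label and 0 otherwise.\<close>

lemma sum_tD:
  assumes i: "1 \<le> i" "i < n"
  shows "\<kappa> (1 / of_nat r) * (\<Sum>s\<in>{0..<r}. tD i ^ s * tD (Suc i) ^ ((r - s) mod r)) = hecke.ee i"
proof -
  let ?f = "\<lambda>l. \<Sum>s\<in>{0..<r}. (l ! (i - 1)) ^ s * (l ! i) ^ ((r - s) mod r)"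
  have v: "valid (\<lambda>l. l ! (i - 1))" "valid (\<lambda>l. l ! i)"
    using valid_nth[of i] valid_nth[of "Suc i"] i by simp_all
  have "\<kappa> (1 / of_nat r) * (\<Sum>s\<in>{0..<r}. tD i ^ s * tD (Suc i) ^ ((r - s) mod r)) =
      D (\<lambda>l. 1 / of_nat r) * D ?f"
    using v by (simp add: tD_def D_power D_mult D_sum D_const valid_power valid_mult)
  also have "\<dots> = D (\<lambda>l. 1 / of_nat r * ?f l)"
    using v by (intro D_mult valid_const Zrz.invr valid_sum valid_mult valid_power)
  also have "\<dots> = D (\<lambda>l. of_bool (sfix i l))"
  proof (rule D_cong)
    fix l assume l: "l \<in> lam r n"
    have ab: "l ! (i - 1) \<in> roots r" "l ! i \<in> roots r" using nth_lam[OF l] i by auto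
    have b0: "l ! i \<noteq> 0" using roots_nonzero[OF r_pos ab(2)] .
    have "(l ! (i - 1)) ^ s * (l ! i) ^ ((r - s) mod r) = (l ! (i - 1) * inverse (l ! i)) ^ s" if "s < r" for s
    proof -
      have "(l ! i) ^ ((r - s) mod r) * (l ! i) ^ s = 1"
        using that ab(2) by (cases "s = 0") (auto simp: roots_def simp flip: power_add)
      then show ?thesis using b0 by (simp add: field_simps)
    qed
    then have "?f l = (\<Sum>s<r. (l ! (i - 1) * inverse (l ! i)) ^ s)"
      by (simp add: lessThan_atLeast0)
    then have "1 / of_nat r * ?f l = of_bool (l ! (i - 1) * inverse (l ! i) = 1)"
      using sum_root_powers[OF r_pos roots_mult[OF ab(1) roots_inverse[OF ab(2)]]] by simp
    then show "1 / of_nat r * ?f l = of_bool (sfix i l)"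
      using sfix_iff[of i l] i l b0 by (simp add: lam_def field_simps)
  qed
  also have "\<dots> = (\<Sum>l\<in>lam r n. if sfix i l then es l else 0)"
    unfolding D_def by (rule sum.cong) (auto simp: \<kappa>_one \<kappa>_zero)
  also have "\<dots> = hecke.ee i"
    using finite_lam[OF r_pos] by (simp add: hecke.ee_def sum.inter_filter)
  finally show ?thesis .
qed

sublocale yok: yokonuma r \<kappa> n gs tD x xi qd
proof
  show "gs i * gs j = gs j * gs i" if "1 \<le> i" "i + 2 \<le> j" "j < n" for i j
    using that by (rule hecke.g_comm)
  show "gs i * gs (Suc i) * gs i = gs (Suc i) * gs i * gs (Suc i)" if "1 \<le> i" "Suc i < n" for i
    using that by (rule hecke.g_braid)
  show "tD i * tD j = tD j * tD i" if "1 \<le> i" "i \<le> n" "1 \<le> j" "j \<le> n" for i j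
    using valid_nth[OF that(1,2)] valid_nth[OF that(3,4)] by (simp add: tD_def D_mult mult.commute)
  show "gs i * tD j = tD (sw i j) * gs i" if "1 \<le> i" "i < n" "1 \<le> j" "j \<le> n" for i j
  proof -
    have "D (\<lambda>l. slam i l ! (j - 1)) = tD (sw i j)"
      unfolding tD_def by (rule D_cong) (use that in \<open>auto simp: lam_def nth_slam sw_def\<close>)
    then show ?thesis using g_D[OF that(1,2) valid_nth[OF that(3,4)]] by (simp add: tD_def)
  qed
  show "tD i ^ r = 1" if "1 \<le> i" "i \<le> n" for i
  proof -
    have "tD i ^ r = D (\<lambda>l. 1)"
      unfolding tD_def D_power[OF valid_nth[OF that]]
      by (rule D_cong) (use that in \<open>auto simp: lam_def\<close>)
    then show ?thesis by (simp add: D_one)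
  qed
  show "gs i * gs i = 1 + qd * (\<kappa> (1 / of_nat r) * (\<Sum>s\<in>{0..<r}. tD i ^ s * tD (Suc i) ^ ((r - s) mod r)) * gs i)"
    if "1 \<le> i" "i < n" for i
    unfolding sum_tD[OF that] using hecke.g_sq'[OF that] .
  show "x * xi = 1" "xi * x = 1" by (fact hecke.x_xi hecke.xi_x)+
  show "gs 1 * x * gs 1 * x = x * gs 1 * x * gs 1" if "2 \<le> n" using that by (rule hecke.g_x_g_x)
  show "gs i * x = x * gs i" if "2 \<le> i" "i < n" for i using that by (rule hecke.g_x)
  show "tD j * x = x * tD j" if "1 \<le> j" "j \<le> n" for j
    unfolding tD_def by (rule x_D[OF valid_nth[OF that]])
  show "qd * gs i = gs i * qd" if "1 \<le> i" "i < n" for i using that by (rule hecke.qd_g)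
qed

text \<open>Fourier inversion: the projection rebuilt from the t_j acts on every 1_m as 1_l does,
  and the 1_m sum to 1. This makes the two homomorphisms mutually inverse on idempotents.\<close>

lemma ep_eq_es: "l \<in> lam r n \<Longrightarrow> yok.ep l = es l"
proof -
  assume l: "l \<in> lam r n"
  have "yok.ep l * es m = (if l = m then es m else 0)" if m: "m \<in> lam r n" for m
    using l m valid_nth[of "Suc _"] by (intro yok.ep_eigen) (simp_all add: tD_def D_e)
  then have "yok.ep l * (\<Sum>m\<in>lam r n. es m) = (\<Sum>m\<in>lam r n. if l = m then es m else 0)"
    unfolding sum_distrib_left by (intro sum.cong) auto
  then show ?thesis using l finite_lam[OF r_pos] by (simp add: hecke.sum_e)
qed

end

section \<open>The defining relations of the two algebras\<close>

lemma hgens_iff [simp]: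
  "G i \<in> hgens r n \<longleftrightarrow> 1 \<le> i \<and> i < n" "E l \<in> hgens r n \<longleftrightarrow> l \<in> lam r n"
  "X1 \<in> hgens r n" "X1i \<in> hgens r n"
  by (auto simp: hgens_def)

lemma ygens_iff [simp]:
  "T j \<in> ygens n \<longleftrightarrow> 1 \<le> j \<and> j \<le> n" "Hg i \<in> ygens n \<longleftrightarrow> 1 \<le> i \<and> i < n"
  "Y1 \<in> ygens n" "Y1i \<in> ygens n"
  by (auto simp: ygens_def)

lemma sw_range: "1 \<le> i \<Longrightarrow> i < n \<Longrightarrow> 1 \<le> j \<Longrightarrow> j \<le> n \<Longrightarrow> 1 \<le> sw i j \<and> sw i j \<le> n"
  by (auto simp: sw_def)

lemma hrels_fa:
  assumes K: "coefficient_ring K" and d: "d \<in> K"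
  shows "hrels r n d \<subseteq> fa (hgens r n) K"
proof -
  interpret presentation "hgens r n" K "{}"
    using K by (simp add: presentation_def presentation_axioms_def)
  have fs: "fsum (\<lambda>l. fw [G i, E l]) {l \<in> lam r n. sfix i l} \<in> fa (hgens r n) K" if "1 \<le> i" "i < n" for i
    using that by (intro fa_fsum fa_fw) auto
  note [simp] = fa_intros
  show ?thesis
    unfolding hrels_def using d by (auto simp: slam_lam[unfolded One_nat_def] fs[unfolded One_nat_def])
qed

lemma yrels_fa:
  assumes K: "coefficient_ring K" and d: "d \<in> K" "ri \<in> K"
  shows "yrels r n d ri \<subseteq> fa (ygens n) K"
proof -
  interpret presentation "ygens n" K "{}"
    using K by (simp add: presentation_def presentation_axioms_def)
  have rep: "fw (replicate k (T i)) \<in> fa (ygens n) K" if "1 \<le> i" "i \<le> n" for k i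
    using that by (intro fa_fw) auto
  note [simp] = fa_intros
  have ye: "ye r ri i \<in> fa (ygens n) K" if "1 \<le> i" "i < n" for i
    unfolding ye_def using that d by (intro fa_fsc fa_fsum fa_fw) auto
  show ?thesis
    unfolding yrels_def using d by (auto simp: ye[unfolded One_nat_def] rep[unfolded One_nat_def] sw_range[unfolded One_nat_def])
qed

text \<open>Applied to the canonical evaluation, this supplies the locale for the presented algebra
  itself. The converse, \<open>hecke_imp_hrels\<close>, supplies homomorphisms out of that
  algebra.\<close>

lemma hrels_imp_hecke:
  assumes ev: "evaluation (hgens r n) K (hrels r n d) \<iota> \<theta>" and r: "1 \<le> r" and d: "d \<in> K"
    and rel: "\<And>\<rho>. \<rho> \<in> hrels r n d \<Longrightarrow> feval \<iota> \<theta> \<rho> = 0"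
  shows "yokonuma_hecke r n (\<lambda>i. \<theta> (G i)) (\<lambda>l. \<theta> (E l)) (\<theta> X1) (\<theta> X1i) (\<iota> d)"
proof -
  interpret evaluation "hgens r n" K "hrels r n d" \<iota> \<theta> by (rule ev)
  have fs: "fsum (\<lambda>l. fw [G i, E l]) {l \<in> lam r n. sfix i l} \<in> fa (hgens r n) K"
    "ev (fsum (\<lambda>l. fw [G i, E l]) {l \<in> lam r n. sfix i l}) =
      (\<Sum>l\<in>{l \<in> lam r n. sfix i l}. \<theta> (G i) * \<theta> (E l))" if "1 \<le> i" "i < n" for i
  proof -
    have "fw [G i, E l] \<in> fa (hgens r n) K" if "l \<in> {l \<in> lam r n. sfix i l}" for l
      using that \<open>1 \<le> i\<close> \<open>i < n\<close> by (intro fa_fw) auto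
    then show "fsum (\<lambda>l. fw [G i, E l]) {l \<in> lam r n. sfix i l} \<in> fa (hgens r n) K"
      "ev (fsum (\<lambda>l. fw [G i, E l]) {l \<in> lam r n. sfix i l}) =
      (\<Sum>l\<in>{l \<in> lam r n. sfix i l}. \<theta> (G i) * \<theta> (E l))"
      by (simp_all only: fa_fsum ev_fsum) (simp_all add: ev_fw)
  qed
  note [simp] = fa_intros ev_simps d
  show ?thesis
  proof
    show "1 \<le> r" by (rule r)
    show "\<theta> (G i) * \<theta> (G j) = \<theta> (G j) * \<theta> (G i)" if "1 \<le> i" "i + 2 \<le> j" "j < n" for i j
    proof -
      have "i < n" "1 \<le> j" "i + 2 \<le> j \<or> j + 2 \<le> i" using that by auto
      then have "fsub (fw [G i, G j]) (fw [G j, G i]) \<in> hrels r n d"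
        using that unfolding hrels_def by blast
      from rel[OF this] that show ?thesis by simp
    qed
    show "\<theta> (G i) * \<theta> (G (Suc i)) * \<theta> (G i) = \<theta> (G (Suc i)) * \<theta> (G i) * \<theta> (G (Suc i))"
      if "1 \<le> i" "Suc i < n" for i
    proof -
      have "i + 1 < n" using that by simp
      then have "fsub (fw [G i, G (i+1), G i]) (fw [G (i+1), G i, G (i+1)]) \<in> hrels r n d"
        using that unfolding hrels_def by blast
      from rel[OF this] that show ?thesis by (simp add: mult.assoc)
    qed
    show "\<theta> (G i) * \<theta> (E l) = \<theta> (E (slam i l)) * \<theta> (G i)" if "1 \<le> i" "i < n" "l \<in> lam r n" for i l
    proof -
      have "fsub (fw [G i, E l]) (fw [E (slam i l), G i]) \<in> hrels r n d"
        using that unfolding hrels_def by blast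
      from rel[OF this] that slam_lam[OF that] show ?thesis by simp
    qed
    show "(\<Sum>l\<in>lam r n. \<theta> (E l)) = 1"
    proof -
      have "fsub (fsum (\<lambda>l. fw [E l]) (lam r n)) (fw []) \<in> hrels r n d"
        unfolding hrels_def by simp
      from rel[OF this] show ?thesis by simp
    qed
    show "\<theta> (E l) * \<theta> (E l') = (if l = l' then \<theta> (E l) else 0)" if "l \<in> lam r n" "l' \<in> lam r n" for l l'
    proof -
      have "fsub (fw [E l, E l']) (if l = l' then fw [E l] else (\<lambda>w. 0)) \<in> hrels r n d"
        using that unfolding hrels_def by blast
      from rel[OF this] that show ?thesis by (cases "l = l'") simp_all
    qed
    show "\<theta> (G i) * \<theta> (G i) = 1 + \<iota> d * (\<Sum>l\<in>{l \<in> lam r n. sfix i l}. \<theta> (G i) * \<theta> (E l))"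
      if "1 \<le> i" "i < n" for i
    proof -
      have "fsub (fw [G i, G i]) (fadd (fw []) (fsc d (fsum (\<lambda>l. fw [G i, E l]) {l \<in> lam r n. sfix i l})))
          \<in> hrels r n d"
        using that unfolding hrels_def by blast
      from rel[OF this] fs[OF that] that show ?thesis by simp
    qed
    show "\<theta> X1 * \<theta> X1i = 1"
    proof -
      have "fsub (fw [X1, X1i]) (fw []) \<in> hrels r n d" unfolding hrels_def by simp
      from rel[OF this] show ?thesis by simp
    qed
    show "\<theta> X1i * \<theta> X1 = 1"
    proof -
      have "fsub (fw [X1i, X1]) (fw []) \<in> hrels r n d" unfolding hrels_def by simp
      from rel[OF this] show ?thesis by simp
    qed
    show "\<theta> (G 1) * \<theta> X1 * \<theta> (G 1) * \<theta> X1 = \<theta> X1 * \<theta> (G 1) * \<theta> X1 * \<theta> (G 1)" if "2 \<le> n"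
    proof -
      have "fsub (fw [G 1, X1, G 1, X1]) (fw [X1, G 1, X1, G 1]) \<in> hrels r n d"
        using that unfolding hrels_def by blast
      from rel[OF this] that show ?thesis by (simp add: mult.assoc)
    qed
    show "\<theta> (G i) * \<theta> X1 = \<theta> X1 * \<theta> (G i)" if "2 \<le> i" "i < n" for i
    proof -
      have "fsub (fw [G i, X1]) (fw [X1, G i]) \<in> hrels r n d" using that unfolding hrels_def by blast
      from rel[OF this] that show ?thesis by simp
    qed
    show "\<theta> X1 * \<theta> (E l) = \<theta> (E l) * \<theta> X1" if "l \<in> lam r n" for l
    proof -
      have "fsub (fw [X1, E l]) (fw [E l, X1]) \<in> hrels r n d" using that unfolding hrels_def by blast
      from rel[OF this] that show ?thesis by simp
    qed
    show "\<iota> d * \<theta> (G i) = \<theta> (G i) * \<iota> d" if "1 \<le> i" "i < n" for i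
      using that \<iota>_comm[OF d] by simp
  qed
qed

lemma hecke_imp_hrels:
  assumes ev: "evaluation (hgens r n) K (hrels r n d) \<iota> \<theta>" and d: "d \<in> K"
    and H: "yokonuma_hecke r n (\<lambda>i. \<theta> (G i)) (\<lambda>l. \<theta> (E l)) (\<theta> X1) (\<theta> X1i) (\<iota> d)"
    and \<rho>: "\<rho> \<in> hrels r n d"
  shows "feval \<iota> \<theta> \<rho> = 0"
proof -
  interpret evaluation "hgens r n" K "hrels r n d" \<iota> \<theta> by (rule ev)
  interpret H: yokonuma_hecke r n "\<lambda>i. \<theta> (G i)" "\<lambda>l. \<theta> (E l)" "\<theta> X1" "\<theta> X1i" "\<iota> d" by (rule H)
  have fs: "fsum (\<lambda>l. fw [G i, E l]) {l \<in> lam r n. sfix i l} \<in> fa (hgens r n) K"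
    "ev (fsum (\<lambda>l. fw [G i, E l]) {l \<in> lam r n. sfix i l}) =
      (\<Sum>l\<in>{l \<in> lam r n. sfix i l}. \<theta> (G i) * \<theta> (E l))" if "1 \<le> i" "i < n" for i
  proof -
    have "fw [G i, E l] \<in> fa (hgens r n) K" if "l \<in> {l \<in> lam r n. sfix i l}" for l
      using that \<open>1 \<le> i\<close> \<open>i < n\<close> by (intro fa_fw) auto
    then show "fsum (\<lambda>l. fw [G i, E l]) {l \<in> lam r n. sfix i l} \<in> fa (hgens r n) K"
      "ev (fsum (\<lambda>l. fw [G i, E l]) {l \<in> lam r n. sfix i l}) =
      (\<Sum>l\<in>{l \<in> lam r n. sfix i l}. \<theta> (G i) * \<theta> (E l))"
      by (simp_all only: fa_fsum ev_fsum) (simp_all add: ev_fw)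
  qed
  note [simp] = fa_intros ev_simps d
  \<comment> \<open>The relators contain both orders of a distant pair, the locale only the pairs
    with i + 2 \<le> j.\<close>
  have comm: "\<theta> (G i) * \<theta> (G j) = \<theta> (G j) * \<theta> (G i)"
    if "1 \<le> i" "i < n" "1 \<le> j" "j < n" "i + 2 \<le> j \<or> j + 2 \<le> i" for i j
    using that H.g_comm[of i j] H.g_comm[of j i] by auto
  consider
      (1) i j where "\<rho> = fsub (fw [G i, G j]) (fw [G j, G i])" "1 \<le> i" "i < n" "1 \<le> j" "j < n"
        "i + 2 \<le> j \<or> j + 2 \<le> i"
    | (2) i where "\<rho> = fsub (fw [G i, G (i+1), G i]) (fw [G (i+1), G i, G (i+1)])" "1 \<le> i" "i + 1 < n"
    | (3) i l where "\<rho> = fsub (fw [G i, E l]) (fw [E (slam i l), G i])" "1 \<le> i" "i < n" "l \<in> lam r n"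
    | (4) "\<rho> = fsub (fsum (\<lambda>l. fw [E l]) (lam r n)) (fw [])"
    | (5) l l' where "\<rho> = fsub (fw [E l, E l']) (if l = l' then fw [E l] else (\<lambda>w. 0))" "l \<in> lam r n" "l' \<in> lam r n"
    | (6) i where "\<rho> = fsub (fw [G i, G i]) (fadd (fw []) (fsc d (fsum (\<lambda>l. fw [G i, E l]) {l \<in> lam r n. sfix i l})))"
        "1 \<le> i" "i < n"
    | (7) "\<rho> = fsub (fw [X1, X1i]) (fw [])"
    | (8) "\<rho> = fsub (fw [X1i, X1]) (fw [])"
    | (9) "\<rho> = fsub (fw [G 1, X1, G 1, X1]) (fw [X1, G 1, X1, G 1])" "2 \<le> n"
    | (10) i where "\<rho> = fsub (fw [G i, X1]) (fw [X1, G i])" "2 \<le> i" "i < n"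
    | (11) l where "\<rho> = fsub (fw [X1, E l]) (fw [E l, X1])" "l \<in> lam r n"
    using \<rho> unfolding hrels_def by blast
  then show ?thesis
  proof cases
    case 1
    then show ?thesis using comm[of i j] by simp
  next
    case 2
    then show ?thesis using H.g_braid[of i] by (simp add: mult.assoc)
  next
    case 3
    then show ?thesis using H.g_e[of i l] slam_lam[of i n l r] by simp
  next
    case 4
    then show ?thesis using H.sum_e by simp
  next
    case 5
    then show ?thesis using H.e_e[of l l'] by (cases "l = l'") simp_all
  next
    case 6
    then show ?thesis using H.g_sq[of i] fs[of i] by simp
  next
    case 7
    then show ?thesis using H.x_xi by simp
  next
    case 8
    then show ?thesis using H.xi_x by simp
  next
    case 9
    then show ?thesis using H.g_x_g_x by (simp add: mult.assoc)
  next
    case 10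
    then show ?thesis using H.g_x[of i] by simp
  next
    case 11
    then show ?thesis using H.x_e[of l] by simp
  qed
qed

lemma feval_ye:
  assumes ev: "evaluation (ygens n) K Rel \<iota> \<theta>" and "ri \<in> K" "1 \<le> i" "i < n"
  shows "ye r ri i \<in> fa (ygens n) K"
    and "feval \<iota> \<theta> (ye r ri i) = \<iota> ri * (\<Sum>s\<in>{0..<r}. \<theta> (T i) ^ s * \<theta> (T (Suc i)) ^ ((r - s) mod r))"
proof -
  interpret evaluation "ygens n" K Rel \<iota> \<theta> by (rule ev)
  have *: "fw (replicate s (T i) @ replicate ((r - s) mod r) (T (i+1))) \<in> fa (ygens n) K" for s
    using assms by (intro fa_fw) auto
  show "ye r ri i \<in> fa (ygens n) K" unfolding ye_def using assms * by (intro fa_fsc fa_fsum)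
  show "feval \<iota> \<theta> (ye r ri i) = \<iota> ri * (\<Sum>s\<in>{0..<r}. \<theta> (T i) ^ s * \<theta> (T (Suc i)) ^ ((r - s) mod r))"
    unfolding ye_def using assms *
    by (simp add: ev_fsc ev_fsum fa_fsum ev_fw prod_list_replicate)
qed

lemma yrels_imp_yokonuma:
  assumes ev: "evaluation (ygens n) K (yrels r n d ri) \<iota> \<theta>" and \<kappa>: "root_scalars r \<kappa>"
    and d: "d \<in> K" "ri \<in> K" and ri: "\<iota> ri = \<kappa> (1 / of_nat r)"
    and rel: "\<And>\<rho>. \<rho> \<in> yrels r n d ri \<Longrightarrow> feval \<iota> \<theta> \<rho> = 0"
  shows "yokonuma r \<kappa> n (\<lambda>i. \<theta> (Hg i)) (\<lambda>j. \<theta> (T j)) (\<theta> Y1) (\<theta> Y1i) (\<iota> d)"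
proof -
  interpret evaluation "ygens n" K "yrels r n d ri" \<iota> \<theta> by (rule ev)
  interpret root_scalars r \<kappa> by (rule \<kappa>)
  note [simp] = fa_intros ev_simps d
  show ?thesis
  proof
    show "\<theta> (Hg i) * \<theta> (Hg j) = \<theta> (Hg j) * \<theta> (Hg i)" if "1 \<le> i" "i + 2 \<le> j" "j < n" for i j
    proof -
      have "i < n" "1 \<le> j" "i + 2 \<le> j \<or> j + 2 \<le> i" using that by auto
      then have "fsub (fw [Hg i, Hg j]) (fw [Hg j, Hg i]) \<in> yrels r n d ri"
        using that unfolding yrels_def by blast
      from rel[OF this] that show ?thesis by simp
    qed
    show "\<theta> (Hg i) * \<theta> (Hg (Suc i)) * \<theta> (Hg i) = \<theta> (Hg (Suc i)) * \<theta> (Hg i) * \<theta> (Hg (Suc i))"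
      if "1 \<le> i" "Suc i < n" for i
    proof -
      have "i + 1 < n" using that by simp
      then have "fsub (fw [Hg i, Hg (i+1), Hg i]) (fw [Hg (i+1), Hg i, Hg (i+1)]) \<in> yrels r n d ri"
        using that unfolding yrels_def by blast
      from rel[OF this] that show ?thesis by (simp add: mult.assoc)
    qed
    show "\<theta> (T i) * \<theta> (T j) = \<theta> (T j) * \<theta> (T i)" if "1 \<le> i" "i \<le> n" "1 \<le> j" "j \<le> n" for i j
    proof -
      have "fsub (fw [T i, T j]) (fw [T j, T i]) \<in> yrels r n d ri"
        using that unfolding yrels_def by blast
      from rel[OF this] that show ?thesis by simp
    qed
    show "\<theta> (Hg i) * \<theta> (T j) = \<theta> (T (sw i j)) * \<theta> (Hg i)" if "1 \<le> i" "i < n" "1 \<le> j" "j \<le> n" for i j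
    proof -
      have "fsub (fw [Hg i, T j]) (fw [T (sw i j), Hg i]) \<in> yrels r n d ri"
        using that unfolding yrels_def by blast
      from rel[OF this] that sw_range[OF that] show ?thesis by simp
    qed
    show "\<theta> (T i) ^ r = 1" if "1 \<le> i" "i \<le> n" for i
    proof -
      have "fsub (fw (replicate r (T i))) (fw []) \<in> yrels r n d ri"
        using that unfolding yrels_def by blast
      moreover have "set (replicate r (T i)) \<subseteq> ygens n" using that by auto
      ultimately show ?thesis using rel[of "fsub (fw (replicate r (T i))) (fw [])"] by (simp add: prod_list_replicate del: set_replicate)
    qed
    show "\<theta> (Hg i) * \<theta> (Hg i) = 1 + \<iota> d *
        (\<kappa> (1 / of_nat r) * (\<Sum>s\<in>{0..<r}. \<theta> (T i) ^ s * \<theta> (T (Suc i)) ^ ((r - s) mod r)) * \<theta> (Hg i))"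
      if "1 \<le> i" "i < n" for i
    proof -
      have "fsub (fw [Hg i, Hg i]) (fadd (fw []) (fsc d (fmul (ye r ri i) (fw [Hg i])))) \<in> yrels r n d ri"
        using that unfolding yrels_def by blast
      from rel[OF this] that feval_ye[OF ev d(2) that] ri show ?thesis by simp
    qed
    show "\<theta> Y1 * \<theta> Y1i = 1"
    proof -
      have "fsub (fw [Y1, Y1i]) (fw []) \<in> yrels r n d ri" unfolding yrels_def by simp
      from rel[OF this] show ?thesis by simp
    qed
    show "\<theta> Y1i * \<theta> Y1 = 1"
    proof -
      have "fsub (fw [Y1i, Y1]) (fw []) \<in> yrels r n d ri" unfolding yrels_def by simp
      from rel[OF this] show ?thesis by simp
    qed
    show "\<theta> (Hg 1) * \<theta> Y1 * \<theta> (Hg 1) * \<theta> Y1 = \<theta> Y1 * \<theta> (Hg 1) * \<theta> Y1 * \<theta> (Hg 1)" if "2 \<le> n"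
    proof -
      have "fsub (fw [Hg 1, Y1, Hg 1, Y1]) (fw [Y1, Hg 1, Y1, Hg 1]) \<in> yrels r n d ri"
        using that unfolding yrels_def by blast
      from rel[OF this] that show ?thesis by (simp add: mult.assoc)
    qed
    show "\<theta> (Hg i) * \<theta> Y1 = \<theta> Y1 * \<theta> (Hg i)" if "2 \<le> i" "i < n" for i
    proof -
      have "fsub (fw [Hg i, Y1]) (fw [Y1, Hg i]) \<in> yrels r n d ri" using that unfolding yrels_def by blast
      from rel[OF this] that show ?thesis by simp
    qed
    show "\<theta> (T j) * \<theta> Y1 = \<theta> Y1 * \<theta> (T j)" if "1 \<le> j" "j \<le> n" for j
    proof -
      have "fsub (fw [T j, Y1]) (fw [Y1, T j]) \<in> yrels r n d ri" using that unfolding yrels_def by blast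
      from rel[OF this] that show ?thesis by simp
    qed
    show "\<iota> d * \<theta> (Hg i) = \<theta> (Hg i) * \<iota> d" if "1 \<le> i" "i < n" for i
      using that \<iota>_comm[OF d(1)] by simp
  qed
qed

lemma yokonuma_imp_yrels:
  assumes ev: "evaluation (ygens n) K (yrels r n d ri) \<iota> \<theta>"
    and d: "d \<in> K" "ri \<in> K" and ri: "\<iota> ri = \<kappa> (1 / of_nat r)"
    and Y: "yokonuma r \<kappa> n (\<lambda>i. \<theta> (Hg i)) (\<lambda>j. \<theta> (T j)) (\<theta> Y1) (\<theta> Y1i) (\<iota> d)"
    and \<rho>: "\<rho> \<in> yrels r n d ri"
  shows "feval \<iota> \<theta> \<rho> = 0"
proof -
  interpret evaluation "ygens n" K "yrels r n d ri" \<iota> \<theta> by (rule ev)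
  interpret Y: yokonuma r \<kappa> n "\<lambda>i. \<theta> (Hg i)" "\<lambda>j. \<theta> (T j)" "\<theta> Y1" "\<theta> Y1i" "\<iota> d" by (rule Y)
  note [simp] = fa_intros ev_simps d
  have comm: "\<theta> (Hg i) * \<theta> (Hg j) = \<theta> (Hg j) * \<theta> (Hg i)"
    if "1 \<le> i" "i < n" "1 \<le> j" "j < n" "i + 2 \<le> j \<or> j + 2 \<le> i" for i j
    using that Y.h_comm[of i j] Y.h_comm[of j i] by auto
  consider
      (1) i j where "\<rho> = fsub (fw [Hg i, Hg j]) (fw [Hg j, Hg i])" "1 \<le> i" "i < n" "1 \<le> j" "j < n"
        "i + 2 \<le> j \<or> j + 2 \<le> i"
    | (2) i where "\<rho> = fsub (fw [Hg i, Hg (i+1), Hg i]) (fw [Hg (i+1), Hg i, Hg (i+1)])" "1 \<le> i" "i + 1 < n"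
    | (3) i j where "\<rho> = fsub (fw [T i, T j]) (fw [T j, T i])" "1 \<le> i" "i \<le> n" "1 \<le> j" "j \<le> n"
    | (4) i j where "\<rho> = fsub (fw [Hg i, T j]) (fw [T (sw i j), Hg i])" "1 \<le> i" "i < n" "1 \<le> j" "j \<le> n"
    | (5) i where "\<rho> = fsub (fw (replicate r (T i))) (fw [])" "1 \<le> i" "i \<le> n"
    | (6) i where "\<rho> = fsub (fw [Hg i, Hg i]) (fadd (fw []) (fsc d (fmul (ye r ri i) (fw [Hg i]))))"
        "1 \<le> i" "i < n"
    | (7) "\<rho> = fsub (fw [Y1, Y1i]) (fw [])"
    | (8) "\<rho> = fsub (fw [Y1i, Y1]) (fw [])"
    | (9) "\<rho> = fsub (fw [Hg 1, Y1, Hg 1, Y1]) (fw [Y1, Hg 1, Y1, Hg 1])" "2 \<le> n"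
    | (10) i where "\<rho> = fsub (fw [Hg i, Y1]) (fw [Y1, Hg i])" "2 \<le> i" "i < n"
    | (11) j where "\<rho> = fsub (fw [T j, Y1]) (fw [Y1, T j])" "1 \<le> j" "j \<le> n"
    using \<rho> unfolding yrels_def by blast
  then show ?thesis
  proof cases
    case 1
    then show ?thesis using comm[of i j] by simp
  next
    case 2
    then show ?thesis using Y.h_braid[of i] by (simp add: mult.assoc)
  next
    case 3
    then show ?thesis using Y.t_comm[of i j] by simp
  next
    case 4
    then show ?thesis using Y.h_t[of i j] sw_range[of i n j] by simp
  next
    case 5
    then have "set (replicate r (T i)) \<subseteq> ygens n" by auto
    then show ?thesis using Y.t_power[of i] 5 by (simp add: prod_list_replicate del: set_replicate)
  next
    case 6
    then show ?thesis using Y.h_sq[of i] feval_ye[OF ev d(2) 6(2,3)] ri by simp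
  next
    case 7
    then show ?thesis using Y.y_yi by simp
  next
    case 8
    then show ?thesis using Y.yi_y by simp
  next
    case 9
    then show ?thesis using Y.h_y_h_y by (simp add: mult.assoc)
  next
    case 10
    then show ?thesis using Y.h_y[of i] by simp
  next
    case 11
    then show ?thesis using Y.t_y[of j] by simp
  qed
qed

section \<open>Presented rings as types\<close>

context presented
begin

lemma Rep_prod_list: "rprod Pr (map Rep xs) = Rep (prod_list xs)"
  by (induction xs) (simp_all add: rprod_def Rep_one Rep_mult)

lemma Rep_power: "Rep x [^]\<^bsub>Pr\<^esub> (k::nat) = Rep (x ^ k)"
  by (induction k) (simp_all add: Rep_one Rep_mult power_Suc2 del: power_Suc)

lemma Rep_m_inv: "x * y = 1 \<Longrightarrow> y * x = 1 \<Longrightarrow> m_inv Pr (Rep x) = Rep y"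
  by (rule monoid.inv_char[OF ring.is_monoid[OF ring_P]])
    (simp_all add: Rep_carrier flip: Rep_mult Rep_one)

lemma Rep_finsum:
  assumes "finite S" "\<And>v. v \<in> S \<Longrightarrow> f (Rep v) = Rep (g v)"
  shows "finsum Pr f (Rep ` S) = Rep (\<Sum>v\<in>S. g v)"
  using assms
proof (induction S rule: finite_induct)
  interpret ring Pr by (rule ring_P)
  case empty
  then show ?case by (simp add: Rep_zero)
next
  interpret ring Pr by (rule ring_P)
  case (insert v S)
  have "Rep v \<notin> Rep ` S" using insert by (auto simp: Rep_inject)
  moreover have "f \<in> Rep ` S \<rightarrow> carrier Pr" "f (Rep v) \<in> carrier Pr"
    using insert.prems by (auto simp: Rep_carrier)
  ultimately show ?case using insert by (simp add: finsum_insert Rep_add)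
qed

lemma Rep_finsum_support:
  assumes fin: "finite {A. c A \<noteq> 0}" and sub: "\<And>A. c A \<noteq> 0 \<Longrightarrow> A \<in> range Rep" and K: "\<And>A. c A \<in> K"
  shows "finsum Pr (\<lambda>A. psc Gen K Rel (c A) A) {A. c A \<noteq> 0} =
    Rep (\<Sum>v | c (Rep v) \<noteq> 0. sc (c (Rep v)) * v)" and "finite {v. c (Rep v) \<noteq> 0}"
proof -
  have eq: "{A. c A \<noteq> 0} = Rep ` {v. c (Rep v) \<noteq> 0}" using sub by blast
  show f: "finite {v. c (Rep v) \<noteq> 0}"
    using fin unfolding eq by (rule finite_imageD) (simp add: inj_on_def Rep_inject)
  show "finsum Pr (\<lambda>A. psc Gen K Rel (c A) A) {A. c A \<noteq> 0} =
    Rep (\<Sum>v | c (Rep v) \<noteq> 0. sc (c (Rep v)) * v)"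
    unfolding eq by (rule Rep_finsum[OF f]) (simp add: Rep_sc K)
qed

text \<open>Uniqueness of coefficients follows from independence applied to a difference of
  coefficient functions. The work lies in the transport: \<open>is_basis\<close> speaks of classes
  and \<open>finsum\<close>, the hypotheses of the type and its sums.\<close>

lemma is_basisI:
  assumes span: "\<And>y. \<exists>c. (\<forall>v. c v \<in> K) \<and> (\<forall>v. c v \<noteq> 0 \<longrightarrow> v \<in> B) \<and> finite {v. c v \<noteq> 0} \<and>
      y = (\<Sum>v | c v \<noteq> 0. sc (c v) * v)"
    and indep: "\<And>c v. (\<forall>v. c v \<in> K) \<Longrightarrow> (\<forall>v. c v \<noteq> 0 \<longrightarrow> v \<in> B) \<Longrightarrow> finite {v. c v \<noteq> 0} \<Longrightarrow>
      (\<Sum>v | c v \<noteq> 0. sc (c v) * v) = 0 \<Longrightarrow> c v = 0"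
  shows "is_basis Pr K (psc Gen K Rel) (Rep ` B)"
  unfolding is_basis_def
proof (intro conjI ballI)
  show "Rep ` B \<subseteq> carrier Pr" using Rep_carrier by blast
  fix A assume "A \<in> carrier Pr"
  then obtain y where A: "A = Rep y"
    using type_definition.Rep_range[OF td] by blast
  obtain c where c: "\<forall>v. c v \<in> K" "\<forall>v. c v \<noteq> 0 \<longrightarrow> v \<in> B" "finite {v. c v \<noteq> 0}"
    "y = (\<Sum>v | c v \<noteq> 0. sc (c v) * v)" using span by blast
  \<comment> \<open>Coefficient functions in \<open>is_basis\<close> are defined on all sets of free
    algebra elements, also on those that are not classes; there the support condition forces the
    value 0.\<close>
  define c' where "c' = (\<lambda>A. if A \<in> range Rep then c (Abs A) else 0)"
  have c'_Rep: "c' (Rep v) = c v" for v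
    by (simp add: c'_def type_definition.Rep_inverse[OF td])
  have c'_supp: "A \<in> range Rep" if "c' A \<noteq> 0" for A using that by (auto simp: c'_def split: if_splits)
  have eq: "{A. c' A \<noteq> 0} = Rep ` {v. c v \<noteq> 0}"
    using c'_supp by (force simp: c'_Rep)
  have fin: "finite {A. c' A \<noteq> 0}" unfolding eq using c(3) by simp
  have K: "c' A \<in> K" for A using c(1) K_zero by (simp add: c'_def)
  let ?P = "\<lambda>c. (\<forall>A. c A \<in> K) \<and> (\<forall>A. c A \<noteq> 0 \<longrightarrow> A \<in> Rep ` B) \<and> finite {A. c A \<noteq> 0} \<and>
      A = finsum Pr (\<lambda>A. psc Gen K Rel (c A) A) {A. c A \<noteq> 0}"
  have "A \<in> Rep ` B" if "c' A \<noteq> 0" for A using that eq c(2) by blast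
  then have P: "?P c'"
    using Rep_finsum_support(1)[of c', OF fin c'_supp K] K fin c(2,4) eq
    by (auto simp: c'_Rep A)
  have "c1 = c'" if "?P c1" for c1
  proof -
    have supp: "C \<in> range Rep" if "c1 C \<noteq> 0" for C using that \<open>?P c1\<close> by blast
    note s1 = Rep_finsum_support[of c1, OF _ supp] and s2 = Rep_finsum_support[OF fin c'_supp K]
    \<comment> \<open>A common finite support allows the two sums to be subtracted termwise.\<close>
    let ?S = "{v. c1 (Rep v) \<noteq> 0} \<union> {v. c' (Rep v) \<noteq> 0}"
    have S: "finite ?S" using s1(2) s2(2) \<open>?P c1\<close> by auto
    have "(\<Sum>v | c1 (Rep v) \<noteq> 0. sc (c1 (Rep v)) * v) = (\<Sum>v | c' (Rep v) \<noteq> 0. sc (c' (Rep v)) * v)"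
      using s1(1) s2(1) \<open>?P c1\<close> P by (simp flip: Rep_inject)
    moreover have "(\<Sum>v | c (Rep v) \<noteq> 0. sc (c (Rep v)) * v) = (\<Sum>v\<in>?S. sc (c (Rep v)) * v)"
      if "{v. c (Rep v) \<noteq> 0} \<subseteq> ?S" for c
      using S that by (intro sum.mono_neutral_left) (auto simp: can.\<iota>_zero)
    ultimately have eq: "(\<Sum>v\<in>?S. sc (c1 (Rep v)) * v) = (\<Sum>v\<in>?S. sc (c' (Rep v)) * v)" by simp
    define d where "d v = c1 (Rep v) - c' (Rep v)" for v
    have dK: "d v \<in> K" for v using K_add[OF _ K_neg, of "c1 (Rep v)" "c' (Rep v)"] K \<open>?P c1\<close> by (simp add: d_def)
    have dS: "{v. d v \<noteq> 0} \<subseteq> ?S" by (auto simp: d_def)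
    have "(\<Sum>v | d v \<noteq> 0. sc (d v) * v) = (\<Sum>v\<in>?S. sc (d v) * v)"
      using S dS by (intro sum.mono_neutral_left) (auto simp: can.\<iota>_zero)
    also have "sc (d v) = sc (c1 (Rep v)) - sc (c' (Rep v))" for v
      using sc_add[OF _ K_neg[OF K], of "c1 (Rep v)"] can.\<iota>_neg[OF K] \<open>?P c1\<close> by (simp add: d_def)
    then have "(\<Sum>v\<in>?S. sc (d v) * v) = 0"
      using eq by (simp add: left_diff_distrib sum_subtractf)
    finally have z: "(\<Sum>v | d v \<noteq> 0. sc (d v) * v) = 0" .
    have "d v = 0" for v
    proof (rule indep[OF _ _ _ z])
      show "\<forall>v. d v \<noteq> 0 \<longrightarrow> v \<in> B"
      proof (intro allI impI)
        fix v assume "d v \<noteq> 0"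
        then have "c1 (Rep v) \<noteq> 0 \<or> c' (Rep v) \<noteq> 0" by (auto simp: d_def)
        then have "Rep v \<in> Rep ` B" using \<open>?P c1\<close> P by blast
        then show "v \<in> B" by (auto simp: Rep_inject)
      qed
      show "finite {v. d v \<noteq> 0}" using S dS finite_subset by blast
    qed (use dK in blast)
    then have *: "c1 (Rep v) = c' (Rep v)" for v by (simp add: d_def)
    show ?thesis
    proof
      fix C show "c1 C = c' C"
        using * supp[of C] c'_supp[of C] by (metis rangeE)
    qed
  qed
  then show "\<exists>!c. ?P c" by (rule ex1I[of ?P, OF P])
qed

end

locale ring_typedef = ring M + type_definition Rep Abs "carrier M" for M :: "('a, 'm) ring_scheme" and Rep :: "'b \<Rightarrow> 'a" and Abs
begin

lemma Rep_carrier [simp]: "Rep x \<in> carrier M"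
  by (rule Rep)

text \<open>The ring class axioms as they appear after unfolding operations defined through
  \<open>Abs\<close> and \<open>Rep\<close>, proved once for the three instance proofs.\<close>

lemma typedef_axioms:
  "Abs (Rep (Abs (Rep a \<oplus>\<^bsub>M\<^esub> Rep b)) \<oplus>\<^bsub>M\<^esub> Rep c) = Abs (Rep a \<oplus>\<^bsub>M\<^esub> Rep (Abs (Rep b \<oplus>\<^bsub>M\<^esub> Rep c)))"
  "Abs (Rep a \<oplus>\<^bsub>M\<^esub> Rep b) = Abs (Rep b \<oplus>\<^bsub>M\<^esub> Rep a)"
  "Abs (Rep (Abs \<zero>\<^bsub>M\<^esub>) \<oplus>\<^bsub>M\<^esub> Rep a) = a"
  "Abs (Rep (Abs (\<ominus>\<^bsub>M\<^esub> Rep a)) \<oplus>\<^bsub>M\<^esub> Rep a) = Abs \<zero>\<^bsub>M\<^esub>"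
  "Abs (Rep a \<ominus>\<^bsub>M\<^esub> Rep b) = Abs (Rep a \<oplus>\<^bsub>M\<^esub> Rep (Abs (\<ominus>\<^bsub>M\<^esub> Rep b)))"
  "Abs (Rep (Abs (Rep a \<otimes>\<^bsub>M\<^esub> Rep b)) \<otimes>\<^bsub>M\<^esub> Rep c) = Abs (Rep a \<otimes>\<^bsub>M\<^esub> Rep (Abs (Rep b \<otimes>\<^bsub>M\<^esub> Rep c)))"
  "Abs (Rep (Abs (Rep a \<oplus>\<^bsub>M\<^esub> Rep b)) \<otimes>\<^bsub>M\<^esub> Rep c) =
    Abs (Rep (Abs (Rep a \<otimes>\<^bsub>M\<^esub> Rep c)) \<oplus>\<^bsub>M\<^esub> Rep (Abs (Rep b \<otimes>\<^bsub>M\<^esub> Rep c)))"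
  "Abs (Rep a \<otimes>\<^bsub>M\<^esub> Rep (Abs (Rep b \<oplus>\<^bsub>M\<^esub> Rep c))) =
    Abs (Rep (Abs (Rep a \<otimes>\<^bsub>M\<^esub> Rep b)) \<oplus>\<^bsub>M\<^esub> Rep (Abs (Rep a \<otimes>\<^bsub>M\<^esub> Rep c)))"
  "Abs (Rep (Abs \<one>\<^bsub>M\<^esub>) \<otimes>\<^bsub>M\<^esub> Rep a) = a"
  "Abs (Rep a \<otimes>\<^bsub>M\<^esub> Rep (Abs \<one>\<^bsub>M\<^esub>)) = a"
  by (simp add: Abs_inverse a_assoc, simp add: a_comm,
    simp_all add: Abs_inverse Rep_inverse m_assoc l_distr r_distr l_neg minus_eq)

end

lemma coefficient_ring_UNIV: "coefficient_ring UNIV"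
  by unfold_locales auto

lemma lookup_mult_sum:
  fixes p q :: "'a::comm_monoid_add \<Rightarrow>\<^sub>0 'b::comm_semiring_0"
  shows "Poly_Mapping.lookup (p * q) k = (\<Sum>i\<in>Poly_Mapping.keys p. \<Sum>j\<in>Poly_Mapping.keys q.
    Poly_Mapping.lookup p i * Poly_Mapping.lookup q j when i + j = k)"
proof -
  have "p * q = (\<Sum>i\<in>Poly_Mapping.keys p. \<Sum>j\<in>Poly_Mapping.keys q.
      Poly_Mapping.single (i + j) (Poly_Mapping.lookup p i * Poly_Mapping.lookup q j))"
    by (subst poly_mapping_sum_single[of p], subst poly_mapping_sum_single[of q])
      (simp add: sum_product mult_single)
  then show ?thesis by (simp add: lookup_sum lookup_single)
qed

lemma coefficient_ring_Rcoef: "coefficient_ring (Rcoef r)"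
proof
  show "a * b \<in> Rcoef r" if "a \<in> Rcoef r" "b \<in> Rcoef r" for a b
    using that by (auto simp: Rcoef_def lookup_mult_sum when_def intro!: Zrz_sum Zrz.mult Zrz_zero)
qed (auto simp: Rcoef_def lookup_one lookup_add when_def intro: Zrz.intros Zrz_zero)

lemma single_Rcoef: "c \<in> Zrz r \<Longrightarrow> Poly_Mapping.single k c \<in> Rcoef r"
  by (simp add: Rcoef_def lookup_single when_def Zrz_zero)

lemma qd_Rcoef: "qL - qLinv \<in> Rcoef r"
proof -
  interpret coefficient_ring "Rcoef r" by (rule coefficient_ring_Rcoef)
  show ?thesis
    using K_add[OF _ K_neg, of qL qLinv] by (simp add: qL_def qLinv_def single_Rcoef Zrz.one)
qed

definition main_statement :: "nat \<Rightarrow> nat \<Rightarrow> bool" where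
  "main_statement r n \<longleftrightarrow>
    (\<exists>\<phi>. \<phi> \<in> ring_iso (Yhat r n) (HhatR r n) \<and>
      (\<forall>c\<in>Rcoef r. \<forall>x\<in>carrier (Yhat r n). \<phi> (Ysc r n c x) = HRsc r n c (\<phi> x)))
    \<and> is_basis (Hhat r n) UNIV (Hsc r n) (Hbasis r n)"

text \<open>A type definition cannot depend on the variables r and n. Hence the quotient rings are turned
  into types only for one fixed pair, chosen to be a counterexample to the theorem if there is any;
  proving the theorem for this pair proves it for all pairs.\<close>

definition rn0 :: "nat \<times> nat" where
  "rn0 = (SOME p. 1 \<le> fst p \<and> 1 \<le> snd p \<and>
    (main_statement (fst p) (snd p) \<longrightarrow> (\<forall>r n. 1 \<le> r \<longrightarrow> 1 \<le> n \<longrightarrow> main_statement r n)))"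

definition r0 where "r0 = fst rn0"
definition n0 where "n0 = snd rn0"

lemma rn0: "1 \<le> r0" "1 \<le> n0"
    "main_statement r0 n0 \<Longrightarrow> 1 \<le> r \<Longrightarrow> 1 \<le> n \<Longrightarrow> main_statement r n"
proof -
  let ?P = "\<lambda>p. 1 \<le> fst p \<and> 1 \<le> snd p \<and>
    (main_statement (fst p) (snd p) \<longrightarrow> (\<forall>r n. 1 \<le> r \<longrightarrow> 1 \<le> n \<longrightarrow> main_statement r n))"
  have "\<exists>p. ?P p"
  proof (cases "\<forall>r n. 1 \<le> r \<longrightarrow> 1 \<le> n \<longrightarrow> main_statement r n")
    case True
    then show ?thesis by (intro exI[of _ "(1, 1)"]) simp
  next
    case False
    then obtain r n where "1 \<le> r" "1 \<le> n" "\<not> main_statement r n" by blast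
    \<comment> \<open>At a counterexample the implication in \<open>?P\<close> has a false
      premise.\<close>
    then show ?thesis by (intro exI[of _ "(r, n)"]) simp
  qed
  then have "?P rn0" unfolding rn0_def by (rule someI_ex)
  then show "1 \<le> r0" "1 \<le> n0"
    "main_statement r0 n0 \<Longrightarrow> 1 \<le> r \<Longrightarrow> 1 \<le> n \<Longrightarrow> main_statement r n"
    by (auto simp: r0_def n0_def)
qed

interpretation PHA: presentation "hgens r0 n0" UNIV "hrels r0 n0 (qL - qLinv :: int \<Rightarrow>\<^sub>0 int)"
  by (simp add: presentation_def presentation_axioms_def coefficient_ring_UNIV hrels_fa)

interpretation PHR: presentation "hgens r0 n0" "Rcoef r0" "hrels r0 n0 (qL - qLinv)"
  by (simp add: presentation_def presentation_axioms_def coefficient_ring_Rcoef hrels_fa qd_Rcoef)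

interpretation PYR: presentation "ygens n0" "Rcoef r0" "Yrels r0 n0"
  by (simp add: presentation_def presentation_axioms_def coefficient_ring_Rcoef Yrels_def yrels_fa
      qd_Rcoef single_Rcoef Zrz.invr)

typedef HA = "carrier (Hhat r0 n0)"
  using PHA.fa_zero by (auto simp: Hhat_def PHA.carrier_P)

typedef HR = "carrier (HhatR r0 n0)"
  using PHR.fa_zero by (auto simp: HhatR_def PHR.carrier_P)

typedef YR = "carrier (Yhat r0 n0)"
  using PYR.fa_zero by (auto simp: Yhat_def PYR.carrier_P)

interpretation THA: ring_typedef "Hhat r0 n0" Rep_HA Abs_HA
  using PHA.ring_P type_definition_HA by (simp add: ring_typedef_def Hhat_def)

interpretation THR: ring_typedef "HhatR r0 n0" Rep_HR Abs_HR
  using PHR.ring_P type_definition_HR by (simp add: ring_typedef_def HhatR_def)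

interpretation TYR: ring_typedef "Yhat r0 n0" Rep_YR Abs_YR
  using PYR.ring_P type_definition_YR by (simp add: ring_typedef_def Yhat_def)

instantiation HA :: "{ring,monoid_mult}"
begin
definition "x + y = Abs_HA (Rep_HA x \<oplus>\<^bsub>Hhat r0 n0\<^esub> Rep_HA y)"
definition "x - y = Abs_HA (Rep_HA x \<ominus>\<^bsub>Hhat r0 n0\<^esub> Rep_HA y)"
definition "- x = Abs_HA (\<ominus>\<^bsub>Hhat r0 n0\<^esub> Rep_HA x)"
definition "x * y = Abs_HA (Rep_HA x \<otimes>\<^bsub>Hhat r0 n0\<^esub> Rep_HA y)"
definition "0 = Abs_HA \<zero>\<^bsub>Hhat r0 n0\<^esub>"
definition "1 = Abs_HA \<one>\<^bsub>Hhat r0 n0\<^esub>"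
instance
  by standard (unfold plus_HA_def minus_HA_def uminus_HA_def times_HA_def zero_HA_def one_HA_def,
      (rule THA.typedef_axioms)+)
end

instantiation HR :: "{ring,monoid_mult}"
begin
definition "x + y = Abs_HR (Rep_HR x \<oplus>\<^bsub>HhatR r0 n0\<^esub> Rep_HR y)"
definition "x - y = Abs_HR (Rep_HR x \<ominus>\<^bsub>HhatR r0 n0\<^esub> Rep_HR y)"
definition "- x = Abs_HR (\<ominus>\<^bsub>HhatR r0 n0\<^esub> Rep_HR x)"
definition "x * y = Abs_HR (Rep_HR x \<otimes>\<^bsub>HhatR r0 n0\<^esub> Rep_HR y)"
definition "0 = Abs_HR \<zero>\<^bsub>HhatR r0 n0\<^esub>"
definition "1 = Abs_HR \<one>\<^bsub>HhatR r0 n0\<^esub>"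
instance
  by standard (unfold plus_HR_def minus_HR_def uminus_HR_def times_HR_def zero_HR_def one_HR_def,
      (rule THR.typedef_axioms)+)
end

instantiation YR :: "{ring,monoid_mult}"
begin
definition "x + y = Abs_YR (Rep_YR x \<oplus>\<^bsub>Yhat r0 n0\<^esub> Rep_YR y)"
definition "x - y = Abs_YR (Rep_YR x \<ominus>\<^bsub>Yhat r0 n0\<^esub> Rep_YR y)"
definition "- x = Abs_YR (\<ominus>\<^bsub>Yhat r0 n0\<^esub> Rep_YR x)"
definition "x * y = Abs_YR (Rep_YR x \<otimes>\<^bsub>Yhat r0 n0\<^esub> Rep_YR y)"
definition "0 = Abs_YR \<zero>\<^bsub>Yhat r0 n0\<^esub>"
definition "1 = Abs_YR \<one>\<^bsub>Yhat r0 n0\<^esub>"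
instance
  by standard (unfold plus_YR_def minus_YR_def uminus_YR_def times_YR_def zero_YR_def one_YR_def,
      (rule TYR.typedef_axioms)+)
end

interpretation HA: presented "hgens r0 n0" UNIV "hrels r0 n0 (qL - qLinv :: int \<Rightarrow>\<^sub>0 int)" Rep_HA Abs_HA
  by unfold_locales
    (use type_definition_HA in \<open>simp_all add: plus_HA_def times_HA_def one_HA_def Rep_HA Rep_HA_inverse Abs_HA_inverse THA.Abs_inverse flip: Hhat_def\<close>)

interpretation HR: presented "hgens r0 n0" "Rcoef r0" "hrels r0 n0 (qL - qLinv)" Rep_HR Abs_HR
  by unfold_locales
    (use type_definition_HR in \<open>simp_all add: plus_HR_def times_HR_def one_HR_def Rep_HR Rep_HR_inverse Abs_HR_inverse THR.Abs_inverse flip: HhatR_def\<close>)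

interpretation YR: presented "ygens n0" "Rcoef r0" "Yrels r0 n0" Rep_YR Abs_YR
  by unfold_locales
    (use type_definition_YR in \<open>simp_all add: plus_YR_def times_YR_def one_YR_def Rep_YR Rep_YR_inverse Abs_YR_inverse TYR.Abs_inverse flip: Yhat_def\<close>)

section \<open>The isomorphism\<close>

abbreviation \<kappa>H :: "complex \<Rightarrow> HR" where "\<kappa>H c \<equiv> HR.sc (Poly_Mapping.single 0 c)"
abbreviation \<kappa>Y :: "complex \<Rightarrow> YR" where "\<kappa>Y c \<equiv> YR.sc (Poly_Mapping.single 0 c)"

interpretation HRh: yokonuma_hecke r0 n0 "\<lambda>i. HR.gn (G i)" "\<lambda>l. HR.gn (E l)" "HR.gn X1" "HR.gn X1i" "HR.sc (qL - qLinv)"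
  by (rule hrels_imp_hecke[OF HR.can.evaluation_axioms rn0(1) qd_Rcoef HR.can_Rel])

interpretation HRr: hecke_roots r0 n0 "\<lambda>i. HR.gn (G i)" "\<lambda>l. HR.gn (E l)" "HR.gn X1" "HR.gn X1i" "HR.sc (qL - qLinv)" \<kappa>H
proof
  show "\<kappa>H (a + b) = \<kappa>H a + \<kappa>H b" if "a \<in> Zrz r0" "b \<in> Zrz r0" for a b
    using that by (simp add: single_add HR.sc_add single_Rcoef)
  show "\<kappa>H (a * b) = \<kappa>H a * \<kappa>H b" if "a \<in> Zrz r0" "b \<in> Zrz r0" for a b
    using that HR.sc_mult[of "Poly_Mapping.single 0 a" "Poly_Mapping.single 0 b"]
    by (simp add: mult_single single_Rcoef)
  show "\<kappa>H 1 = 1" by (simp add: HR.sc_one)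
  show "\<kappa>H a * v = v * \<kappa>H a" if "a \<in> Zrz r0" for a v
    using that by (intro HR.sc_comm single_Rcoef)
qed (rule rn0)

interpretation YRr: root_scalars r0 \<kappa>Y
proof
  show "\<kappa>Y (a + b) = \<kappa>Y a + \<kappa>Y b" if "a \<in> Zrz r0" "b \<in> Zrz r0" for a b
    using that by (simp add: single_add YR.sc_add single_Rcoef)
  show "\<kappa>Y (a * b) = \<kappa>Y a * \<kappa>Y b" if "a \<in> Zrz r0" "b \<in> Zrz r0" for a b
    using that YR.sc_mult[of "Poly_Mapping.single 0 a" "Poly_Mapping.single 0 b"]
    by (simp add: mult_single single_Rcoef)
  show "\<kappa>Y 1 = 1" by (simp add: YR.sc_one)
  show "\<kappa>Y a * v = v * \<kappa>Y a" if "a \<in> Zrz r0" for a v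
    using that by (intro YR.sc_comm single_Rcoef)
qed (rule rn0)

lemma rinv_Rcoef: "Poly_Mapping.single 0 (1 / of_nat r) \<in> Rcoef r"
  by (intro single_Rcoef Zrz.invr)

interpretation YRy: yokonuma r0 \<kappa>Y n0 "\<lambda>i. YR.gn (Hg i)" "\<lambda>j. YR.gn (T j)" "YR.gn Y1" "YR.gn Y1i" "YR.sc (qL - qLinv)"
  by (rule yrels_imp_yokonuma[where r = r0 and n = n0 and d = "qL - qLinv" and K = "Rcoef r0" and
        ri = "Poly_Mapping.single 0 (1 / of_nat r0)" and \<iota> = YR.sc and \<theta> = YR.gn and \<kappa> = \<kappa>Y, folded Yrels_def, OF YR.can.evaluation_axioms
        YRr.root_scalars_axioms qd_Rcoef rinv_Rcoef refl YR.can_Rel])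

fun y_to_h :: "ygen \<Rightarrow> HR" where
  "y_to_h (T j) = HRr.tD j"
| "y_to_h (Hg i) = HR.gn (G i)"
| "y_to_h Y1 = HR.gn X1"
| "y_to_h Y1i = HR.gn X1i"

fun h_to_y :: "hgen \<Rightarrow> YR" where
  "h_to_y (G i) = YR.gn (Hg i)"
| "h_to_y (E l) = YRy.ep l"
| "h_to_y X1 = YR.gn Y1"
| "h_to_y X1i = YR.gn Y1i"

interpretation \<Phi>: lifting_hom "ygens n0" "Rcoef r0" "Yrels r0 n0" Rep_YR Abs_YR HR.sc y_to_h
proof -
  interpret ev: evaluation "ygens n0" "Rcoef r0" "Yrels r0 n0" HR.sc y_to_h
    by unfold_locales (assumption | rule HR.sc_add HR.sc_mult HR.sc_one HR.sc_comm)+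
  have "yokonuma r0 \<kappa>H n0 (\<lambda>i. y_to_h (Hg i)) (\<lambda>j. y_to_h (T j)) (y_to_h Y1) (y_to_h Y1i) (HR.sc (qL - qLinv))"
    using HRr.yok.yokonuma_axioms by simp
  then have "feval HR.sc y_to_h \<rho> = 0" if "\<rho> \<in> Yrels r0 n0" for \<rho>
    using that by (rule yokonuma_imp_yrels[where r = r0 and n = n0 and d = "qL - qLinv" and K = "Rcoef r0" and
        ri = "Poly_Mapping.single 0 (1 / of_nat r0)" and \<iota> = HR.sc and \<theta> = y_to_h and \<kappa> = \<kappa>H, folded Yrels_def, OF ev.evaluation_axioms
          qd_Rcoef rinv_Rcoef refl])
  then show "lifting_hom (ygens n0) (Rcoef r0) (Yrels r0 n0) Rep_YR Abs_YR HR.sc y_to_h"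
    by (intro lifting_hom.intro YR.presented_axioms rel_evaluation.intro ev.evaluation_axioms
        rel_evaluation_axioms.intro)
qed

interpretation \<Psi>: lifting_hom "hgens r0 n0" "Rcoef r0" "hrels r0 n0 (qL - qLinv)" Rep_HR Abs_HR YR.sc h_to_y
proof -
  interpret ev: evaluation "hgens r0 n0" "Rcoef r0" "hrels r0 n0 (qL - qLinv)" YR.sc h_to_y
    by unfold_locales (assumption | rule YR.sc_add YR.sc_mult YR.sc_one YR.sc_comm)+
  have "yokonuma_hecke r0 n0 (\<lambda>i. h_to_y (G i)) (\<lambda>l. h_to_y (E l)) (h_to_y X1) (h_to_y X1i) (YR.sc (qL - qLinv))"
    using YRy.hecke.yokonuma_hecke_axioms by simp
  then have "feval YR.sc h_to_y \<rho> = 0" if "\<rho> \<in> hrels r0 n0 (qL - qLinv)" for \<rho>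
    using hecke_imp_hrels[OF ev.evaluation_axioms qd_Rcoef] that by blast
  then show "lifting_hom (hgens r0 n0) (Rcoef r0) (hrels r0 n0 (qL - qLinv)) Rep_HR Abs_HR YR.sc h_to_y"
    by (intro lifting_hom.intro HR.presented_axioms rel_evaluation.intro ev.evaluation_axioms
        rel_evaluation_axioms.intro)
qed

text \<open>It suffices to check generators. The only one that takes work is t_j, recovered from its
  spectral decomposition.\<close>

lemma \<Psi>_\<Phi>: "\<Psi>.lift (\<Phi>.lift x) = x"
proof (induction x rule: YR.presented_induct)
  case zero
  show ?case by (simp add: \<Phi>.lift_zero \<Psi>.lift_zero)
next
  case (step c u x)
  have gen: "\<Psi>.lift (\<Phi>.lift (YR.gn g)) = YR.gn g" if "g \<in> ygens n0" for g
  proof (cases g)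
    case (T j)
    then have j: "j - 1 < n0" "1 \<le> j" "Suc (j - 1) = j" using that by auto
    have "\<Psi>.lift (HRr.tD j) = (\<Sum>l\<in>lam r0 n0. \<kappa>Y (l ! (j - 1)) * YRy.ep l)"
      unfolding HRr.tD_def HRr.D_def \<Psi>.lift_sum
    proof (rule sum.cong)
      fix l assume l: "l \<in> lam r0 n0"
      have "l ! (j - 1) \<in> Zrz r0" by (rule YRr.root_Zrz[OF nth_lam[OF l j(1)]])
      then show "\<Psi>.lift (\<kappa>H (l ! (j - 1)) * HR.gn (E l)) = \<kappa>Y (l ! (j - 1)) * YRy.ep l"
        using l by (simp add: \<Psi>.lift_mult \<Psi>.lift_sc \<Psi>.lift_gn single_Rcoef)
    qed simp
    also have "\<dots> = YR.gn (T j)" using YRy.sum_\<kappa>_ep[OF j(1)] j(3) by simp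
    finally show ?thesis using T that by (simp add: \<Phi>.lift_gn)
  qed (use that in \<open>auto simp: \<Phi>.lift_gn \<Psi>.lift_gn\<close>)
  have "\<Psi>.lift (\<Phi>.lift (prod_list (map YR.gn u))) = prod_list (map YR.gn u)"
    using step(2) by (induction u) (auto simp: \<Phi>.lift_one \<Psi>.lift_one \<Phi>.lift_mult \<Psi>.lift_mult gen)
  then show ?case
    using step(1,3) by (simp add: \<Phi>.lift_add \<Psi>.lift_add \<Phi>.lift_mult \<Psi>.lift_mult \<Phi>.lift_sc \<Psi>.lift_sc)
qed

text \<open>A ring homomorphism compatible with the scalars commutes with the Fourier formula for
  the projections.\<close>

lemma \<Phi>_eps: "length ts = m \<Longrightarrow> l \<in> lam r0 m \<Longrightarrow> \<Phi>.lift (YRr.eps ts l) = HRr.eps (map \<Phi>.lift ts) l"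
proof (induction ts arbitrary: l m)
  case Nil
  then show ?case by (simp add: \<Phi>.lift_one)
next
  case (Cons t ts)
  then obtain z l' where l: "l = z # l'" "z \<in> roots r0" "l' \<in> lam r0 (length ts)"
    by (auto simp: lam_Suc)
  have "\<Phi>.lift (YRr.proj t z) = HRr.proj (\<Phi>.lift t) z"
    using l(2) by (simp add: YRr.proj_def HRr.proj_def \<Phi>.lift_mult \<Phi>.lift_sum \<Phi>.lift_power \<Phi>.lift_sc
        rinv_Rcoef single_Rcoef YRr.inverse_power_Zrz)
  then show ?case using Cons.IH[OF refl l(3)] by (simp add: l(1) \<Phi>.lift_mult)
qed

text \<open>\<Phi> sends t_j to the diagonal element \<open>tD\<close>, hence eigenprojections to
  eigenprojections, and \<open>ep_eq_es\<close> identifies the latter with the given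
  idempotents.\<close>

lemma \<Phi>_\<Psi>: "\<Phi>.lift (\<Psi>.lift x) = x"
proof (induction x rule: HR.presented_induct)
  case zero
  show ?case by (simp add: \<Phi>.lift_zero \<Psi>.lift_zero)
next
  case (step c u x)
  have gen: "\<Phi>.lift (\<Psi>.lift (HR.gn g)) = HR.gn g" if "g \<in> hgens r0 n0" for g
  proof (cases g)
    case (E l)
    then have l: "l \<in> lam r0 n0" using that by simp
    have "map \<Phi>.lift YRy.tl = HRr.yok.tl"
      by (rule nth_equalityI) (simp_all add: \<Phi>.lift_gn)
    then have "\<Phi>.lift (YRy.ep l) = HRr.yok.ep l"
      using \<Phi>_eps[OF YRy.tl_simps(1) l] by (simp add: YRy.ep_def HRr.yok.ep_def)
    then show ?thesis using E l by (simp add: \<Psi>.lift_gn HRr.ep_eq_es)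
  qed (use that in \<open>auto simp: \<Phi>.lift_gn \<Psi>.lift_gn\<close>)
  have "\<Phi>.lift (\<Psi>.lift (prod_list (map HR.gn u))) = prod_list (map HR.gn u)"
    using step(2) by (induction u) (auto simp: \<Phi>.lift_one \<Psi>.lift_one \<Phi>.lift_mult \<Psi>.lift_mult gen)
  then show ?case
    using step(1,3) by (simp add: \<Phi>.lift_add \<Psi>.lift_add \<Phi>.lift_mult \<Psi>.lift_mult \<Phi>.lift_sc \<Psi>.lift_sc)
qed

lemma ex_iso:
  "\<exists>\<phi>. \<phi> \<in> ring_iso (Yhat r0 n0) (HhatR r0 n0) \<and>
    (\<forall>c\<in>Rcoef r0. \<forall>x\<in>carrier (Yhat r0 n0). \<phi> (Ysc r0 n0 c x) = HRsc r0 n0 c (\<phi> x))"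
proof (intro exI conjI ballI)
  let ?\<phi> = "\<lambda>A. Rep_HR (\<Phi>.lift (Abs_YR A))"
  have \<phi>: "?\<phi> (Rep_YR x) = Rep_HR (\<Phi>.lift x)" for x by (simp add: Rep_YR_inverse)
  have car: "\<exists>x. A = Rep_YR x" if "A \<in> carrier (Yhat r0 n0)" for A
    using that by (metis Abs_YR_inverse)
  show "?\<phi> \<in> ring_iso (Yhat r0 n0) (HhatR r0 n0)"
    unfolding ring_iso_def
  proof (intro CollectI conjI ring_hom_memI)
    show "?\<phi> A \<in> carrier (HhatR r0 n0)" for A by (rule Rep_HR)
    fix A B assume "A \<in> carrier (Yhat r0 n0)" "B \<in> carrier (Yhat r0 n0)"
    then obtain x y where xy: "A = Rep_YR x" "B = Rep_YR y" using car by blast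
    show "?\<phi> (A \<otimes>\<^bsub>Yhat r0 n0\<^esub> B) = ?\<phi> A \<otimes>\<^bsub>HhatR r0 n0\<^esub> ?\<phi> B"
      unfolding xy using \<phi>[of "x * y"]
      by (simp add: Yhat_def HhatR_def Rep_YR_inverse \<Phi>.lift_mult HR.Rep_mult flip: YR.Rep_mult)
    show "?\<phi> (A \<oplus>\<^bsub>Yhat r0 n0\<^esub> B) = ?\<phi> A \<oplus>\<^bsub>HhatR r0 n0\<^esub> ?\<phi> B"
      unfolding xy using \<phi>[of "x + y"]
      by (simp add: Yhat_def HhatR_def Rep_YR_inverse \<Phi>.lift_add HR.Rep_add flip: YR.Rep_add)
  next
    show "?\<phi> \<one>\<^bsub>Yhat r0 n0\<^esub> = \<one>\<^bsub>HhatR r0 n0\<^esub>"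
      using \<phi>[of 1] by (simp add: Yhat_def HhatR_def \<Phi>.lift_one flip: YR.Rep_one HR.Rep_one)
    show "bij_betw ?\<phi> (carrier (Yhat r0 n0)) (carrier (HhatR r0 n0))"
      by (rule bij_betw_byWitness[of _ "\<lambda>A. Rep_YR (\<Psi>.lift (Abs_HR A))"])
        (auto simp: Rep_YR Rep_HR Rep_YR_inverse Rep_HR_inverse \<Psi>_\<Phi> \<Phi>_\<Psi> Abs_YR_inverse Abs_HR_inverse)
  qed
  fix c A assume c: "c \<in> Rcoef r0" and "A \<in> carrier (Yhat r0 n0)"
  then obtain x where x: "A = Rep_YR x" using car by blast
  show "?\<phi> (Ysc r0 n0 c A) = HRsc r0 n0 c (?\<phi> A)"
    unfolding x Ysc_def HRsc_def
    using c by (simp add: YR.Rep_sc HR.Rep_sc Rep_YR_inverse \<Phi>.lift_mult \<Phi>.lift_sc)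
qed

section \<open>The basis\<close>

interpretation HAh: yokonuma_hecke_scalars r0 n0 "\<lambda>i. HA.gn (G i)" "\<lambda>l. HA.gn (E l)" "HA.gn X1" "HA.gn X1i" HA.sc "qL - qLinv"
proof (intro yokonuma_hecke_scalars.intro yokonuma_hecke_scalars_axioms.intro)
  show "yokonuma_hecke r0 n0 (\<lambda>i. HA.gn (G i)) (\<lambda>l. HA.gn (E l)) (HA.gn X1) (HA.gn X1i) (HA.sc (qL - qLinv))"
    by (rule hrels_imp_hecke[OF HA.can.evaluation_axioms rn0(1) UNIV_I HA.can_Rel])
qed (rule HA.sc_add HA.sc_mult HA.sc_one HA.sc_comm; simp)+

lemma HA_span: "y \<in> lspan HA.sc HAh.standard"
proof (induction y rule: HA.presented_induct)
  case zero
  show ?case by (rule lspan.zero)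
next
  case (step c u x)
  have gen: "HA.gn g * s \<in> lspan HA.sc HAh.standard" if g: "g \<in> hgens r0 n0" and s: "s \<in> lspan HA.sc HAh.standard" for g s
  proof (cases g)
    case (G i)
    then obtain j where "i = Suc j" "Suc j < n0" using g by (cases i) auto
    then show ?thesis using HAh.g_mult_standard[of j s] s G by simp
  next
    case (E l)
    then show ?thesis using HAh.Psub_mult_standard[OF HAh.Psub.e s] g by simp
  next
    case X1
    have "HAh.Xp 0 \<in> HAh.Psub" using rn0(2) by (intro HAh.Psub.X) simp
    then show ?thesis using HAh.Psub_mult_standard[OF _ s] X1 by simp
  next
    case X1i
    have "HAh.Xq 0 \<in> HAh.Psub" using rn0(2) by (intro HAh.Psub.Xi) simp
    then show ?thesis using HAh.Psub_mult_standard[OF _ s] X1i by simp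
  qed
  have "prod_list (map HA.gn u) \<in> lspan HA.sc HAh.standard"
    using step(2) by (induction u) (auto simp: HAh.one_standard gen)
  then show ?case
    using step(3) by (intro lspan_add HAh.Psub_mult_standard HAh.Psub.sc)
qed

lemma lspan_coefficients:
  fixes sc :: "'k::comm_ring_1 \<Rightarrow> 'b::{ring,monoid_mult}"
  assumes "y \<in> lspan sc B" "\<And>a b. sc (a + b) = sc a + sc b"
  shows "\<exists>c. (\<forall>v. c v \<noteq> 0 \<longrightarrow> v \<in> B) \<and> finite {v. c v \<noteq> 0} \<and> y = (\<Sum>v | c v \<noteq> 0. sc (c v) * v)"
  using assms(1)
proof (induction rule: lspan.induct)
  case zero
  show ?case by (rule exI[of _ "\<lambda>_. 0"]) simp
next
  case (step b s a)
  then obtain c where c: "\<forall>v. c v \<noteq> 0 \<longrightarrow> v \<in> B" "finite {v. c v \<noteq> 0}" "s = (\<Sum>v | c v \<noteq> 0. sc (c v) * v)"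
    by blast
  have sc0: "sc 0 = 0" using assms(2)[of 0 0] by simp
  \<comment> \<open>The element b may be new or its coefficient may cancel, so all sums are taken
    over this superset of the support.\<close>
  let ?S = "insert b {v. c v \<noteq> 0}" and ?c = "c(b := c b + a)"
  have S: "finite ?S" using c(2) by simp
  have sub: "{v. ?c v \<noteq> 0} \<subseteq> ?S" by auto
  have "(\<Sum>v | ?c v \<noteq> 0. sc (?c v) * v) = (\<Sum>v\<in>?S. sc (?c v) * v)"
    using S sub by (intro sum.mono_neutral_left) (auto simp: sc0)
  also have "\<dots> = sc (c b + a) * b + (\<Sum>v\<in>?S - {b}. sc (c v) * v)"
    using S by (subst sum.remove[of _ b]) auto
  also have "\<dots> = sc a * b + (\<Sum>v\<in>?S. sc (c v) * v)"
    using S by (subst (2) sum.remove[of _ b]) (auto simp: assms(2) distrib_right algebra_simps)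
  also have "(\<Sum>v\<in>?S. sc (c v) * v) = s"
    unfolding c(3) using S by (intro sum.mono_neutral_right) (auto simp: sc0)
  finally show ?case
    using c(1) step(1) finite_subset[OF sub S] by (intro exI[of _ ?c]) auto
qed

section \<open>Generic points and the operator representation of the algebra\<close>

typedef pt = "{(t, x, l). generic n0 t x \<and> l \<in> lam r0 n0}"
proof -
  \<comment> \<open>Base 3 is the least one that \<open>generic_powers\<close> admits, and t = 2 is
    one choice above 1.\<close>
  have "generic n0 2 (\<lambda>i. 2 powi (3 ^ i))" by (rule generic_powers) auto
  moreover have "replicate n0 1 \<in> lam r0 n0" by (simp add: lam_def)
  ultimately show ?thesis by blast
qed

definition pt_t where "pt_t p = fst (Rep_pt p)"
definition pt_x where "pt_x p = fst (snd (Rep_pt p))"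
definition pt_l where "pt_l p = snd (snd (Rep_pt p))"
definition pt_act where "pt_act i p = Abs_pt (pt_t p, pt_x p \<circ> sw i, slam i (pt_l p))"

lemma generic_sw:
  assumes i: "1 \<le> i" "i < n" and g: "generic n t x"
  shows "generic n t (x \<circ> sw i)"
proof -
  have "sw i j \<in> {1..n}" if "j \<in> {1..n}" for j using sw_range[OF i] that by auto
  moreover have "sw i j \<noteq> sw i k" if "j \<noteq> k" for j k using that by (metis sw_sw)
  ultimately show ?thesis using g unfolding generic_def o_apply by blast
qed

lemma pt_Abs:
  assumes "generic n0 t x" "l \<in> lam r0 n0"
  shows "pt_t (Abs_pt (t, x, l)) = t" "pt_x (Abs_pt (t, x, l)) = x" "pt_l (Abs_pt (t, x, l)) = l"
  using assms by (simp_all add: pt_t_def pt_x_def pt_l_def Abs_pt_inverse)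

lemma pt_props: "generic n0 (pt_t p) (pt_x p)" "pt_l p \<in> lam r0 n0"
  using Rep_pt[of p] by (auto simp: pt_t_def pt_x_def pt_l_def)

interpretation pts: generic_points r0 n0 pt_t pt_x pt_l pt_act
proof
  show "generic n0 (pt_t p) (pt_x p)" "pt_l p \<in> lam r0 n0" for p by (fact pt_props)+
  show "p = p'" if "pt_t p = pt_t p'" "pt_x p = pt_x p'" "pt_l p = pt_l p'" for p p'
    using that unfolding pt_t_def pt_x_def pt_l_def by (metis Rep_pt_inject prod_eqI)
  show "pt_t (pt_act i p) = pt_t p" "pt_x (pt_act i p) = pt_x p \<circ> sw i" "pt_l (pt_act i p) = slam i (pt_l p)"
    if "1 \<le> i" "i < n0" for i p
    unfolding pt_act_def using pt_Abs[OF generic_sw[OF that pt_props(1)] slam_lam[OF that pt_props(2)]]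
    by blast+
  show "\<exists>p. pt_t p = t \<and> pt_x p = x \<and> pt_l p = l" if "generic n0 t x" "l \<in> lam r0 n0" for t x l
    using pt_Abs[OF that] by blast
qed (rule rn0)+

fun rep_gen :: "hgen \<Rightarrow> pt op" where
  "rep_gen (G i) = pts.gop i"
| "rep_gen (E l) = pts.eop l"
| "rep_gen X1 = pts.xop (Suc 0)"
| "rep_gen X1i = mop (\<lambda>p. 1 / pt_x p (Suc 0))"

definition rep_sc :: "(int \<Rightarrow>\<^sub>0 int) \<Rightarrow> pt op" where
  "rep_sc c = mop (\<lambda>p. evl (pt_t p) c)"

interpretation \<rho>: lifting_hom "hgens r0 n0" UNIV "hrels r0 n0 (qL - qLinv :: int \<Rightarrow>\<^sub>0 int)" Rep_HA Abs_HA rep_sc rep_gen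
proof -
  interpret ev: evaluation "hgens r0 n0" UNIV "hrels r0 n0 (qL - qLinv :: int \<Rightarrow>\<^sub>0 int)" rep_sc rep_gen
  proof unfold_locales
    show "rep_sc (a + b) = rep_sc a + rep_sc b" for a b by (simp add: rep_sc_def evl_add mop_add)
    show "rep_sc (a * b) = rep_sc a * rep_sc b" for a b
      by (simp add: rep_sc_def evl_mult pts.tv_pos mop_mult)
    show "rep_sc 1 = 1" by (simp add: rep_sc_def evl_one mop_one)
    show "rep_sc c * rep_gen g = rep_gen g * rep_sc c" if "g \<in> hgens r0 n0" for c g
    proof (cases g)
      case (G i)
      then show ?thesis using that
        by (auto intro!: op_eqI simp: rep_sc_def app_simps app_mop pts.app_gop pts.tv_act algebra_simps)
    qed (auto intro!: op_eqI simp: rep_sc_def app_simps app_mop pts.eop_def pts.xop_def)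
  qed
  have "yokonuma_hecke r0 n0 (\<lambda>i. rep_gen (G i)) (\<lambda>l. rep_gen (E l)) (rep_gen X1) (rep_gen X1i)
      (rep_sc (qL - qLinv))"
    using pts.ops.yokonuma_hecke_axioms by (simp add: rep_sc_def evl_qd)
  then have "feval rep_sc rep_gen \<rho> = 0" if "\<rho> \<in> hrels r0 n0 (qL - qLinv)" for \<rho>
    using hecke_imp_hrels[OF ev.evaluation_axioms UNIV_I] that by blast
  then show "lifting_hom (hgens r0 n0) UNIV (hrels r0 n0 (qL - qLinv)) Rep_HA Abs_HA rep_sc rep_gen"
    by (intro lifting_hom.intro HA.presented_axioms rel_evaluation.intro ev.evaluation_axioms
        rel_evaluation_axioms.intro)
qed

lemma \<rho>_diff: "\<rho>.lift (x - y) = \<rho>.lift x - \<rho>.lift y"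
  using \<rho>.lift_add[of "x - y" y] by simp

lemma \<rho>_gi: "1 \<le> i \<Longrightarrow> i < n0 \<Longrightarrow> \<rho>.lift (HAh.gi i) = pts.ops.gi i"
  by (simp add: HAh.gi_def pts.ops.gi_def HAh.ee_def pts.ops.ee_def \<rho>_diff \<rho>.lift_mult \<rho>.lift_sum
      \<rho>.lift_gn \<rho>.lift_sc rep_sc_def evl_qd)

lemma \<rho>_Xp: "i < n0 \<Longrightarrow> \<rho>.lift (HAh.Xp i) = pts.ops.Xp i"
  by (induction i) (simp_all add: \<rho>.lift_mult \<rho>.lift_gn)

lemma \<rho>_Xq: "i < n0 \<Longrightarrow> \<rho>.lift (HAh.Xq i) = pts.ops.Xq i"
  by (induction i) (simp_all add: \<rho>.lift_mult \<rho>.lift_gn \<rho>_gi)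

lemma \<rho>_standard:
  assumes "l \<in> lam r0 n0" "w permutes {1..n0}"
  shows "\<rho>.lift (HAh.mon \<alpha> * HA.gn (E l) * HAh.gw w) = pts.ops.mon \<alpha> * pts.eop l * pts.ops.gw w"
proof -
  have "\<rho>.lift (HAh.mon \<alpha>) = pts.ops.mon \<alpha>"
    unfolding HAh.mon_def pts.ops.mon_def \<rho>.lift_prod_list map_map
    by (rule arg_cong[of _ _ prod_list], rule map_cong)
      (auto simp: HAh.xpw_def pts.ops.xpw_def \<rho>.lift_power \<rho>_Xp \<rho>_Xq)
  moreover have "\<rho>.lift (HAh.gw w) = pts.ops.gw w"
    unfolding HAh.gw_def pts.ops.gw_def \<rho>.lift_prod_list map_map
    using reduced_redword[OF assms(2)]
    by (intro arg_cong[of _ _ prod_list] map_cong) (auto simp: reduced_def letters_def \<rho>.lift_gn)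
  ultimately show ?thesis using assms(1) by (simp add: \<rho>.lift_mult \<rho>.lift_gn)
qed

lemma HA_independent:
  assumes sub: "\<forall>v. c v \<noteq> 0 \<longrightarrow> v \<in> HAh.standard" and fin: "finite {v. c v \<noteq> 0}"
    and zero: "(\<Sum>v | c v \<noteq> 0. HA.sc (c v) * v) = 0"
  shows "c v = 0"
proof -
  define ix where "ix = {(\<alpha>::int list, l, w). length \<alpha> = n0 \<and> l \<in> lam r0 n0 \<and> w permutes {1..n0}}"
  define b where "b = (\<lambda>(\<alpha>, l, w). HAh.mon \<alpha> * HA.gn (E l) * HAh.gw w)"
  have "\<forall>v\<in>{v. c v \<noteq> 0}. \<exists>j. j \<in> ix \<and> b j = v"
  proof
    fix v assume "v \<in> {v. c v \<noteq> 0}"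
    then obtain \<alpha> l w where "v = b (\<alpha>, l, w)" "(\<alpha>, l, w) \<in> ix"
      using sub unfolding HAh.standard_def ix_def b_def by auto
    then show "\<exists>j. j \<in> ix \<and> b j = v" by blast
  qed
  \<comment> \<open>Elements of \<open>HAh.standard\<close> are not yet known to have a unique
    index, so one index is chosen for each element of the support. The choice is injective because b
    inverts it.\<close>
  from bchoice[OF this] obtain j where j: "\<And>v. c v \<noteq> 0 \<Longrightarrow> j v \<in> ix \<and> b (j v) = v" by blast
  let ?F = "j ` {v. c v \<noteq> 0}"
  have inj: "inj_on j {v. c v \<noteq> 0}" by (rule inj_onI) (metis j mem_Collect_eq)
  have "0 = \<rho>.lift (\<Sum>v | c v \<noteq> 0. HA.sc (c v) * v)" by (simp add: zero \<rho>.lift_zero)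
  also have "\<dots> = (\<Sum>v | c v \<noteq> 0. rep_sc (c (b (j v))) * \<rho>.lift (b (j v)))"
    unfolding \<rho>.lift_sum by (rule sum.cong) (auto simp: j \<rho>.lift_mult \<rho>.lift_sc)
  also have "\<dots> = (\<Sum>i\<in>?F. rep_sc (c (b i)) * \<rho>.lift (b i))"
    by (simp add: sum.reindex[OF inj])
  also have "\<dots> = (\<Sum>(\<alpha>, l, w)\<in>?F. mop (\<lambda>p. evl (pt_t p) ((c \<circ> b) (\<alpha>, l, w))) *
      (pts.ops.mon \<alpha> * pts.eop l * pts.ops.gw w))"
  proof (rule sum.cong)
    fix i assume "i \<in> ?F"
    then have "i \<in> ix" using j by auto
    then obtain \<alpha> l w where i: "i = (\<alpha>, l, w)" "l \<in> lam r0 n0" "w permutes {1..n0}"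
      by (auto simp: ix_def)
    have "\<rho>.lift (b i) = pts.ops.mon \<alpha> * pts.eop l * pts.ops.gw w"
      using \<rho>_standard[OF i(2,3)] by (simp add: b_def i(1))
    then show "rep_sc (c (b i)) * \<rho>.lift (b i) = (case i of (\<alpha>, l, w) \<Rightarrow>
        mop (\<lambda>p. evl (pt_t p) ((c \<circ> b) (\<alpha>, l, w))) * (pts.ops.mon \<alpha> * pts.eop l * pts.ops.gw w))"
      by (simp add: i(1) rep_sc_def)
  qed simp
  finally have sum0: "(\<Sum>(\<alpha>, l, w)\<in>?F. mop (\<lambda>p. evl (pt_t p) ((c \<circ> b) (\<alpha>, l, w))) *
      (pts.ops.mon \<alpha> * pts.eop l * pts.ops.gw w)) = 0" by (rule sym)
  show ?thesis
  proof (rule ccontr)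
    assume v: "c v \<noteq> 0"
    have "?F \<subseteq> ix" using j by blast
    then have "(c \<circ> b) (j v) = 0"
      unfolding ix_def using fin v by (intro pts.standard_independent[OF _ _ sum0]) auto
    then show False using v j by simp
  qed
qed

section \<open>Comparison with the basis elements of the statement\<close>

lemma hg_HA: "g \<in> hgens r0 n0 \<Longrightarrow> hg r0 n0 g = Rep_HA (HA.gn g)"
  by (simp add: hg_def HA.Rep_gn)

lemma HX_HA: "i < n0 \<Longrightarrow> HX r0 n0 (Suc i) = Rep_HA (HAh.Xp i)"
  by (induction i) (simp_all add: hg_HA HA.Rep_mult Hhat_def)

text \<open>A negative power of a monoid element is the inverse of a natural power. It equals a
  power of \<open>Xq\<close> because equal powers of mutually inverse elements are again inverse to
  each other.\<close>

lemma HX_power_HA: "i < n0 \<Longrightarrow> HX r0 n0 (Suc i) [^]\<^bsub>Hhat r0 n0\<^esub> (k::int) = Rep_HA (HAh.xpw i k)"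
proof -
  assume i: "i < n0"
  have inv: "HAh.Xp i ^ m * HAh.Xq i ^ m = 1 \<and> HAh.Xq i ^ m * HAh.Xp i ^ m = 1" for m
  proof (induction m)
    case (Suc m)
    have "HAh.Xp i ^ Suc m * HAh.Xq i ^ Suc m = HAh.Xp i * (HAh.Xp i ^ m * HAh.Xq i ^ m) * HAh.Xq i"
      "HAh.Xq i ^ Suc m * HAh.Xp i ^ Suc m = HAh.Xq i * (HAh.Xq i ^ m * HAh.Xp i ^ m) * HAh.Xp i"
      by (simp only: power_Suc[of "HAh.Xp i"] power_Suc2[of "HAh.Xq i"] mult.assoc,
          simp only: power_Suc[of "HAh.Xq i"] power_Suc2[of "HAh.Xp i"] mult.assoc)
    then show ?case using Suc HAh.Xp_Xq[OF i] by simp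
  qed simp
  show ?thesis
    unfolding HX_HA[OF i] int_pow_def2 HAh.xpw_def Hhat_def HA.Rep_power
      HA.Rep_m_inv[OF conjunct1[OF inv] conjunct2[OF inv]] by simp
qed

lemma Hbasis_HA: "Hbasis r0 n0 = Rep_HA ` HAh.standard"
proof -
  have elt: "rprod (Hhat r0 n0) (map (\<lambda>i. HX r0 n0 i [^]\<^bsub>Hhat r0 n0\<^esub> ((\<alpha>::int list) ! (i - 1))) [1..<Suc n0])
      \<otimes>\<^bsub>Hhat r0 n0\<^esub> hg r0 n0 (E l) \<otimes>\<^bsub>Hhat r0 n0\<^esub> Hgw r0 n0 w
    = Rep_HA (HAh.mon \<alpha> * HA.gn (E l) * HAh.gw w)"
    if "l \<in> lam r0 n0" "w permutes {1..n0}" for \<alpha> l w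
  proof -
    have "map (\<lambda>i. HX r0 n0 i [^]\<^bsub>Hhat r0 n0\<^esub> (\<alpha> ! (i - 1))) [1..<Suc n0] =
        map Rep_HA (map (\<lambda>i. HAh.xpw i (\<alpha> ! i)) [0..<n0])"
      \<comment> \<open>The index range 1, ..., n of the statement is shifted to 0, ..., n -
        1.\<close>
      unfolding One_nat_def map_Suc_upt[symmetric] map_map
      by (rule map_cong) (simp_all add: HX_power_HA)
    then have mon: "rprod (Hhat r0 n0) (map (\<lambda>i. HX r0 n0 i [^]\<^bsub>Hhat r0 n0\<^esub> (\<alpha> ! (i - 1))) [1..<Suc n0]) =
        Rep_HA (HAh.mon \<alpha>)"
      using HA.Rep_prod_list by (simp only: HAh.mon_def Hhat_def)
    have "map (\<lambda>i. hg r0 n0 (G i)) (redword n0 w) = map Rep_HA (map (\<lambda>i. HA.gn (G i)) (redword n0 w))"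
      unfolding map_map using reduced_redword[OF that(2)]
      by (intro map_cong) (auto simp: reduced_def letters_def hg_HA)
    then have gw: "Hgw r0 n0 w = Rep_HA (HAh.gw w)"
      using HA.Rep_prod_list by (simp only: Hgw_def HAh.gw_def Hhat_def)
    show ?thesis using that(1) unfolding mon gw by (simp add: hg_HA HA.Rep_mult Hhat_def)
  qed
  show ?thesis
  proof
    show "Hbasis r0 n0 \<subseteq> Rep_HA ` HAh.standard"
      unfolding Hbasis_def HAh.standard_def using elt by blast
    show "Rep_HA ` HAh.standard \<subseteq> Hbasis r0 n0"
      unfolding Hbasis_def HAh.standard_def using elt[symmetric] by fast
  qed
qed

lemma basis: "is_basis (Hhat r0 n0) UNIV (Hsc r0 n0) (Hbasis r0 n0)"
  unfolding Hbasis_HA Hhat_def Hsc_def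
proof (rule HA.is_basisI)
  fix y
  show "\<exists>c. (\<forall>v. c v \<in> UNIV) \<and> (\<forall>v. c v \<noteq> 0 \<longrightarrow> v \<in> HAh.standard) \<and> finite {v. c v \<noteq> 0} \<and>
      y = (\<Sum>v | c v \<noteq> 0. HA.sc (c v) * v)"
    using lspan_coefficients[OF HA_span HAh.sc_add] by simp
qed (rule HA_independent)

theorem theorem3p3:
  fixes r n :: nat
  assumes "1 \<le> r" and "1 \<le> n"
  shows "(\<exists>\<phi>. \<phi> \<in> ring_iso (Yhat r n) (HhatR r n) \<and>
            (\<forall>c\<in>Rcoef r. \<forall>x\<in>carrier (Yhat r n). \<phi> (Ysc r n c x) = HRsc r n c (\<phi> x)))
       \<and> is_basis (Hhat r n) UNIV (Hsc r n) (Hbasis r n)"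
proof -
  have "main_statement r0 n0" unfolding main_statement_def using ex_iso basis by blast
  from rn0(3)[OF this assms] show ?thesis unfolding main_statement_def .
qed

end
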